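(* Fix $d\ge 1$. For $L\ge 1$ let $N=L^d$, let $q_N\in[0,1]$, $p_N=1-q_N$, and let $X_L=X_L^d(q_N)$ be bond percolation on the torus $T_L^d$ with retention probability $q_N$. Put $\eta_N=\min\{p_N,q_N\}$. Let $f:\mathbb N\to\mathbb N$ be integer-valued. Assume that $\eta_N>0$ eventually, $f(N)\to\infty$, and $$f(N)\log(1/\eta_N)=o(\log N)\qquad (L\to\infty).$$ Then $Y_L=\mathrm{Prune}_{f(N)}(X_L)$ has a first-order zero--one law (as $L\to\infty$). Its almost-sure first-order theory (the set of first-order sentences $\varphi$ with $\mathbb P(Y_L\models\varphi)\to1$) is determined by the following axiom schemes, i.e. they belong to it and axiomatize it: (i) the maximum degree is at most $2d$, and, for every $r\ge 0$ and every rooted $r$-ball type $\tau$ that is not a $d$-lattice type, no vertex has rooted $r$-ball type $\tau$; (ii) for each $m\ge 1$, there is no connected component of size exactly $m$; (iii) for every $r\ge 0$, every rooted $r$-ball type $\tau$ realized at a vertex of an infinite component of a subgraph of $\mathbb Z^d$, and every $h\ge 1$, there are at least $h$ distinct vertices with rooted $r$-ball type $\tau$. Each item is a genuine first-order scheme: bounded degree, a fixed finite rooted ball type, the existence of a component of a fixed finite size, and the existence of $h$ distinct realizations of a fixed type are all first-order expressible.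
   Context: $T_L^d=(\mathbb Z/L\mathbb Z)^d$ is the (simple) graph in which two vertices are adjacent if they differ by $1$ or $-1$ modulo $L$ in exactly one coordinate and agree in all other coordinates; it has $N=L^d$ vertices. $X_L^d(q_N)$ is the random subgraph of $T_L^d$ on the full vertex set in which each edge is retained with probability $q_N$ and omitted with probability $p_N=1-q_N$, independently. $L$ ranges over all positive integers and asymptotics are as $L\to\infty$. $\mathbb N$ denotes the positive integers. For a finite graph $G$ and an integer $m\ge1$, $\mathrm{Prune}_m(G)$ is the subgraph of $G$ induced on $\{v\in V(G):|C_G(v)|\ge m\}$, where $C_G(v)$ is the connected component of $v$. For a graph $G$, a vertex $v$ and $r\ge0$, $B_G(v,r)$ is the induced subgraph on the vertices at graph distance (in $G$) at most $r$ from $v$, rooted at $v$. A rooted $r$-ball type is an isomorphism type of finite rooted graphs all of whose vertices are at distance at most $r$ from the root; $v$ has rooted $r$-ball type $\tau$ in $G$ if $B_G(v,r)\cong\tau$ as rooted graphs. $\mathbb Z^d$ also denotes the usual nearest-neighbor lattice graph. A rooted $r$-ball type $\tau$ is a $d$-lattice type if $B_X(0,r)\cong\tau$ for some subgraph $X\subseteq\mathbb Z^d$. The first-order language of graphs has one binary symbol $E$ (symmetric irreflexive adjacency). A first-order zero--one law means that for every first-order sentence $\varphi$, $\mathbb P(Y_L\models\varphi)$ converges to $0$ or to $1$. *)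

theory Defs
  imports
    "HOL-Probability.Probability"
    "HOL-Number_Theory.Cong"
    "HOL-Library.Landau_Symbols"
    "HOL-Library.Extended_Nat"
    "HOL-Library.Infinite_Typeclass"
begin

record 'a ugraph =
  verts :: "'a set"
  edges :: "'a set set"

definition simple_graph :: "'a ugraph \<Rightarrow> bool" where
  "simple_graph G \<longleftrightarrow> (\<forall>e\<in>edges G. \<exists>u\<in>verts G. \<exists>v\<in>verts G. u \<noteq> v \<and> e = {u, v})"

definition adj :: "'a ugraph \<Rightarrow> 'a \<Rightarrow> 'a \<Rightarrow> bool" where
  "adj G u v \<longleftrightarrow> {u, v} \<in> edges G"

definition neighbours :: "'a ugraph \<Rightarrow> 'a \<Rightarrow> 'a set" where
  "neighbours G v = {w\<in>verts G. adj G v w}"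

definition subgraph :: "'a ugraph \<Rightarrow> 'a ugraph \<Rightarrow> bool" where
  "subgraph H G \<longleftrightarrow> simple_graph H \<and> verts H \<subseteq> verts G \<and> edges H \<subseteq> edges G"

definition induced_subgraph :: "'a ugraph \<Rightarrow> 'a set \<Rightarrow> 'a ugraph" where
  "induced_subgraph G W = \<lparr>verts = verts G \<inter> W, edges = {e\<in>edges G. e \<subseteq> W}\<rparr>"

definition adj_rel :: "'a ugraph \<Rightarrow> ('a \<times> 'a) set" where
  "adj_rel G = {(u, v). adj G u v}"

definition component :: "'a ugraph \<Rightarrow> 'a \<Rightarrow> 'a set" where
  "component G v = {w\<in>verts G. (v, w) \<in> (adj_rel G)\<^sup>*}"

text \<open>The value is \<open>\<infinity>\<close> if there is no walk from \<open>u\<close> to \<open>v\<close>.\<close>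

definition gdist :: "'a ugraph \<Rightarrow> 'a \<Rightarrow> 'a \<Rightarrow> enat" where
  "gdist G u v = Inf {enat n | n. (u, v) \<in> adj_rel G ^^ n}"

text \<open>Meant for finite graphs only: an infinite component has \<open>card\<close> equal to 0.\<close>

definition prune :: "nat \<Rightarrow> 'a ugraph \<Rightarrow> 'a ugraph" where
  "prune m G = induced_subgraph G {v\<in>verts G. card (component G v) \<ge> m}"

definition ball_graph :: "'a ugraph \<Rightarrow> 'a \<Rightarrow> nat \<Rightarrow> 'a ugraph" where
  "ball_graph G v r = induced_subgraph G {w\<in>verts G. gdist G v w \<le> enat r}"

definition rooted_iso :: "'a ugraph \<Rightarrow> 'a \<Rightarrow> 'b ugraph \<Rightarrow> 'b \<Rightarrow> bool" where
  "rooted_iso G u H v \<longleftrightarrow>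
     (\<exists>f. bij_betw f (verts G) (verts H) \<and> f u = v \<and>
          (\<forall>x\<in>verts G. \<forall>y\<in>verts G. adj G x y \<longleftrightarrow> adj H (f x) (f y)))"

text \<open>
  A ball type is given by a representative \<open>(T, t)\<close> with vertices in \<open>nat\<close>; every finite rooted
  graph is isomorphic to such a representative.
\<close>

definition ball_type :: "nat \<Rightarrow> nat ugraph \<Rightarrow> nat \<Rightarrow> bool" where
  "ball_type r T t \<longleftrightarrow> simple_graph T \<and> finite (verts T) \<and> t \<in> verts T \<and>
     (\<forall>w\<in>verts T. gdist T t w \<le> enat r)"

definition has_ball_type :: "'a ugraph \<Rightarrow> 'a \<Rightarrow> nat \<Rightarrow> nat ugraph \<Rightarrow> nat \<Rightarrow> bool" where
  "has_ball_type G v r T t \<longleftrightarrow> v \<in> verts G \<and> rooted_iso (ball_graph G v r) v T t"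

definition lattice :: "nat \<Rightarrow> (nat \<Rightarrow> int) ugraph" where
  "lattice d =
    \<lparr>verts = {..<d} \<rightarrow>\<^sub>E UNIV,
     edges = {{x, y} | x y. x \<in> {..<d} \<rightarrow>\<^sub>E UNIV \<and> y \<in> {..<d} \<rightarrow>\<^sub>E UNIV \<and>
       (\<exists>i<d. \<bar>x i - y i\<bar> = 1 \<and> (\<forall>j<d. j \<noteq> i \<longrightarrow> x j = y j))}\<rparr>"

definition lattice_origin :: "nat \<Rightarrow> nat \<Rightarrow> int" where
  "lattice_origin d = (\<lambda>i\<in>{..<d}. 0)"

text \<open>
  Residues modulo \<open>L\<close> are represented by \<open>0, \<dots>, L - 1\<close>. The condition \<open>x \<noteq> y\<close> only matters
  for \<open>L = 1\<close>, where it excludes the loop at the single vertex.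
\<close>

definition torus :: "nat \<Rightarrow> nat \<Rightarrow> (nat \<Rightarrow> int) ugraph" where
  "torus d L =
    \<lparr>verts = {..<d} \<rightarrow>\<^sub>E {0..<int L},
     edges = {{x, y} | x y.
       x \<in> {..<d} \<rightarrow>\<^sub>E {0..<int L} \<and> y \<in> {..<d} \<rightarrow>\<^sub>E {0..<int L} \<and> x \<noteq> y \<and>
       (\<exists>i<d. ([x i - y i = 1] (mod int L) \<or> [x i - y i = -1] (mod int L)) \<and>
              (\<forall>j<d. j \<noteq> i \<longrightarrow> x j = y j))}\<rparr>"

definition percolation :: "nat \<Rightarrow> nat \<Rightarrow> real \<Rightarrow> (nat \<Rightarrow> int) ugraph pmf" where
  "percolation d L q =
     map_pmf (\<lambda>\<omega>. \<lparr>verts = verts (torus d L), edges = {e\<in>edges (torus d L). \<omega> e}\<rparr>)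
       (Pi_pmf (edges (torus d L)) False (\<lambda>_. bernoulli_pmf q))"

definition lattice_type :: "nat \<Rightarrow> nat \<Rightarrow> nat ugraph \<Rightarrow> nat \<Rightarrow> bool" where
  "lattice_type d r T t \<longleftrightarrow>
     (\<exists>X. subgraph X (lattice d) \<and> has_ball_type X (lattice_origin d) r T t)"

definition infinite_lattice_type :: "nat \<Rightarrow> nat \<Rightarrow> nat ugraph \<Rightarrow> nat \<Rightarrow> bool" where
  "infinite_lattice_type d r T t \<longleftrightarrow>
     (\<exists>X v. subgraph X (lattice d) \<and> infinite (component X v) \<and> has_ball_type X v r T t)"

datatype fm =
    FFalse
  | FEq nat nat
  | FAdj nat nat
  | FNot fm
  | FAnd fm fm
  | FEx nat fm

primrec sat :: "'a ugraph \<Rightarrow> (nat \<Rightarrow> 'a) \<Rightarrow> fm \<Rightarrow> bool" where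
  "sat G \<beta> FFalse \<longleftrightarrow> False"
| "sat G \<beta> (FEq x y) \<longleftrightarrow> \<beta> x = \<beta> y"
| "sat G \<beta> (FAdj x y) \<longleftrightarrow> adj G (\<beta> x) (\<beta> y)"
| "sat G \<beta> (FNot \<phi>) \<longleftrightarrow> \<not> sat G \<beta> \<phi>"
| "sat G \<beta> (FAnd \<phi> \<psi>) \<longleftrightarrow> sat G \<beta> \<phi> \<and> sat G \<beta> \<psi>"
| "sat G \<beta> (FEx x \<phi>) \<longleftrightarrow> (\<exists>a\<in>verts G. sat G (\<beta>(x := a)) \<phi>)"

primrec free_vars :: "fm \<Rightarrow> nat set" where
  "free_vars FFalse = {}"
| "free_vars (FEq x y) = {x, y}"
| "free_vars (FAdj x y) = {x, y}"
| "free_vars (FNot \<phi>) = free_vars \<phi>"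
| "free_vars (FAnd \<phi> \<psi>) = free_vars \<phi> \<union> free_vars \<psi>"
| "free_vars (FEx x \<phi>) = free_vars \<phi> - {x}"

definition sentence :: "fm \<Rightarrow> bool" where
  "sentence \<phi> \<longleftrightarrow> free_vars \<phi> = {}"

text \<open>
  Used for sentences only, whose truth does not depend on \<open>\<beta>\<close>. The empty graph is admitted as a
  structure, since pruning may remove every vertex.
\<close>

definition models :: "'a ugraph \<Rightarrow> fm \<Rightarrow> bool" where
  "models G \<phi> \<longleftrightarrow> (\<forall>\<beta>. sat G \<beta> \<phi>)"

text \<open>Semantic consequences over the graphs (of any cardinality) with vertices in \<open>'v\<close>.\<close>

definition consequences :: "'v itself \<Rightarrow> fm set \<Rightarrow> fm set" where
  "consequences _ \<Gamma> = {\<phi>. sentence \<phi> \<and>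
     (\<forall>G :: 'v ugraph. simple_graph G \<and> (\<forall>\<psi>\<in>\<Gamma>. models G \<psi>) \<longrightarrow> models G \<phi>)}"

definition expresses :: "fm \<Rightarrow> ('w ugraph \<Rightarrow> bool) \<Rightarrow> bool" where
  "expresses \<phi> P \<longleftrightarrow> sentence \<phi> \<and> (\<forall>G. simple_graph G \<longrightarrow> (models G \<phi> \<longleftrightarrow> P G))"

definition zero_one_law :: "(nat \<Rightarrow> 'a ugraph pmf) \<Rightarrow> bool" where
  "zero_one_law Y \<longleftrightarrow> (\<forall>\<phi>. sentence \<phi> \<longrightarrow>
     (\<lambda>L. measure_pmf.prob (Y L) {G. models G \<phi>}) \<longlonglongrightarrow> 0 \<or>
     (\<lambda>L. measure_pmf.prob (Y L) {G. models G \<phi>}) \<longlonglongrightarrow> 1)"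

definition almost_sure_theory :: "(nat \<Rightarrow> 'a ugraph pmf) \<Rightarrow> fm set" where
  "almost_sure_theory Y = {\<phi>. sentence \<phi> \<and>
     (\<lambda>L. measure_pmf.prob (Y L) {G. models G \<phi>}) \<longlonglongrightarrow> 1}"

abbreviation FOr :: "fm \<Rightarrow> fm \<Rightarrow> fm" where
  "FOr \<phi> \<psi> \<equiv> FNot (FAnd (FNot \<phi>) (FNot \<psi>))"

abbreviation FImp :: "fm \<Rightarrow> fm \<Rightarrow> fm" where
  "FImp \<phi> \<psi> \<equiv> FNot (FAnd \<phi> (FNot \<psi>))"

abbreviation FAll :: "nat \<Rightarrow> fm \<Rightarrow> fm" where
  "FAll x \<phi> \<equiv> FNot (FEx x (FNot \<phi>))"

definition FConj :: "fm list \<Rightarrow> fm" where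
  "FConj \<phi>s = foldr FAnd \<phi>s (FNot FFalse)"

definition FDisj :: "fm list \<Rightarrow> fm" where
  "FDisj \<phi>s = foldr FOr \<phi>s FFalse"

definition FExs :: "nat list \<Rightarrow> fm \<Rightarrow> fm" where
  "FExs xs \<phi> = foldr FEx xs \<phi>"

definition distinct_fm :: "nat list \<Rightarrow> fm" where
  "distinct_fm xs = FConj [FNot (FEq x y). x \<leftarrow> xs, y \<leftarrow> xs, x \<noteq> y]"

text \<open>Distance at most \<open>r\<close>, by a walk of length \<open>r\<close> that may pause; \<open>z\<close> is a fresh variable.\<close>

fun dist_fm :: "nat \<Rightarrow> nat \<Rightarrow> nat \<Rightarrow> fm" where
  "dist_fm 0 x y = FEq x y"
| "dist_fm (Suc r) x y =
     (let z = Suc (max x y) in FEx z (FAnd (FOr (FEq x z) (FAdj x z)) (dist_fm r z y)))"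

text \<open>
  The vertex \<open>x\<close> has ball type \<open>(T, t)\<close>. The variable \<open>c u\<close> stands for the image of the vertex
  \<open>u\<close> of \<open>T\<close>, and \<open>y\<close> is a further variable distinct from \<open>x\<close> and all \<open>c u\<close>. That the images lie
  in the ball is automatic, because all of \<open>T\<close> is within distance \<open>r\<close> of \<open>t\<close>.
\<close>

definition ball_type_fm :: "nat \<Rightarrow> nat ugraph \<Rightarrow> nat \<Rightarrow> nat \<Rightarrow> fm" where
  "ball_type_fm r T t x =
    (let us = sorted_list_of_set (verts T);
         c = (\<lambda>u. Suc (x + u));
         y = Suc (c (Max (verts T)))
     in FExs (map c us) (FConj
          [distinct_fm (map c us),
           FConj [if adj T u v then FAdj (c u) (c v) else FNot (FAdj (c u) (c v)).
                  u \<leftarrow> us, v \<leftarrow> us],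
           FEq x (c t),
           FAll y (FImp (dist_fm r x y) (FDisj [FEq y (c u). u \<leftarrow> us]))]))"

definition degree_axiom :: "nat \<Rightarrow> fm" where
  "degree_axiom k =
     FNot (FEx 0 (FExs [1..<k + 2]
       (FAnd (distinct_fm [1..<k + 2]) (FConj [FAdj 0 i. i \<leftarrow> [1..<k + 2]]))))"

definition omit_type_axiom :: "nat \<Rightarrow> nat ugraph \<Rightarrow> nat \<Rightarrow> fm" where
  "omit_type_axiom r T t = FNot (FEx 0 (ball_type_fm r T t 0))"

text \<open>
  There are no \<open>m\<close> distinct vertices which are all reachable from the first one and form a set
  closed under adjacency.
\<close>

definition no_component_axiom :: "nat \<Rightarrow> fm" where
  "no_component_axiom m =
     FNot (FExs [0..<m] (FConj
       [distinct_fm [0..<m],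
        FConj [dist_fm m 0 i. i \<leftarrow> [0..<m]],
        FAll m (FImp (FDisj [FAdj i m. i \<leftarrow> [0..<m]]) (FDisj [FEq m i. i \<leftarrow> [0..<m]]))]))"

definition many_type_axiom :: "nat \<Rightarrow> nat \<Rightarrow> nat ugraph \<Rightarrow> nat \<Rightarrow> fm" where
  "many_type_axiom h r T t =
     FExs [0..<h] (FAnd (distinct_fm [0..<h]) (FConj [ball_type_fm r T t i. i \<leftarrow> [0..<h]]))"

definition limit_axioms :: "nat \<Rightarrow> fm set" where
  "limit_axioms d =
     {degree_axiom (2 * d)} \<union>
     {omit_type_axiom r T t | r T t. ball_type r T t \<and> \<not> lattice_type d r T t} \<union>
     {no_component_axiom m | m. m \<ge> 1} \<union>
     {many_type_axiom h r T t | h r T t. ball_type r T t \<and> infinite_lattice_type d r T t \<and> h \<ge> 1}"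

end

theory Submission
  imports Defs "HOL-Real_Asymp.Real_Asymp"
begin

text \<open>
  The proof compares graphs by their balls. A sentence of quantifier rank \<open>k\<close> cannot distinguish two graphs
  of bounded degree if every ball type of radius at most \<open>radius k\<close> which occurs in one of them occurs many
  times in both: in each round of an Ehrenfeucht--Fraisse game a new point is either close to the previous points, and
  then an isomorphism of neighbourhoods answers the move, or far from them, and then a point with the same
  type can be found far from the previous answers. This is \<open>rich_models_iff\<close>. It remains to
  show that the models of the axioms, and with high probability the graphs \<open>Y L\<close>, are of this kind (\<open>rich\<close>)
  with the same ball types, namely those of infinite components of lattice subgraphs.

  No other types occur. A ball in the torus does not wrap around when \<open>L\<close> is large, so it is a
  lattice ball (\<open>lattice_type_of_torus_subgraph\<close>). Pruning with \<open>f (L ^ d)\<close> tending to infinity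
  removes every component of a given size. A lattice ball
  whose component is too large for the box around it can be continued outside the box by all lattice edges,
  and then it lies in an infinite component (\<open>infinite_lattice_typeI\<close>).

  All these types occur often. Inside an infinite component take a connected set \<open>K\<close> that contains
  the ball and has \<open>f (L ^ d)\<close> additional vertices. At a given place of the torus, the event that the edges
  touching a copy of \<open>K\<close> are exactly those of \<open>K\<close> has probability at least \<open>\<eta> ^ (2 * d * card K)\<close>, where \<open>\<eta>\<close>
  is the minimum of the probabilities of an edge to be open or closed. Then the copy
  is a component that survives pruning. The growth condition says that this probability is \<open>L\<close> to
  the power of \<open>- o(1)\<close>. There are \<open>L\<close> to the power of \<open>1 - o(1)\<close> places whose edge sets are disjoint, so
  the events are independent, and any fixed number of them occur with probability tending to one
  (\<open>prob_many_type_ge\<close>, \<open>miss_probability_tendsto_0\<close>).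

  Hence every sentence has in \<open>Y L\<close>, with high probability, the truth value that it has in any model of the
  axioms. A model exists on every infinite type (\<open>limit_axioms_satisfiable\<close>), which yields the zero--one law
  and shows that the almost sure theory consists of exactly the consequences of the axioms.
\<close>

section \<open>Balls and their isomorphisms\<close>

text \<open>
  The set of centres will be the set of all points chosen so far in a game. The connection to \<open>gdist\<close> is
  \<open>gdist_le_iff\<close>.
\<close>

primrec nball :: "'a ugraph \<Rightarrow> 'a set \<Rightarrow> nat \<Rightarrow> 'a set" where
  "nball G S 0 = S"
| "nball G S (Suc r) = nball G S r \<union> {w. \<exists>u\<in>nball G S r. adj G u w}"

lemma adj_sym: "adj G u v \<longleftrightarrow> adj G v u"
  by (simp add: adj_def insert_commute)

lemma simple_adj:
  assumes "simple_graph G" "adj G u v"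
  shows "u \<in> verts G" "v \<in> verts G" "u \<noteq> v"
  using assms by (fastforce simp: simple_graph_def adj_def doubleton_eq_iff)+

lemma nball_mono: "j \<le> r \<Longrightarrow> nball G S j \<subseteq> nball G S r"
  by (induction r) (auto simp: le_Suc_eq)

lemma nball_self: "S \<subseteq> nball G S r"
  using nball_mono[of 0 r G S] by simp

lemma nball_mono_set: "S \<subseteq> T \<Longrightarrow> nball G S r \<subseteq> nball G T r"
  by (induction r) auto

lemma nball_empty: "nball G {} r = {}"
  by (induction r) auto

lemma nball_Un: "nball G (S \<union> T) r = nball G S r \<union> nball G T r"
  by (induction r) auto

lemma nball_UN: "nball G (\<Union>i\<in>I. S i) r = (\<Union>i\<in>I. nball G (S i) r)"
  by (induction r) auto

lemma nball_add: "nball G S (j + r) = nball G (nball G S j) r"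
  by (induction r) auto

lemma nball_verts: "simple_graph G \<Longrightarrow> S \<subseteq> verts G \<Longrightarrow> nball G S r \<subseteq> verts G"
  by (induction r) (auto dest: simple_adj)

lemma nball_nbhd: "u \<in> nball G S r \<Longrightarrow> adj G u w \<Longrightarrow> w \<in> nball G S (Suc r)"
  by auto

lemma nball_sym: "w \<in> nball G {v} r \<longleftrightarrow> v \<in> nball G {w} r"
proof -
  have *: "v \<in> nball G {w} r" if "w \<in> nball G {v} r" for v w
    using that
  proof (induction r arbitrary: w)
    case (Suc r)
    then consider "w \<in> nball G {v} r" | u where "u \<in> nball G {v} r" "adj G u w"
      by auto
    then show ?case
    proof cases
      case 2
      then have "nball G {u} r \<subseteq> nball G (nball G {w} 1) r"
        by (intro nball_mono_set) (auto simp: adj_sym)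
      then show ?thesis using Suc.IH[OF 2(1)] nball_add[of G "{w}" 1 r] by (auto simp del: nball.simps)
    qed (use Suc in auto)
  qed auto
  show ?thesis using *[of w v] *[of v w] by blast
qed

lemma relpow_imp_nball: "(u, w) \<in> adj_rel G ^^ n \<Longrightarrow> w \<in> nball G {u} n"
  by (induction n arbitrary: w) (auto simp: adj_rel_def)

lemma nball_imp_relpow: "w \<in> nball G {u} r \<Longrightarrow> \<exists>n\<le>r. (u, w) \<in> adj_rel G ^^ n"
proof (induction r arbitrary: w)
  case (Suc r)
  then consider "w \<in> nball G {u} r" | x where "x \<in> nball G {u} r" "adj G x w"
    by auto
  then show ?case
  proof cases
    case 1 then show ?thesis using Suc.IH[of w] le_SucI by blast
  next
    case 2
    then obtain n where "n \<le> r" "(u, x) \<in> adj_rel G ^^ n" using Suc.IH by blast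
    then show ?thesis using 2 by (intro exI[of _ "Suc n"]) (auto simp: adj_rel_def)
  qed
qed auto

lemma gdist_le_iff: "gdist G u w \<le> enat r \<longleftrightarrow> w \<in> nball G {u} r"
proof
  assume le: "gdist G u w \<le> enat r"
  let ?A = "{enat n | n. (u, w) \<in> adj_rel G ^^ n}"
  have "?A \<noteq> {}" using le unfolding gdist_def by (auto simp: Inf_enat_def split: if_splits)
  then have "Inf ?A \<in> ?A" by (auto simp: Inf_enat_def intro: LeastI)
  then obtain n where n: "Inf ?A = enat n" "(u, w) \<in> adj_rel G ^^ n" by blast
  then have "n \<le> r" using le by (simp add: gdist_def)
  then show "w \<in> nball G {u} r"
    by (rule subsetD[OF nball_mono relpow_imp_nball[OF n(2)]])
next
  assume "w \<in> nball G {u} r"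
  then obtain n where n: "n \<le> r" "(u, w) \<in> adj_rel G ^^ n" using nball_imp_relpow by meson
  then have "gdist G u w \<le> enat n" unfolding gdist_def by (intro Inf_lower CollectI exI[of _ n]) simp
  then show "gdist G u w \<le> enat r" using n by (meson enat_ord_simps(1) order_trans)
qed

lemma component_eq_nball:
  assumes "simple_graph G" "v \<in> verts G"
  shows "component G v = (\<Union>r. nball G {v} r)"
proof -
  have "(v, w) \<in> (adj_rel G)\<^sup>* \<longleftrightarrow> (\<exists>r. w \<in> nball G {v} r)" for w
    unfolding rtrancl_power using relpow_imp_nball nball_imp_relpow by metis
  moreover have "nball G {v} r \<subseteq> verts G" for r using nball_verts[OF assms(1)] assms(2) by blast
  ultimately show ?thesis unfolding component_def by blast
qed

text \<open>
  Only the restriction of \<open>f\<close> to the ball matters, so two such maps with balls far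
  apart can be glued.
\<close>

definition ball_iso :: "'a ugraph \<Rightarrow> 'a set \<Rightarrow> 'b ugraph \<Rightarrow> ('a \<Rightarrow> 'b) \<Rightarrow> nat \<Rightarrow> bool" where
  "ball_iso G S H f r \<longleftrightarrow> bij_betw f (nball G S r) (nball H (f ` S) r) \<and>
     (\<forall>x\<in>nball G S r. \<forall>y\<in>nball G S r. adj G x y \<longleftrightarrow> adj H (f x) (f y))"

text \<open>
  A map that preserves edges sends walks to walks and so cannot increase distances.
\<close>

lemma image_nball_subset:
  assumes "\<And>x y. x \<in> W \<Longrightarrow> y \<in> W \<Longrightarrow> adj G x y \<Longrightarrow> adj H (f x) (f y)"
    and "nball G S r \<subseteq> W"
  shows "f ` nball G S r \<subseteq> nball H (f ` S) r"
  using assms(2)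
proof (induction r)
  case (Suc r)
  then have IH: "f ` nball G S r \<subseteq> nball H (f ` S) r" by auto
  show ?case
  proof
    fix z assume "z \<in> f ` nball G S (Suc r)"
    then obtain x where x: "z = f x" "x \<in> nball G S (Suc r)" by blast
    then consider "x \<in> nball G S r" | u where "u \<in> nball G S r" "adj G u x" by auto
    then show "z \<in> nball H (f ` S) (Suc r)"
    proof cases
      case 1 then show ?thesis using IH x by auto
    next
      case 2
      then have "adj H (f u) (f x)" using Suc.prems x by (intro assms(1)) auto
      moreover have "f u \<in> nball H (f ` S) r" using IH 2(1) by blast
      ultimately show ?thesis using nball_nbhd x(1) by metis
    qed
  qed
qed auto

text \<open>
  An isomorphism between the induced graphs on \<open>W\<close> and \<open>f ` W\<close> restricts to the balls, because a
  shortest path from the centre stays inside the ball; applied to \<open>f\<close> and to its inverse, the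
  previous lemma gives both inclusions. The isomorphisms between balls below (into
  the torus, into a modified lattice graph, into a pruned cluster, into a disjoint union) are
  obtained from it, with a set \<open>W\<close> that contains both balls for a different reason in each case.
\<close>

lemma ball_isoI:
  assumes inj: "inj_on f W"
    and adj: "\<And>x y. x \<in> W \<Longrightarrow> y \<in> W \<Longrightarrow> adj G x y \<longleftrightarrow> adj H (f x) (f y)"
    and G: "nball G S r \<subseteq> W" and H: "nball H (f ` S) r \<subseteq> f ` W"
  shows "ball_iso G S H f r"
proof -
  let ?g = "inv_into W f"
  have 1: "f ` nball G S r \<subseteq> nball H (f ` S) r"
    using adj G by (intro image_nball_subset) auto
  have S: "?g ` f ` S = S" using nball_self[of S G r] G inj by (auto intro!: inv_into_image_cancel)
  have "?g ` nball H (f ` S) r \<subseteq> nball G (?g ` f ` S) r"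
    by (rule image_nball_subset[OF _ H]) (use inj adj in auto)
  then have "?g ` nball H (f ` S) r \<subseteq> nball G S r" by (simp only: S)
  then have "f ` ?g ` nball H (f ` S) r \<subseteq> f ` nball G S r" by blast
  moreover have "f ` ?g ` nball H (f ` S) r = nball H (f ` S) r"
    using H by (intro image_inv_into_cancel) auto
  ultimately have "f ` nball G S r = nball H (f ` S) r" using 1 by blast
  then show ?thesis unfolding ball_iso_def bij_betw_def
    using adj G inj inj_on_subset by blast
qed

lemma ball_iso_image: "ball_iso G S H f r \<Longrightarrow> f ` nball G S r = nball H (f ` S) r"
  by (simp add: ball_iso_def bij_betw_def)

text \<open>
  This moves the centre: inside an isomorphism of balls of radius \<open>R\<close> around \<open>S\<close> lie
  isomorphisms of smaller balls around all points close to \<open>S\<close>.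
\<close>

lemma ball_iso_restrict:
  assumes "ball_iso G S H f R" "U \<subseteq> nball G S j" "j + r \<le> R"
  shows "ball_iso G U H f r"
proof (rule ball_isoI[where W = "nball G S R"])
  show "inj_on f (nball G S R)" using assms by (simp add: ball_iso_def bij_betw_def)
  show adj: "adj G x y \<longleftrightarrow> adj H (f x) (f y)" if "x \<in> nball G S R" "y \<in> nball G S R" for x y
    using assms that by (simp add: ball_iso_def)
  have "nball G U r \<subseteq> nball G S (j + r)"
    unfolding nball_add using assms by (intro nball_mono_set)
  then show "nball G U r \<subseteq> nball G S R" using nball_mono[OF assms(3)] by (rule order_trans)
  have "nball G S j \<subseteq> nball G S R" using assms(3) by (intro nball_mono) auto
  then have "f ` nball G S j \<subseteq> nball H (f ` S) j"
    using adj by (intro image_nball_subset[where W = "nball G S R"]) auto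
  then have "nball H (f ` U) r \<subseteq> nball H (f ` S) (j + r)"
    unfolding nball_add using assms by (intro nball_mono_set) auto
  also have "\<dots> \<subseteq> nball H (f ` S) R" using nball_mono[OF assms(3)] .
  finally show "nball H (f ` U) r \<subseteq> f ` nball G S R" using ball_iso_image[OF assms(1)] by simp
qed

lemma ball_iso_mono: "ball_iso G S H f R \<Longrightarrow> r \<le> R \<Longrightarrow> ball_iso G S H f r"
  by (rule ball_iso_restrict[where j = 0]) auto

lemma ball_iso_comp:
  assumes "ball_iso G S H f r" "ball_iso H (f ` S) K g r"
  shows "ball_iso G S K (g \<circ> f) r"
  unfolding ball_iso_def
proof
  show "bij_betw (g \<circ> f) (nball G S r) (nball K ((g \<circ> f) ` S) r)"
    using assms unfolding ball_iso_def image_comp[symmetric] by (auto intro: bij_betw_trans)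
  show "\<forall>x\<in>nball G S r. \<forall>y\<in>nball G S r. adj G x y \<longleftrightarrow> adj K ((g \<circ> f) x) ((g \<circ> f) y)"
    using assms ball_iso_image[OF assms(1)] unfolding ball_iso_def o_def by blast
qed

lemma ball_iso_inv:
  assumes "ball_iso G S H f r"
  obtains g where "ball_iso H (f ` S) G g r" "\<And>x. x \<in> nball G S r \<Longrightarrow> g (f x) = x" "g ` f ` S = S"
proof
  let ?B = "nball G S r" and ?g = "inv_into (nball G S r) f"
  have inj: "inj_on f ?B" and im: "f ` ?B = nball H (f ` S) r"
    using assms by (auto simp: ball_iso_def bij_betw_def)
  show 1: "?g (f x) = x" if "x \<in> ?B" for x using inj that by simp
  show S: "?g ` f ` S = S" using 1 nball_self[of S G r] by (force simp: image_image)
  have "bij_betw ?g (nball H (f ` S) r) ?B"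
    using assms by (auto simp: ball_iso_def intro: bij_betw_inv_into)
  moreover have "\<forall>x\<in>f ` ?B. \<forall>y\<in>f ` ?B. adj H x y \<longleftrightarrow> adj G (?g x) (?g y)"
    using assms 1 by (auto simp: ball_iso_def)
  ultimately show "ball_iso H (f ` S) G ?g r" unfolding ball_iso_def S im by blast
qed

lemma verts_ball_graph:
  "simple_graph G \<Longrightarrow> v \<in> verts G \<Longrightarrow> verts (ball_graph G v r) = nball G {v} r"
  using nball_verts[of G "{v}" r] by (auto simp: ball_graph_def induced_subgraph_def gdist_le_iff)

lemma adj_induced: "adj (induced_subgraph G W) x y \<longleftrightarrow> adj G x y \<and> x \<in> W \<and> y \<in> W"
  by (auto simp: adj_def induced_subgraph_def)

lemma ball_type_verts: "ball_type r T t \<Longrightarrow> verts T = nball T {t} r"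
  using nball_verts[of T "{t}" r] by (auto simp: ball_type_def gdist_le_iff)

text \<open>
  Ball types are defined through \<open>ball_graph\<close> and \<open>gdist\<close>. From here on they are handled through maps
  out of the representative \<open>T\<close>, which is its own ball of radius \<open>r\<close>.
\<close>

lemma has_ball_type_iff:
  assumes G: "simple_graph G" and T: "ball_type r T t"
  shows "has_ball_type G v r T t \<longleftrightarrow> v \<in> verts G \<and> (\<exists>g. ball_iso T {t} G g r \<and> g t = v)"
proof (cases "v \<in> verts G")
  case v: True
  have adj: "adj (ball_graph G v r) x y \<longleftrightarrow> adj G x y"
    if "x \<in> nball G {v} r" "y \<in> nball G {v} r" for x y
    using that verts_ball_graph[OF G v, of r] unfolding ball_graph_def adj_induced
    by (auto simp: induced_subgraph_def)
  have "has_ball_type G v r T t \<longleftrightarrow> (\<exists>f. ball_iso G {v} T f r \<and> f v = t)"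
    using v adj unfolding has_ball_type_def rooted_iso_def ball_iso_def verts_ball_graph[OF G v]
      ball_type_verts[OF T] by auto
  also have "\<dots> \<longleftrightarrow> (\<exists>g. ball_iso T {t} G g r \<and> g t = v)"
  proof
    assume "\<exists>f. ball_iso G {v} T f r \<and> f v = t"
    then obtain f where f: "ball_iso G {v} T f r" "f v = t" by blast
    obtain g where "ball_iso T (f ` {v}) G g r" "g ` f ` {v} = {v}" by (rule ball_iso_inv[OF f(1)])
    then show "\<exists>g. ball_iso T {t} G g r \<and> g t = v" using f by auto
  next
    assume "\<exists>g. ball_iso T {t} G g r \<and> g t = v"
    then obtain f where f: "ball_iso T {t} G f r" "f t = v" by blast
    obtain g where "ball_iso G (f ` {t}) T g r" "g ` f ` {t} = {t}" by (rule ball_iso_inv[OF f(1)])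
    then show "\<exists>f. ball_iso G {v} T f r \<and> f v = t" using f by auto
  qed
  finally show ?thesis using v by simp
qed (simp add: has_ball_type_def)

lemma has_ball_type_transfer:
  assumes "simple_graph G" "simple_graph H" "ball_type r T t"
    and "has_ball_type G v r T t" "ball_iso G {v} H f r" "f v \<in> verts H"
  shows "has_ball_type H (f v) r T t"
proof -
  obtain g where g: "ball_iso T {t} G g r" "g t = v"
    using assms(4) has_ball_type_iff[OF assms(1,3)] by auto
  have "ball_iso T {t} H (f \<circ> g) r" using g assms(5) by (intro ball_iso_comp) auto
  then show ?thesis using has_ball_type_iff[OF assms(2,3)] assms(6) g by (metis comp_apply)
qed

lemma has_ball_type_same_iso:
  assumes "simple_graph G" "simple_graph H" "ball_type r T t"
    and "has_ball_type G v r T t" "has_ball_type H w r T t"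
  obtains f where "ball_iso G {v} H f r" "f v = w"
proof -
  obtain g where g: "ball_iso T {t} G g r" "g t = v"
    using assms(4) has_ball_type_iff[OF assms(1,3)] by auto
  obtain h where h: "ball_iso T {t} H h r" "h t = w"
    using assms(5) has_ball_type_iff[OF assms(2,3)] by auto
  obtain g' where g': "ball_iso G (g ` {t}) T g' r" "g' ` g ` {t} = {t}"
    using ball_iso_inv[OF g(1)] by metis
  have "ball_iso G {v} H (h \<circ> g') r" using g' g h by (intro ball_iso_comp) auto
  moreover have "(h \<circ> g') v = w" using g' g h by auto
  ultimately show thesis by (rule that)
qed

text \<open>
  The vertex set of the representative is an initial segment of the naturals. There are only
  finitely many such representatives of bounded size, and this finiteness is what turns
  statements about all types into finite intersections of events.
\<close>

lemma ball_type_exists: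
  assumes G: "simple_graph G" and v: "v \<in> verts G" and fin: "finite (nball G {v} r)"
  obtains T t where "ball_type r T t" "has_ball_type G v r T t" "verts T = {..<card (nball G {v} r)}"
proof -
  let ?B = "nball G {v} r"
  obtain f where f: "bij_betw f ?B {0..<card ?B}" using ex_bij_betw_finite_nat[OF fin] by blast
  define T where "T = \<lparr>verts = {..<card ?B}, edges = {{f x, f y} | x y. x \<in> ?B \<and> y \<in> ?B \<and> adj G x y}\<rparr>"
  have inj: "inj_on f ?B" and im: "f ` ?B = {..<card ?B}" using f by (auto simp: bij_betw_def lessThan_atLeast0)
  have vT: "verts T = {..<card ?B}" by (simp add: T_def)
  have adj: "adj G x y \<longleftrightarrow> adj T (f x) (f y)" if "x \<in> ?B" "y \<in> ?B" for x y
  proof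
    assume "adj T (f x) (f y)"
    then obtain x' y' where "{f x, f y} = {f x', f y'}" "x' \<in> ?B" "y' \<in> ?B" "adj G x' y'"
      by (auto simp: adj_def T_def)
    then show "adj G x y" using that inj unfolding doubleton_eq_iff by (metis adj_sym inj_onD)
  qed (use that in \<open>auto simp: adj_def T_def\<close>)
  have T: "simple_graph T" unfolding simple_graph_def
  proof
    fix e assume "e \<in> edges T"
    then obtain x y where *: "e = {f x, f y}" "x \<in> ?B" "y \<in> ?B" "adj G x y" by (auto simp: T_def)
    then have "f x \<noteq> f y" using simple_adj[OF G *(4)] inj by (auto dest: inj_onD)
    then show "\<exists>u\<in>verts T. \<exists>v\<in>verts T. u \<noteq> v \<and> e = {u, v}" using * im vT by blast
  qed
  have fv: "f v \<in> verts T" using im vT nball_self[of "{v}" G r] by blast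
  have "nball T {f v} r \<subseteq> f ` ?B" using nball_verts[OF T, of "{f v}" r] fv im vT by simp
  then have iso: "ball_iso G {v} T f r" using inj adj by (intro ball_isoI[where W = ?B]) auto
  have "verts T = nball T {f v} r" using ball_iso_image[OF iso] im vT by simp
  moreover have "finite (verts T)" by (simp add: vT)
  ultimately have bt: "ball_type r T (f v)" using T fv by (auto simp: ball_type_def gdist_le_iff)
  obtain g where "ball_iso T (f ` {v}) G g r" "g ` f ` {v} = {v}" by (rule ball_iso_inv[OF iso])
  then have "has_ball_type G v r T (f v)" using has_ball_type_iff[OF G bt] v by auto
  then show thesis using that bt vT by blast
qed

section \<open>Locality of first-order logic\<close>

lemma card_nball:
  assumes deg: "\<And>v. v \<in> verts G \<Longrightarrow> finite (neighbours G v) \<and> card (neighbours G v) \<le> D"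
    and G: "simple_graph G" and S: "finite S" "S \<subseteq> verts G"
  shows "finite (nball G S r) \<and> card (nball G S r) \<le> card S * (D + 1) ^ r"
proof (induction r)
  case (Suc r)
  let ?B = "nball G S r"
  have B: "?B \<subseteq> verts G" using nball_verts[OF G S(2)] .
  have eq: "nball G S (Suc r) = (\<Union>u\<in>?B. insert u (neighbours G u))"
    using simple_adj[OF G] by (auto simp: neighbours_def)
  have fin: "finite (nball G S (Suc r))" unfolding eq using Suc B deg by blast
  have "card (nball G S (Suc r)) \<le> (\<Sum>u\<in>?B. card (insert u (neighbours G u)))"
    unfolding eq using Suc by (intro card_UN_le) auto
  also have "\<dots> \<le> (\<Sum>u\<in>?B. D + 1)"
  proof (rule sum_mono)
    fix u assume "u \<in> ?B"
    then have "card (neighbours G u) \<le> D" "finite (neighbours G u)" using deg B by auto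
    then show "card (insert u (neighbours G u)) \<le> D + 1"
      using card_insert_le_m1[of "D + 1" "neighbours G u" u] by simp
  qed
  also have "\<dots> \<le> card S * (D + 1) ^ r * (D + 1)"
    using Suc by (simp only: sum_constant of_nat_id mult_le_mono1)
  finally show ?case using fin by (simp add: ac_simps)
qed (use S in auto)

text \<open>
  Balls around points at distance more than \<open>2 * r + 1\<close> are disjoint and have no edge between
  them, so their union is determined up to isomorphism by the two balls separately.
\<close>

lemma far_apart:
  assumes "a \<notin> nball G S (2 * r + 1)" "x \<in> nball G S r" "y \<in> nball G {a} r"
  shows "x \<noteq> y \<and> \<not> adj G x y"
proof (rule ccontr)
  assume "\<not> ?thesis"
  then have "y \<in> nball G S (Suc r)" using assms(2) by auto
  moreover have "a \<in> nball G {y} r" using assms(3) nball_sym[of y G a r] by simp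
  ultimately have "a \<in> nball G (nball G S (Suc r)) r"
    using nball_mono_set[of "{y}" "nball G S (Suc r)" G r] by blast
  then have "a \<in> nball G S (Suc r + r)" unfolding nball_add .
  then show False using assms(1) by (simp only: mult_2 add_Suc add_Suc_right Suc_eq_plus1[symmetric] not_True_eq_False)
qed

lemma ball_iso_glue:
  assumes f: "ball_iso G S H f r" and g: "ball_iso G {a} H g r"
    and a: "a \<notin> nball G S (2 * r + 1)" and b: "g a \<notin> nball H (f ` S) (2 * r + 1)"
  shows "ball_iso G (insert a S) H (\<lambda>u. if u \<in> nball G S r then f u else g u) r"
    (is "ball_iso _ _ _ ?h _")
proof -
  let ?P = "nball G S r" and ?Q = "nball G {a} r"
  let ?P' = "nball H (f ` S) r" and ?Q' = "nball H {g a} r"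
  have far: "x \<noteq> y" "\<not> adj G x y" "\<not> adj G y x" if "x \<in> ?P" "y \<in> ?Q" for x y
    using far_apart[OF a that] by (auto simp: adj_sym)
  have far': "x \<noteq> y" "\<not> adj H x y" "\<not> adj H y x" if "x \<in> ?P'" "y \<in> ?Q'" for x y
    using far_apart[OF b that] by (auto simp: adj_sym)
  have f': "bij_betw f ?P ?P'" "\<And>x y. x \<in> ?P \<Longrightarrow> y \<in> ?P \<Longrightarrow> adj G x y \<longleftrightarrow> adj H (f x) (f y)"
    and g': "bij_betw g ?Q ?Q'" "\<And>x y. x \<in> ?Q \<Longrightarrow> y \<in> ?Q \<Longrightarrow> adj G x y \<longleftrightarrow> adj H (g x) (g y)"
    using f g by (auto simp: ball_iso_def)
  have hP: "?h x = f x" if "x \<in> ?P" for x using that by simp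
  have hQ: "?h x = g x" if "x \<in> ?Q" for x using that far(1) by auto
  have fP: "f x \<in> ?P'" if "x \<in> ?P" for x using f' that by (auto simp: bij_betw_def)
  have gQ: "g x \<in> ?Q'" if "x \<in> ?Q" for x using g' that by (auto simp: bij_betw_def)
  have U: "nball G (insert a S) r = ?P \<union> ?Q" using nball_Un[of G S "{a}" r] by simp
  have "S \<subseteq> ?P" "a \<in> ?Q" using nball_self[of S G r] nball_self[of "{a}" G r] by auto
  then have "?h a = g a" "?h ` S = f ` S" using hP hQ by (blast, intro image_cong) auto
  then have "?h ` insert a S = insert (g a) (f ` S)" by (simp only: image_insert)
  then have U': "nball H (?h ` insert a S) r = ?P' \<union> ?Q'"
    using nball_Un[of H "f ` S" "{g a}" r] by simp
  have "bij_betw ?h (?P \<union> ?Q) (?P' \<union> ?Q')"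
  proof (rule bij_betw_combine)
    show "bij_betw ?h ?P ?P'" using f'(1) hP bij_betw_cong[of ?P ?h f] by blast
    show "bij_betw ?h ?Q ?Q'" using g'(1) hQ bij_betw_cong[of ?Q ?h g] by blast
    show "?P' \<inter> ?Q' = {}" using far' by blast
  qed
  moreover have "adj G x y \<longleftrightarrow> adj H (?h x) (?h y)" if xy: "x \<in> ?P \<union> ?Q" "y \<in> ?P \<union> ?Q" for x y
  proof -
    consider "x \<in> ?P" "y \<in> ?P" | "x \<in> ?P" "y \<in> ?Q" | "x \<in> ?Q" "y \<in> ?P" | "x \<in> ?Q" "y \<in> ?Q"
      using xy by blast
    then show ?thesis
    proof cases
      case 1
      show ?thesis unfolding hP[OF 1(1)] hP[OF 1(2)] by (rule f'(2)[OF 1])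
    next
      case 2
      show ?thesis unfolding hP[OF 2(1)] hQ[OF 2(2)]
        using far(2)[OF 2] far'(2)[OF fP[OF 2(1)] gQ[OF 2(2)]] by blast
    next
      case 3
      show ?thesis unfolding hQ[OF 3(1)] hP[OF 3(2)]
        using far(3)[OF 3(2,1)] far'(3)[OF fP[OF 3(2)] gQ[OF 3(1)]] by blast
    next
      case 4
      show ?thesis unfolding hQ[OF 4(1)] hQ[OF 4(2)] by (rule g'(2)[OF 4])
    qed
  qed
  ultimately show ?thesis unfolding ball_iso_def U U' by blast
qed

definition ball_types :: "nat \<Rightarrow> nat \<Rightarrow> (nat \<times> nat ugraph \<times> nat) set" where
  "ball_types D R = {(r, T, t). r \<le> R \<and> ball_type r T t \<and> (\<exists>m\<le>(D + 1) ^ R. verts T = {..<m})}"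

lemma finite_ball_types: "finite (ball_types D R)"
proof -
  let ?M = "(D + 1) ^ R"
  let ?mk = "\<lambda>(r, m, E, t). (r, \<lparr>verts = {..<m}, edges = E\<rparr>, t)"
  have "ball_types D R \<subseteq> ?mk ` ({..R} \<times> {..?M} \<times> Pow (Pow {..<?M}) \<times> {..<?M})"
  proof
    fix z assume "z \<in> ball_types D R"
    then obtain r T t m where z: "z = (r, T, t)" "r \<le> R" "ball_type r T t" "m \<le> ?M" "verts T = {..<m}"
      by (auto simp: ball_types_def)
    then have e: "edges T \<subseteq> Pow {..<?M}" "t < ?M"
      by (fastforce simp: ball_type_def simple_graph_def)+
    have "z = ?mk (r, m, edges T, t)" using z by (cases T) auto
    then show "z \<in> ?mk ` ({..R} \<times> {..?M} \<times> Pow (Pow {..<?M}) \<times> {..<?M})"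
      using z e by (intro image_eqI[of _ _ "(r, m, edges T, t)"]) auto
  qed
  then show ?thesis by (rule finite_subset) auto
qed

text \<open>
  The graphs which are indistinguishable by sentences of bounded quantifier rank: a ball type
  satisfying \<open>P\<close> is too frequent for a sentence to see how often it occurs, all other types are
  absent. Only the finitely many representatives in \<open>ball_types D R\<close> are considered; the bound
  \<open>(D + 1) ^ R\<close> bounds the size of a ball of radius \<open>R\<close> in degree \<open>D\<close>.
\<close>

definition rich :: "(nat \<Rightarrow> nat ugraph \<Rightarrow> nat \<Rightarrow> bool) \<Rightarrow> nat \<Rightarrow> nat \<Rightarrow> nat \<Rightarrow> 'a ugraph \<Rightarrow> bool" where
  "rich P D R h G \<longleftrightarrow> simple_graph G \<and>
     (\<forall>v\<in>verts G. finite (neighbours G v) \<and> card (neighbours G v) \<le> D) \<and>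
     (\<forall>(r, T, t)\<in>ball_types D R.
        (P r T t \<longrightarrow> (\<exists>S\<subseteq>{v. has_ball_type G v r T t}. finite S \<and> card S = h)) \<and>
        (\<not> P r T t \<longrightarrow> \<not> (\<exists>v. has_ball_type G v r T t)))"

text \<open>
  The far case of the back-and-forth argument: a copy of a ball of one rich graph can be found in
  another one outside a prescribed small set, since the type has more occurrences than
  the set has elements.
\<close>

lemma rich_realizes:
  assumes G: "rich P D R h G" and H: "rich P D R h H"
    and v: "v \<in> verts G" and r: "r \<le> R" and U: "finite U" "card U < h"
  obtains g w where "w \<in> verts H - U" "ball_iso G {v} H g r" "g v = w"
proof -
  have sG: "simple_graph G" and sH: "simple_graph H" using G H by (auto simp: rich_def)
  have "finite (nball G {v} r) \<and> card (nball G {v} r) \<le> card {v} * (D + 1) ^ r"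
    using G v by (intro card_nball) (auto simp: rich_def)
  then have fin: "finite (nball G {v} r)" and "card (nball G {v} r) \<le> (D + 1) ^ r" by auto
  then have c: "card (nball G {v} r) \<le> (D + 1) ^ R"
    using power_increasing[OF r, of "D + 1"] by simp
  obtain T t where T: "ball_type r T t" "has_ball_type G v r T t" "verts T = {..<card (nball G {v} r)}"
    using ball_type_exists[OF sG v fin] .
  have mem: "(r, T, t) \<in> ball_types D R" using T r c by (auto simp: ball_types_def)
  then have "P r T t" using G T(2) by (auto simp: rich_def)
  then have "\<exists>S\<subseteq>{w. has_ball_type H w r T t}. finite S \<and> card S = h"
    using H mem unfolding rich_def by fast
  then obtain S where S: "S \<subseteq> {w. has_ball_type H w r T t}" "finite S" "card S = h" by blast
  then have "\<not> S \<subseteq> U" using U card_mono by (metis linorder_not_le)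
  then obtain w where w: "w \<in> S" "w \<notin> U" by blast
  then have w': "has_ball_type H w r T t" using S by blast
  obtain g where "ball_iso G {v} H g r" "g v = w"
    using has_ball_type_same_iso[OF sG sH T(1,2) w'] .
  then show thesis using that w w' by (auto simp: has_ball_type_def)
qed

text \<open>
  The position in an Ehrenfeucht--Fraisse game: the chosen points, as values of the variables in
  \<open>A\<close>, have isomorphic neighbourhoods of radius \<open>r\<close>.
\<close>

definition loc_equiv ::
  "nat \<Rightarrow> 'a ugraph \<Rightarrow> 'b ugraph \<Rightarrow> nat set \<Rightarrow> (nat \<Rightarrow> 'a) \<Rightarrow> (nat \<Rightarrow> 'b) \<Rightarrow> bool" where
  "loc_equiv r G H A \<alpha> \<beta> \<longleftrightarrow> \<alpha> ` A \<subseteq> verts G \<and> \<beta> ` A \<subseteq> verts H \<and>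
     (\<exists>f. ball_iso G (\<alpha> ` A) H f r \<and> (\<forall>x\<in>A. f (\<alpha> x) = \<beta> x))"

lemma loc_equiv_sym:
  assumes "loc_equiv r G H A \<alpha> \<beta>"
  shows "loc_equiv r H G A \<beta> \<alpha>"
proof -
  obtain f where f: "ball_iso G (\<alpha> ` A) H f r" "\<forall>x\<in>A. f (\<alpha> x) = \<beta> x"
    using assms by (auto simp: loc_equiv_def)
  have im: "f ` \<alpha> ` A = \<beta> ` A" using f(2) by (auto simp: image_image)
  obtain g where g: "ball_iso H (f ` \<alpha> ` A) G g r" "\<And>x. x \<in> nball G (\<alpha> ` A) r \<Longrightarrow> g (f x) = x"
    using ball_iso_inv[OF f(1)] by metis
  have "g (\<beta> x) = \<alpha> x" if "x \<in> A" for x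
    using g(2)[of "\<alpha> x"] f(2) that nball_self[of "\<alpha> ` A" G r] by (metis imageI subsetD)
  then show ?thesis using assms g(1) im by (auto simp: loc_equiv_def)
qed

lemma loc_equiv_subset:
  assumes "loc_equiv R G H A \<alpha> \<beta>" "B \<subseteq> A" "r \<le> R"
  shows "loc_equiv r G H B \<alpha> \<beta>"
proof -
  obtain f where f: "ball_iso G (\<alpha> ` A) H f R" "\<forall>x\<in>A. f (\<alpha> x) = \<beta> x"
    using assms by (auto simp: loc_equiv_def)
  have "ball_iso G (\<alpha> ` B) H f r" using assms by (intro ball_iso_restrict[OF f(1), of _ 0]) auto
  moreover have "\<alpha> ` B \<subseteq> verts G" "\<beta> ` B \<subseteq> verts H" using assms(1,2) unfolding loc_equiv_def by blast+
  moreover have "\<forall>x\<in>B. f (\<alpha> x) = \<beta> x" using assms(2) f(2) by blast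
  ultimately show ?thesis unfolding loc_equiv_def by blast
qed

text \<open>
  One round of the game. If the new point \<open>a\<close> is close to the old ones, its ball of radius \<open>r\<close> lies
  inside the old neighbourhood, and the answer is its image: the distance is at most \<open>2 * r + 1\<close>,
  hence the radius \<open>3 * r + 1\<close>. If \<open>a\<close> is far, any far point with the same type will do, by
  \<open>rich_realizes\<close> and \<open>ball_iso_glue\<close>.
\<close>

lemma loc_equiv_extend:
  assumes G: "rich P D R h G" and H: "rich P D R h H"
    and eq: "loc_equiv (3 * r + 1) G H A \<alpha> \<beta>" and A: "finite A" "x \<notin> A" "card A \<le> N"
    and R: "3 * r + 1 \<le> R" and h: "N * (D + 1) ^ R < h" and a: "a \<in> verts G"
  shows "\<exists>b\<in>verts H. loc_equiv r G H (insert x A) (\<alpha>(x := a)) (\<beta>(x := b))"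
proof -
  let ?S = "\<alpha> ` A"
  obtain f where f: "ball_iso G ?S H f (3 * r + 1)" "\<forall>y\<in>A. f (\<alpha> y) = \<beta> y"
    and S: "?S \<subseteq> verts G" "\<beta> ` A \<subseteq> verts H"
    using eq by (auto simp: loc_equiv_def)
  have sH: "simple_graph H" using H by (simp add: rich_def)
  have fS: "f ` ?S = \<beta> ` A" using f(2) by (auto simp: image_image)
  have upd: "(\<alpha>(x := a)) ` insert x A = insert a ?S" "\<And>b. (\<beta>(x := b)) ` insert x A = insert b (\<beta> ` A)"
    using A by auto
  have goal: ?thesis if "ball_iso G (insert a ?S) H g r" "\<forall>y\<in>A. g (\<alpha> y) = \<beta> y" "g a \<in> verts H" for g
  proof (intro bexI[of _ "g a"])
    have "\<forall>y\<in>insert x A. g ((\<alpha>(x := a)) y) = (\<beta>(x := g a)) y"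
      using that A by auto
    then show "loc_equiv r G H (insert x A) (\<alpha>(x := a)) (\<beta>(x := g a))"
      unfolding loc_equiv_def upd using that a S by blast
  qed (use that in auto)
  show ?thesis
  proof (cases "a \<in> nball G ?S (2 * r + 1)")
    case True
    have "ball_iso G (insert a ?S) H f r"
    proof (rule ball_iso_restrict[OF f(1)])
      show "insert a ?S \<subseteq> nball G ?S (2 * r + 1)" using True nball_self[of ?S G "2 * r + 1"] by blast
    qed auto
    moreover have "f a \<in> verts H"
    proof -
      have "a \<in> nball G ?S (3 * r + 1)"
        by (rule subsetD[OF nball_mono True]) simp
      then have "f a \<in> nball H (f ` ?S) (3 * r + 1)" using ball_iso_image[OF f(1)] by blast
      moreover have "nball H (f ` ?S) (3 * r + 1) \<subseteq> verts H" using S fS by (intro nball_verts[OF sH]) simp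
      ultimately show ?thesis by blast
    qed
    ultimately show ?thesis using goal f(2) by blast
  next
    case False
    let ?U = "nball H (\<beta> ` A) (2 * r + 1)"
    have U: "finite ?U \<and> card ?U \<le> card (\<beta> ` A) * (D + 1) ^ (2 * r + 1)"
      using H A S by (intro card_nball) (auto simp: rich_def)
    have "card (\<beta> ` A) * (D + 1) ^ (2 * r + 1) \<le> N * (D + 1) ^ R"
      using card_image_le[OF A(1), of \<beta>] A(3) R by (intro mult_le_mono power_increasing) auto
    then have "card ?U < h" using U h by linarith
    moreover have "finite ?U" "r \<le> R" using U R by (blast, simp)
    ultimately obtain g w where w: "w \<in> verts H - ?U" "ball_iso G {a} H g r" "g a = w"
      using rich_realizes[OF G H a] by metis
    have "ball_iso G (insert a ?S) H (\<lambda>u. if u \<in> nball G ?S r then f u else g u) r"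
      using w False fS by (intro ball_iso_glue ball_iso_mono[OF f(1)]) auto
    moreover have "a \<notin> nball G ?S r" using False nball_mono[of r "2 * r + 1" G ?S] by auto
    moreover have "\<alpha> y \<in> nball G ?S r" if "y \<in> A" for y using that nball_self[of ?S G r] by auto
    ultimately show ?thesis using goal[of "\<lambda>u. if u \<in> nball G ?S r then f u else g u"] w f(2) by auto
  qed
qed

primrec quant_rank :: "fm \<Rightarrow> nat" where
  "quant_rank FFalse = 0"
| "quant_rank (FEq x y) = 0"
| "quant_rank (FAdj x y) = 0"
| "quant_rank (FNot \<phi>) = quant_rank \<phi>"
| "quant_rank (FAnd \<phi> \<psi>) = max (quant_rank \<phi>) (quant_rank \<psi>)"
| "quant_rank (FEx x \<phi>) = Suc (quant_rank \<phi>)"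

primrec radius :: "nat \<Rightarrow> nat" where
  "radius 0 = 0"
| "radius (Suc k) = 3 * radius k + 1"

lemma radius_mono: "j \<le> k \<Longrightarrow> radius j \<le> radius k"
  by (induction k) (auto simp: le_Suc_eq)

lemma rich_sat_iff:
  assumes G: "rich P D R h G" and H: "rich P D R h H" and h: "N * (D + 1) ^ R < h"
  shows "loc_equiv (radius (quant_rank \<phi>)) G H A \<alpha> \<beta> \<Longrightarrow> finite A \<Longrightarrow> free_vars \<phi> \<subseteq> A \<Longrightarrow>
    radius (quant_rank \<phi>) \<le> R \<Longrightarrow> card A + quant_rank \<phi> \<le> N \<Longrightarrow> sat G \<alpha> \<phi> \<longleftrightarrow> sat H \<beta> \<phi>"
proof (induction \<phi> arbitrary: A \<alpha> \<beta>)
  case (FEq x y)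
  then obtain f where f: "ball_iso G (\<alpha> ` A) H f 0" "\<forall>x\<in>A. f (\<alpha> x) = \<beta> x"
    by (auto simp: loc_equiv_def)
  then have "inj_on f (\<alpha> ` A)" by (auto simp: ball_iso_def bij_betw_def)
  then have "f (\<alpha> x) = f (\<alpha> y) \<longleftrightarrow> \<alpha> x = \<alpha> y"
    using FEq.prems(3) by (intro inj_on_eq_iff) auto
  then show ?case using f(2) FEq.prems(3) by simp
next
  case (FAdj x y)
  then obtain f where f: "ball_iso G (\<alpha> ` A) H f 0" "\<forall>x\<in>A. f (\<alpha> x) = \<beta> x"
    by (auto simp: loc_equiv_def)
  then have "adj G (\<alpha> x) (\<alpha> y) \<longleftrightarrow> adj H (f (\<alpha> x)) (f (\<alpha> y))"
    using FAdj.prems(3) by (auto simp: ball_iso_def)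
  then show ?case using f(2) FAdj.prems(3) by auto
next
  case (FAnd \<phi> \<psi>)
  have "sat G \<alpha> \<phi> \<longleftrightarrow> sat H \<beta> \<phi>"
    using FAnd.prems loc_equiv_subset[OF FAnd.prems(1) subset_refl radius_mono[of "quant_rank \<phi>"]]
      radius_mono[of "quant_rank \<phi>" "quant_rank (FAnd \<phi> \<psi>)"]
    by (intro FAnd.IH(1)[of A]) (auto simp: max_def split: if_splits)
  moreover have "sat G \<alpha> \<psi> \<longleftrightarrow> sat H \<beta> \<psi>"
    using FAnd.prems loc_equiv_subset[OF FAnd.prems(1) subset_refl radius_mono[of "quant_rank \<psi>"]]
      radius_mono[of "quant_rank \<psi>" "quant_rank (FAnd \<phi> \<psi>)"]
    by (intro FAnd.IH(2)[of A]) (auto simp: max_def split: if_splits)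
  ultimately show ?case by simp
next
  case (FEx x \<phi>)
  let ?A = "A - {x}" and ?r = "radius (quant_rank \<phi>)"
  have A: "finite ?A" "x \<notin> ?A" "card ?A \<le> N" "card (insert x ?A) + quant_rank \<phi> \<le> N"
    using FEx.prems card_mono[of A ?A] card_insert_if[of A x] by (auto split: if_splits)
  have fv: "free_vars \<phi> \<subseteq> insert x ?A" using FEx.prems by auto
  have r: "3 * ?r + 1 \<le> R" "?r \<le> R" using FEx.prems by auto
  have eq: "loc_equiv (3 * ?r + 1) G H ?A \<alpha> \<beta>"
    using FEx.prems by (auto intro: loc_equiv_subset)
  have IH: "sat G \<alpha>' \<phi> \<longleftrightarrow> sat H \<beta>' \<phi>" if "loc_equiv ?r G H (insert x ?A) \<alpha>' \<beta>'" for \<alpha>' \<beta>'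
    using A fv r by (intro FEx.IH[OF that]) auto
  have "\<exists>b\<in>verts H. sat H (\<beta>(x := b)) \<phi>" if "a \<in> verts G" "sat G (\<alpha>(x := a)) \<phi>" for a
    using loc_equiv_extend[OF G H eq A(1-3) r(1) h that(1)] IH that(2) by blast
  moreover have "\<exists>a\<in>verts G. sat G (\<alpha>(x := a)) \<phi>" if "b \<in> verts H" "sat H (\<beta>(x := b)) \<phi>" for b
    using loc_equiv_extend[OF H G loc_equiv_sym[OF eq] A(1-3) r(1) h that(1)] IH that(2)
      loc_equiv_sym by blast
  ultimately show ?case by auto
qed auto

text \<open>
  This is the form of Hanf's locality theorem that is needed here. The empty tuples are locally
  equivalent for every radius, so the game can start.
\<close>

theorem rich_models_iff:
  assumes "sentence \<phi>" "rich P D (radius (quant_rank \<phi>)) h G" "rich P D (radius (quant_rank \<phi>)) h H"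
    and "quant_rank \<phi> * (D + 1) ^ radius (quant_rank \<phi>) < h"
  shows "models G \<phi> \<longleftrightarrow> models H \<phi>"
proof -
  have "sat G \<alpha> \<phi> \<longleftrightarrow> sat H \<beta> \<phi>" for \<alpha> \<beta>
  proof (rule rich_sat_iff[OF assms(2-4), of _ "{}"])
    show "loc_equiv (radius (quant_rank \<phi>)) G H {} \<alpha> \<beta>"
      unfolding loc_equiv_def ball_iso_def
      by (simp add: nball_empty bij_betw_def)
  qed (use assms(1) in \<open>auto simp: sentence_def\<close>)
  then show ?thesis unfolding models_def by blast
qed

section \<open>The meaning of the axioms\<close>

lemma sat_FConj: "sat G \<beta> (FConj \<phi>s) \<longleftrightarrow> (\<forall>\<phi>\<in>set \<phi>s. sat G \<beta> \<phi>)"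
  by (induction \<phi>s) (auto simp: FConj_def)

lemma sat_FDisj: "sat G \<beta> (FDisj \<phi>s) \<longleftrightarrow> (\<exists>\<phi>\<in>set \<phi>s. sat G \<beta> \<phi>)"
  by (induction \<phi>s) (auto simp: FDisj_def)

lemma sat_FExs:
  "sat G \<beta> (FExs xs \<phi>) \<longleftrightarrow>
     (\<exists>\<gamma>. (\<forall>x\<in>set xs. \<gamma> x \<in> verts G) \<and> (\<forall>x. x \<notin> set xs \<longrightarrow> \<gamma> x = \<beta> x) \<and> sat G \<gamma> \<phi>)"
proof (induction xs arbitrary: \<beta>)
  case Nil
  have "\<gamma> = \<beta>" if "\<forall>x. \<gamma> x = \<beta> x" for \<gamma> using that by blast
  then show ?case by (auto simp: FExs_def)
next
  case (Cons y xs)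
  have "sat G \<beta> (FExs (y # xs) \<phi>) \<longleftrightarrow> (\<exists>a\<in>verts G. sat G (\<beta>(y := a)) (FExs xs \<phi>))"
    by (simp add: FExs_def)
  also have "\<dots> \<longleftrightarrow> (\<exists>a\<in>verts G. \<exists>\<gamma>. (\<forall>x\<in>set xs. \<gamma> x \<in> verts G) \<and>
      (\<forall>x. x \<notin> set xs \<longrightarrow> \<gamma> x = (\<beta>(y := a)) x) \<and> sat G \<gamma> \<phi>)"
    by (simp only: Cons.IH)
  also have "\<dots> \<longleftrightarrow> (\<exists>\<gamma>. (\<forall>x\<in>set (y # xs). \<gamma> x \<in> verts G) \<and>
      (\<forall>x. x \<notin> set (y # xs) \<longrightarrow> \<gamma> x = \<beta> x) \<and> sat G \<gamma> \<phi>)" (is "?L \<longleftrightarrow> ?R")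
  proof
    assume ?L
    then obtain a \<gamma> where a: "a \<in> verts G" "\<forall>x\<in>set xs. \<gamma> x \<in> verts G"
      "\<forall>x. x \<notin> set xs \<longrightarrow> \<gamma> x = (\<beta>(y := a)) x" "sat G \<gamma> \<phi>" by blast
    then have "\<gamma> y \<in> verts G" by (cases "y \<in> set xs") auto
    then show ?R using a by (intro exI[of _ \<gamma>]) auto
  next
    assume ?R
    then obtain \<gamma> where g: "\<forall>x\<in>set (y # xs). \<gamma> x \<in> verts G"
      "\<forall>x. x \<notin> set (y # xs) \<longrightarrow> \<gamma> x = \<beta> x" "sat G \<gamma> \<phi>" by blast
    then show ?L by (intro bexI[of _ "\<gamma> y"] exI[of _ \<gamma>]) auto
  qed
  finally show ?case .
qed

lemma sat_FConj_product:
  "sat G \<beta> (FConj [F u v. u \<leftarrow> us, v \<leftarrow> vs]) \<longleftrightarrow> (\<forall>u\<in>set us. \<forall>v\<in>set vs. sat G \<beta> (F u v))"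
  by (auto simp: sat_FConj)

lemma sat_distinct_fm: "sat G \<beta> (distinct_fm xs) \<longleftrightarrow> inj_on \<beta> (set xs)"
  by (auto simp: distinct_fm_def sat_FConj inj_on_def split: if_splits)

lemma free_vars_FConj: "free_vars (FConj \<phi>s) = (\<Union>\<phi>\<in>set \<phi>s. free_vars \<phi>)"
  by (induction \<phi>s) (auto simp: FConj_def)

lemma free_vars_FDisj: "free_vars (FDisj \<phi>s) = (\<Union>\<phi>\<in>set \<phi>s. free_vars \<phi>)"
  by (induction \<phi>s) (auto simp: FDisj_def)

lemma free_vars_FExs: "free_vars (FExs xs \<phi>) = free_vars \<phi> - set xs"
  by (induction xs) (auto simp: FExs_def)

lemma free_vars_distinct_fm: "free_vars (distinct_fm xs) \<subseteq> set xs"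
  by (auto simp: distinct_fm_def free_vars_FConj split: if_splits)

lemma free_vars_dist_fm: "free_vars (dist_fm r x y) \<subseteq> {x, y}"
proof (induction r arbitrary: x)
  case (Suc r)
  show ?case using Suc[of "Suc (max x y)"] by (auto simp: Let_def)
qed auto

lemma sat_dist_fm:
  assumes G: "simple_graph G"
  shows "\<beta> x \<in> verts G \<Longrightarrow> sat G \<beta> (dist_fm r x y) \<longleftrightarrow> \<beta> y \<in> nball G {\<beta> x} r"
proof (induction r arbitrary: x \<beta>)
  case (Suc r)
  define z where "z = Suc (max x y)"
  have z: "z \<noteq> x" "z \<noteq> y" by (auto simp: z_def)
  have "sat G \<beta> (dist_fm (Suc r) x y) \<longleftrightarrow>
    (\<exists>a\<in>verts G. (\<beta> x = a \<or> adj G (\<beta> x) a) \<and> sat G (\<beta>(z := a)) (dist_fm r z y))"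
    using z by (auto simp: Let_def z_def[symmetric])
  also have "\<dots> \<longleftrightarrow> (\<exists>a\<in>verts G. (\<beta> x = a \<or> adj G (\<beta> x) a) \<and> \<beta> y \<in> nball G {a} r)"
  proof -
    have "sat G (\<beta>(z := a)) (dist_fm r z y) \<longleftrightarrow> \<beta> y \<in> nball G {a} r" if "a \<in> verts G" for a
      using Suc.IH[of "\<beta>(z := a)" z] that z(2)[symmetric]
      by (simp del: fun_upd_apply add: fun_upd_same fun_upd_other)
    then show ?thesis by blast
  qed
  also have "\<dots> \<longleftrightarrow> (\<exists>a\<in>nball G {\<beta> x} 1. \<beta> y \<in> nball G {a} r)"
    using Suc.prems simple_adj[OF G] by auto
  also have "\<dots> \<longleftrightarrow> \<beta> y \<in> nball G (nball G {\<beta> x} 1) r"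
    using nball_UN[of G "\<lambda>a. {a}" "nball G {\<beta> x} 1" r] by simp
  also have "\<dots> \<longleftrightarrow> \<beta> y \<in> nball G {\<beta> x} (Suc r)"
    using nball_add[of G "{\<beta> x}" 1 r] by simp
  finally show ?case .
qed auto

lemma free_vars_ball_type_fm:
  assumes "ball_type r T t"
  shows "free_vars (ball_type_fm r T t x) \<subseteq> {x}"
proof -
  have "finite (verts T)" "t \<in> verts T" using assms by (auto simp: ball_type_def)
  then show ?thesis
    using free_vars_dist_fm[of r x "Suc (Suc (x + Max (verts T)))"]
      free_vars_distinct_fm[of "map (\<lambda>u. Suc (x + u)) (sorted_list_of_set (verts T))"]
    by (auto simp: ball_type_fm_def Let_def free_vars_FExs free_vars_FConj free_vars_FDisj split: if_splits)
qed

text \<open>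
  The formula states an embedding \<open>\<gamma> \<circ> c\<close> of \<open>T\<close> with root \<open>\<beta> x\<close> whose image contains the ball. The
  converse inclusion is automatic, because every vertex of \<open>T\<close> is within distance \<open>r\<close> of the root;
  this is why \<open>ball_isoI\<close> applies with \<open>W = verts T\<close>.
\<close>

lemma sat_ball_type_fm:
  assumes G: "simple_graph G" and T: "ball_type r T t" and x: "\<beta> x \<in> verts G"
  shows "sat G \<beta> (ball_type_fm r T t x) \<longleftrightarrow> has_ball_type G (\<beta> x) r T t"
proof -
  define c where "c = (\<lambda>u. Suc (x + u))"
  define y where "y = Suc (c (Max (verts T)))"
  have T': "simple_graph T" "finite (verts T)" "t \<in> verts T" "verts T = nball T {t} r"
    using T ball_type_verts[OF T] by (auto simp: ball_type_def)
  have y: "y \<noteq> c u" "y \<noteq> x" if "u \<in> verts T" for u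
    using Max_ge[OF T'(2) that] by (auto simp: y_def c_def)
  have cx: "x \<noteq> c u" for u by (simp add: c_def)
  have ci: "inj c" by (simp add: c_def inj_def)
  let ?B = "nball G {\<beta> x} r"
  have core: "sat G \<gamma> (FConj
          [distinct_fm (map c (sorted_list_of_set (verts T))),
           FConj [if adj T u v then FAdj (c u) (c v) else FNot (FAdj (c u) (c v)).
                  u \<leftarrow> sorted_list_of_set (verts T), v \<leftarrow> sorted_list_of_set (verts T)],
           FEq x (c t),
           FAll y (FImp (dist_fm r x y) (FDisj [FEq y (c u). u \<leftarrow> sorted_list_of_set (verts T)]))])
      \<longleftrightarrow> inj_on (\<gamma> \<circ> c) (verts T) \<and>
        (\<forall>u\<in>verts T. \<forall>v\<in>verts T. adj T u v \<longleftrightarrow> adj G (\<gamma> (c u)) (\<gamma> (c v))) \<and>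
        \<gamma> x = \<gamma> (c t) \<and> (\<forall>a\<in>?B. a \<in> (\<gamma> \<circ> c) ` verts T)" (is "?L \<longleftrightarrow> ?R")
    if "\<gamma> x = \<beta> x" for \<gamma>
  proof -
    have dist: "inj_on \<gamma> (c ` verts T) \<longleftrightarrow> inj_on (\<gamma> \<circ> c) (verts T)"
      by (rule comp_inj_on_iff[OF inj_on_subset[OF ci subset_UNIV]])
    have all: "(\<forall>a\<in>verts G. sat G (\<gamma>(y := a)) (dist_fm r x y) \<longrightarrow>
        (\<exists>u\<in>verts T. (\<gamma>(y := a)) y = (\<gamma>(y := a)) (c u))) \<longleftrightarrow> (\<forall>a\<in>?B. a \<in> (\<gamma> \<circ> c) ` verts T)"
    proof -
      have "sat G (\<gamma>(y := a)) (dist_fm r x y) \<longleftrightarrow> a \<in> ?B" for a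
        using sat_dist_fm[OF G, of "\<gamma>(y := a)" x r y] that x y(2)[OF T'(3)] by simp
      moreover have "?B \<subseteq> verts G" using nball_verts[OF G] x by simp
      moreover have "(\<exists>u\<in>verts T. (\<gamma>(y := a)) y = (\<gamma>(y := a)) (c u)) \<longleftrightarrow> a \<in> (\<gamma> \<circ> c) ` verts T" for a
        using y(1) by (auto simp: image_iff)
      ultimately show ?thesis by (simp only:) blast
    qed
    have adj: "(\<forall>u\<in>verts T. \<forall>v\<in>verts T. sat G \<gamma> (if adj T u v then FAdj (c u) (c v) else FNot (FAdj (c u) (c v))))
      \<longleftrightarrow> (\<forall>u\<in>verts T. \<forall>v\<in>verts T. adj T u v \<longleftrightarrow> adj G (\<gamma> (c u)) (\<gamma> (c v)))"
      by (intro ball_cong refl) auto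
    show ?thesis
      unfolding dist[symmetric] all[symmetric] adj[symmetric]
      unfolding sat_FConj[of G \<gamma> "[_, _, _, _]"]
      by (simp add: sat_FConj_product sat_FDisj sat_distinct_fm T'(2) del: fun_upd_apply if_split)
  qed
  have "sat G \<beta> (ball_type_fm r T t x) \<longleftrightarrow>
     (\<exists>\<gamma>. (\<forall>z\<in>c ` verts T. \<gamma> z \<in> verts G) \<and> (\<forall>z. z \<notin> c ` verts T \<longrightarrow> \<gamma> z = \<beta> z) \<and>
        inj_on (\<gamma> \<circ> c) (verts T) \<and>
        (\<forall>u\<in>verts T. \<forall>v\<in>verts T. adj T u v \<longleftrightarrow> adj G (\<gamma> (c u)) (\<gamma> (c v))) \<and>
        \<gamma> x = \<gamma> (c t) \<and> (\<forall>a\<in>?B. a \<in> (\<gamma> \<circ> c) ` verts T))" (is "_ \<longleftrightarrow> (\<exists>\<gamma>. ?P \<gamma>)")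
  proof -
    have "\<gamma> x = \<beta> x" if "\<forall>z. z \<notin> c ` verts T \<longrightarrow> \<gamma> z = \<beta> z" for \<gamma> using that cx by blast
    then show ?thesis
      using T'(2) unfolding ball_type_fm_def Let_def c_def[symmetric] y_def[symmetric] sat_FExs
      by (intro ex_cong1) (auto simp only: core set_map set_sorted_list_of_set)
  qed
  also have "\<dots> \<longleftrightarrow> (\<exists>g. ball_iso T {t} G g r \<and> g t = \<beta> x)"
  proof
    assume "\<exists>\<gamma>. ?P \<gamma>"
    then obtain \<gamma> where g: "?P \<gamma>" ..
    have "\<gamma> x = \<beta> x" using g cx by blast
    then have gt: "(\<gamma> \<circ> c) t = \<beta> x" using g by simp
    have "ball_iso T {t} G (\<gamma> \<circ> c) r"
    proof (rule ball_isoI[where W = "verts T"])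
      show "nball G ((\<gamma> \<circ> c) ` {t}) r \<subseteq> (\<gamma> \<circ> c) ` verts T" using g gt by auto
    qed (use g T' in auto)
    then show "\<exists>g. ball_iso T {t} G g r \<and> g t = \<beta> x" using gt by blast
  next
    assume "\<exists>g. ball_iso T {t} G g r \<and> g t = \<beta> x"
    then obtain g where g: "ball_iso T {t} G g r" "g t = \<beta> x" by blast
    define \<gamma> where "\<gamma> = (\<lambda>z. if z \<in> c ` verts T then g (inv c z) else \<beta> z)"
    have gc: "\<gamma> (c u) = g u" if "u \<in> verts T" for u using that ci by (simp add: \<gamma>_def)
    have im: "g ` verts T = ?B" using ball_iso_image[OF g(1)] g(2) T'(4) by simp
    then have im': "(\<gamma> \<circ> c) ` verts T = ?B" using gc by simp
    have "inj_on g (verts T)" using g(1) T'(4) by (simp add: ball_iso_def bij_betw_def)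
    then have 1: "inj_on (\<gamma> \<circ> c) (verts T)" using gc by (simp add: inj_on_def)
    have 2: "\<gamma> x = \<gamma> (c t)" using gc[OF T'(3)] g(2) cx by (auto simp: \<gamma>_def)
    have "?B \<subseteq> verts G" using nball_verts[OF G] x by simp
    then have 3: "\<forall>z\<in>c ` verts T. \<gamma> z \<in> verts G" using im' by auto
    have 4: "\<forall>u\<in>verts T. \<forall>v\<in>verts T. adj T u v \<longleftrightarrow> adj G (\<gamma> (c u)) (\<gamma> (c v))"
      using g(1) gc T'(4) by (simp add: ball_iso_def)
    have 5: "\<forall>z. z \<notin> c ` verts T \<longrightarrow> \<gamma> z = \<beta> z" by (simp add: \<gamma>_def)
    have 6: "\<forall>a\<in>?B. a \<in> (\<gamma> \<circ> c) ` verts T" unfolding im' by blast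
    show "\<exists>\<gamma>. ?P \<gamma>" using 1 2 3 4 5 6 by (intro exI[of _ \<gamma>] conjI)
  qed
  finally show ?thesis using has_ball_type_iff[OF G T] x by simp
qed

lemma expresses_many_type:
  assumes T: "ball_type r T t"
  shows "expresses (many_type_axiom h r T t)
    (\<lambda>G. \<exists>S\<subseteq>{v. has_ball_type G v r T t}. finite S \<and> card S = h)"
  unfolding expresses_def
proof (intro conjI allI impI)
  show "sentence (many_type_axiom h r T t)"
    using free_vars_ball_type_fm[OF T] free_vars_distinct_fm[of "[0..<h]"]
    by (fastforce simp: sentence_def many_type_axiom_def free_vars_FExs free_vars_FConj)
  fix G :: "'a ugraph" assume G: "simple_graph G"
  have "sat G \<beta> (many_type_axiom h r T t) \<longleftrightarrow>
    (\<exists>\<gamma>. (\<forall>i<h. \<gamma> i \<in> verts G) \<and> (\<forall>i. i \<notin> {0..<h} \<longrightarrow> \<gamma> i = \<beta> i) \<and> inj_on \<gamma> {0..<h} \<and>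
       (\<forall>i<h. has_ball_type G (\<gamma> i) r T t))" for \<beta>
    unfolding many_type_axiom_def sat_FExs
    using sat_ball_type_fm[OF G T]
    by (intro ex_cong1) (auto simp: sat_FConj sat_distinct_fm)
  also have "\<dots> \<beta> \<longleftrightarrow> (\<exists>S\<subseteq>{v. has_ball_type G v r T t}. finite S \<and> card S = h)" (is "?L \<longleftrightarrow> ?R") for \<beta>
  proof
    assume ?L
    then obtain \<gamma> where "inj_on \<gamma> {0..<h}" "\<forall>i<h. has_ball_type G (\<gamma> i) r T t" by blast
    then show ?R by (intro exI[of _ "\<gamma> ` {0..<h}"]) (auto simp: card_image)
  next
    assume ?R
    then obtain S where S: "S \<subseteq> {v. has_ball_type G v r T t}" "finite S" "card S = h" by blast
    then obtain g where g: "bij_betw g {0..<h} S" using ex_bij_betw_nat_finite by blast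
    then have "has_ball_type G (g i) r T t" if "i < h" for i
      using S(1) that bij_betwE[OF g] by auto
    moreover have "inj_on (\<lambda>i. if i < h then g i else \<beta> i) {0..<h}"
      using g by (auto simp: bij_betw_def inj_on_def)
    ultimately show ?L
      by (intro exI[of _ "\<lambda>i. if i < h then g i else \<beta> i"]) (auto simp: has_ball_type_def)
  qed
  finally show "models G (many_type_axiom h r T t) \<longleftrightarrow>
    (\<exists>S\<subseteq>{v. has_ball_type G v r T t}. finite S \<and> card S = h)" by (simp add: models_def)
qed

lemma expresses_omit_type:
  assumes T: "ball_type r T t"
  shows "expresses (omit_type_axiom r T t) (\<lambda>G. \<not> (\<exists>v. has_ball_type G v r T t))"
  unfolding expresses_def
proof (intro conjI allI impI)
  show "sentence (omit_type_axiom r T t)"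
    using free_vars_ball_type_fm[OF T] by (auto simp: sentence_def omit_type_axiom_def)
  fix G :: "'a ugraph" assume G: "simple_graph G"
  show "models G (omit_type_axiom r T t) \<longleftrightarrow> \<not> (\<exists>v. has_ball_type G v r T t)"
    using sat_ball_type_fm[OF G T] by (auto simp: models_def omit_type_axiom_def has_ball_type_def)
qed

lemma expresses_degree:
  "expresses (degree_axiom k) (\<lambda>G. \<forall>v\<in>verts G. finite (neighbours G v) \<and> card (neighbours G v) \<le> k)"
  unfolding expresses_def
proof (intro conjI allI impI)
  show "sentence (degree_axiom k)"
    using free_vars_distinct_fm[of "[1..<k + 2]"]
    by (fastforce simp: sentence_def degree_axiom_def free_vars_FExs free_vars_FConj)
  fix G :: "'a ugraph" assume G: "simple_graph G"
  let ?I = "{1..<k + 2}"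
  have I: "finite ?I" "card ?I = k + 1" "0 \<notin> ?I" by auto
  have "(\<exists>a\<in>verts G. sat G (\<beta>(0 := a)) (FExs [1..<k + 2]
       (FAnd (distinct_fm [1..<k + 2]) (FConj [FAdj 0 i. i \<leftarrow> [1..<k + 2]])))) \<longleftrightarrow>
    (\<exists>a\<in>verts G. \<exists>\<gamma>. (\<forall>i\<in>?I. \<gamma> i \<in> verts G) \<and> (\<forall>i. i \<notin> ?I \<longrightarrow> \<gamma> i = (\<beta>(0 := a)) i) \<and>
       inj_on \<gamma> ?I \<and> (\<forall>i\<in>?I. adj G a (\<gamma> i)))" for \<beta>
    unfolding sat_FExs set_upt using I(3)
    by (intro bex_cong refl ex_cong1) (auto simp: sat_FConj sat_distinct_fm simp del: upt_Suc)
  also have "\<dots> \<beta> \<longleftrightarrow> (\<exists>a\<in>verts G. infinite (neighbours G a) \<or> k < card (neighbours G a))" for \<beta>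
  proof (intro bex_cong refl iffI)
    fix a assume "\<exists>\<gamma>. (\<forall>i\<in>?I. \<gamma> i \<in> verts G) \<and> (\<forall>i. i \<notin> ?I \<longrightarrow> \<gamma> i = (\<beta>(0 := a)) i) \<and>
       inj_on \<gamma> ?I \<and> (\<forall>i\<in>?I. adj G a (\<gamma> i))"
    then obtain \<gamma> where g: "\<forall>i\<in>?I. \<gamma> i \<in> verts G" "inj_on \<gamma> ?I" "\<forall>i\<in>?I. adj G a (\<gamma> i)" by blast
    then have "\<gamma> ` ?I \<subseteq> neighbours G a" by (auto simp: neighbours_def)
    then show "infinite (neighbours G a) \<or> k < card (neighbours G a)"
      using card_mono[of "neighbours G a" "\<gamma> ` ?I"] card_image[OF g(2)] I(2) by auto
  next
    fix a assume "a \<in> verts G" "infinite (neighbours G a) \<or> k < card (neighbours G a)"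
    then obtain S where S: "S \<subseteq> neighbours G a" "finite S" "card S = k + 1"
      using infinite_arbitrarily_large[of "neighbours G a" "k + 1"]
        obtain_subset_with_card_n[of "k + 1" "neighbours G a"] by (metis Suc_eq_plus1 Suc_leI)
    then obtain g where g: "bij_betw g ?I S" using finite_same_card_bij[OF I(1) S(2)] I(2) by auto
    then have gS: "g i \<in> S" if "i \<in> ?I" for i using that by (auto simp: bij_betw_def)
    have "inj_on (\<lambda>i. if i \<in> ?I then g i else (\<beta>(0 := a)) i) ?I"
      using g by (auto simp: bij_betw_def inj_on_def)
    moreover have "\<forall>i\<in>?I. g i \<in> verts G \<and> adj G a (g i)" using gS S(1) unfolding neighbours_def by blast
    ultimately show "\<exists>\<gamma>. (\<forall>i\<in>?I. \<gamma> i \<in> verts G) \<and> (\<forall>i. i \<notin> ?I \<longrightarrow> \<gamma> i = (\<beta>(0 := a)) i) \<and>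
       inj_on \<gamma> ?I \<and> (\<forall>i\<in>?I. adj G a (\<gamma> i))"
      by (intro exI[of _ "\<lambda>i. if i \<in> ?I then g i else (\<beta>(0 := a)) i"]) simp
  qed
  finally show "models G (degree_axiom k) \<longleftrightarrow>
      (\<forall>v\<in>verts G. finite (neighbours G v) \<and> card (neighbours G v) \<le> k)"
    unfolding models_def degree_axiom_def sat.simps by (auto simp: not_less)
qed

text \<open>
  As long as a ball does not exhaust the component, each further unit of radius adds a vertex.
\<close>

lemma nball_grows:
  assumes "finite (nball G {v} r)"
  shows "r < card (nball G {v} r) \<or> (\<forall>s. nball G {v} s \<subseteq> nball G {v} r)"
  using assms
proof (induction r)
  case 0 then show ?case by simp
next
  case (Suc r)
  let ?B = "nball G {v}"
  have fin: "finite (?B r)" using Suc.prems by simp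
  show ?case
  proof (cases "?B (Suc r) = ?B r")
    case True
    then have closed: "w \<in> ?B r" if "u \<in> ?B r" "adj G u w" for u w using nball_nbhd[OF that] by simp
    have "?B s \<subseteq> ?B r" for s
    proof (induction s)
      case 0 show ?case using nball_self[of "{v}" G r] by simp
    next
      case (Suc s)
      then show ?case using closed by (simp add: subset_iff) blast
    qed
    then show ?thesis unfolding True by blast
  next
    case False
    then have less: "?B r \<subset> ?B (Suc r)" by auto
    then have "card (?B r) < card (?B (Suc r))" using Suc.prems psubset_card_mono by blast
    moreover have "r < card (?B r)" using Suc.IH[OF fin] less by blast
    ultimately show ?thesis by simp
  qed
qed

text \<open>
  Reachability is not first-order, but in a component of size \<open>m\<close> every vertex is within distance \<open>m\<close>
  of every other one by \<open>nball_grows\<close>.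
\<close>

lemma expresses_no_component:
  assumes m: "m \<ge> 1"
  shows "expresses (no_component_axiom m) (\<lambda>G. \<not> (\<exists>v\<in>verts G. card (component G v) = m))"
  unfolding expresses_def
proof (intro conjI allI impI)
  have A: "z < m" if "z \<in> free_vars (dist_fm m 0 i)" "i < m" for i z
    using subsetD[OF free_vars_dist_fm that(1)] that(2) m by auto
  have B: "z < m" if "z \<in> free_vars (distinct_fm [0..<m])" for z
    using subsetD[OF free_vars_distinct_fm that] by simp
  show "sentence (no_component_axiom m)"
    unfolding sentence_def no_component_axiom_def using m
    by (auto simp: free_vars_FExs free_vars_FConj free_vars_FDisj dest: A B)
  fix G :: "'a ugraph" assume G: "simple_graph G"
  let ?I = "{0..<m}"
  let ?\<phi> = "FConj [distinct_fm [0..<m],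
        FConj [dist_fm m 0 i. i \<leftarrow> [0..<m]],
        FAll m (FImp (FDisj [FAdj i m. i \<leftarrow> [0..<m]]) (FDisj [FEq m i. i \<leftarrow> [0..<m]]))]"
  have core: "sat G \<gamma> ?\<phi> \<longleftrightarrow> inj_on \<gamma> ?I \<and> (\<forall>i<m. \<gamma> i \<in> nball G {\<gamma> 0} m) \<and>
      (\<forall>a. \<forall>i<m. adj G (\<gamma> i) a \<longrightarrow> a \<in> \<gamma> ` ?I)" if "\<gamma> 0 \<in> verts G" for \<gamma>
  proof -
    have "sat G \<gamma> ?\<phi> \<longleftrightarrow> inj_on \<gamma> ?I \<and> (\<forall>i\<in>?I. sat G \<gamma> (dist_fm m 0 i)) \<and>
      (\<forall>a\<in>verts G. (\<exists>i\<in>?I. adj G (\<gamma> i) a) \<longrightarrow> (\<exists>i\<in>?I. a = \<gamma> i))"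
      by (auto simp: sat_FConj sat_FDisj sat_distinct_fm)
    also have "(\<forall>i\<in>?I. sat G \<gamma> (dist_fm m 0 i)) \<longleftrightarrow> (\<forall>i<m. \<gamma> i \<in> nball G {\<gamma> 0} m)"
      using sat_dist_fm[OF G, of \<gamma> 0] that by auto
    also have "(\<forall>a\<in>verts G. (\<exists>i\<in>?I. adj G (\<gamma> i) a) \<longrightarrow> (\<exists>i\<in>?I. a = \<gamma> i)) \<longleftrightarrow>
      (\<forall>a. \<forall>i<m. adj G (\<gamma> i) a \<longrightarrow> a \<in> \<gamma> ` ?I)"
      using simple_adj(2)[OF G] unfolding image_iff atLeast0LessThan lessThan_iff Bex_def Ball_def by blast
    finally show ?thesis .
  qed
  have "sat G \<beta> (FExs [0..<m] ?\<phi>) \<longleftrightarrow> (\<exists>v\<in>verts G. card (component G v) = m)" (is "?L \<longleftrightarrow> ?R") for \<beta>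
  proof
    assume ?L
    then obtain \<gamma> where g: "\<forall>i\<in>set [0..<m]. \<gamma> i \<in> verts G" "sat G \<gamma> ?\<phi>"
      unfolding sat_FExs by blast
    have v: "\<gamma> 0 \<in> verts G" using g m by simp
    have c: "inj_on \<gamma> ?I" "\<And>i. i < m \<Longrightarrow> \<gamma> i \<in> nball G {\<gamma> 0} m"
      "\<And>i a. i < m \<Longrightarrow> adj G (\<gamma> i) a \<Longrightarrow> a \<in> \<gamma> ` ?I"
      using g(2) v unfolding core[of \<gamma>, OF v] by blast+
    have "nball G {\<gamma> 0} s \<subseteq> \<gamma> ` ?I" for s
    proof (induction s)
      case 0 then show ?case using m by auto
    next
      case (Suc s) then show ?case using c(3) by fastforce
    qed
    moreover have "\<gamma> ` ?I \<subseteq> nball G {\<gamma> 0} m" using c(2) by auto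
    ultimately have "component G (\<gamma> 0) = \<gamma> ` ?I" unfolding component_eq_nball[OF G v] by blast
    then have "card (component G (\<gamma> 0)) = m" using c(1) by (simp add: card_image)
    then show ?R using v by blast
  next
    assume ?R
    then obtain v where v: "v \<in> verts G" "card (component G v) = m" by blast
    have C: "component G v = (\<Union>r. nball G {v} r)" by (rule component_eq_nball[OF G v(1)])
    have fin: "finite (component G v)" using v(2) m card_ge_0_finite by force
    have vC: "v \<in> component G v" using v(1) by (simp add: component_def)
    have sub: "nball G {v} m \<subseteq> component G v" unfolding C by blast
    then have "card (nball G {v} m) \<le> m" "finite (nball G {v} m)"
      using card_mono[OF fin] v(2) fin finite_subset by auto
    then have "\<forall>s. nball G {v} s \<subseteq> nball G {v} m" using nball_grows[of G v m] by auto
    then have Cm: "component G v = nball G {v} m" unfolding C by blast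
    obtain g where g: "bij_betw g ?I (component G v)" using ex_bij_betw_nat_finite[OF fin] v(2) by auto
    then obtain j where j: "j < m" "g j = v" using vC unfolding bij_betw_def by (metis atLeastLessThan_iff imageE)
    \<comment> \<open>The formula measures distances from variable \<open>0\<close>, which therefore has to denote \<open>v\<close>.\<close>
    have sw: "bij_betw (g \<circ> Transposition.transpose 0 j) ?I (component G v)"
      using j m by (intro bij_betw_trans[OF _ g] bij_betw_transpose_iff) auto
    define h where "h = g \<circ> Transposition.transpose 0 j"
    have h: "bij_betw h ?I (component G v)" "h 0 = v" using sw j by (auto simp: h_def)
    define \<gamma> where "\<gamma> = (\<lambda>i. if i < m then h i else \<beta> i)"
    have \<gamma>0: "\<gamma> 0 = v" using h(2) m by (simp add: \<gamma>_def)
    have im: "\<gamma> ` ?I = component G v" using h(1) by (auto simp: bij_betw_def \<gamma>_def)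
    have "inj_on \<gamma> ?I" using h(1) by (auto simp: bij_betw_def \<gamma>_def inj_on_def)
    moreover have "\<forall>i<m. \<gamma> i \<in> nball G {\<gamma> 0} m" using im Cm \<gamma>0 by auto
    moreover have "a \<in> \<gamma> ` ?I" if "i < m" "adj G (\<gamma> i) a" for i a
    proof -
      have "\<gamma> i \<in> nball G {v} m" using im Cm that by auto
      then have "a \<in> nball G {v} (Suc m)" using that nball_nbhd by metis
      then show ?thesis unfolding im C by blast
    qed
    ultimately have "sat G \<gamma> ?\<phi>" using core[of \<gamma>] \<gamma>0 v(1) by blast
    moreover have "\<forall>i\<in>set [0..<m]. \<gamma> i \<in> verts G" using im by (auto simp: component_def)
    moreover have "\<forall>i. i \<notin> set [0..<m] \<longrightarrow> \<gamma> i = \<beta> i" by (simp add: \<gamma>_def)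
    ultimately show ?L unfolding sat_FExs by blast
  qed
  then show "models G (no_component_axiom m) \<longleftrightarrow> \<not> (\<exists>v\<in>verts G. card (component G v) = m)"
    unfolding models_def no_component_axiom_def sat.simps by blast
qed

section \<open>Ball types of the lattice and of the torus\<close>

lemma subgraphD:
  assumes "subgraph H G"
  shows "simple_graph H" "verts H \<subseteq> verts G" "edges H \<subseteq> edges G" "adj H x y \<Longrightarrow> adj G x y"
  using assms by (auto simp: subgraph_def adj_def)

lemma adj_iff_edge_relation:
  assumes "edges G = {{x, y} | x y. P x y}" "\<And>x y. P x y \<Longrightarrow> P y x"
  shows "adj G x y \<longleftrightarrow> P x y"
proof
  assume "adj G x y"
  then obtain x' y' where "{x, y} = {x', y'}" "P x' y'" unfolding adj_def assms(1) by blast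
  then show "P x y" using assms(2) by (auto simp: doubleton_eq_iff)
qed (auto simp: adj_def assms(1))

lemma adj_lattice:
  "adj (lattice d) x y \<longleftrightarrow> x \<in> {..<d} \<rightarrow>\<^sub>E UNIV \<and> y \<in> {..<d} \<rightarrow>\<^sub>E UNIV \<and>
     (\<exists>i<d. \<bar>x i - y i\<bar> = 1 \<and> (\<forall>j<d. j \<noteq> i \<longrightarrow> x j = y j))"
proof (rule adj_iff_edge_relation)
  fix x y :: "nat \<Rightarrow> int"
  assume *: "x \<in> {..<d} \<rightarrow>\<^sub>E UNIV \<and> y \<in> {..<d} \<rightarrow>\<^sub>E UNIV \<and>
     (\<exists>i<d. \<bar>x i - y i\<bar> = 1 \<and> (\<forall>j<d. j \<noteq> i \<longrightarrow> x j = y j))"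
  then obtain i where "i < d" "\<bar>x i - y i\<bar> = 1" "\<forall>j<d. j \<noteq> i \<longrightarrow> x j = y j" by auto
  then have "\<exists>i<d. \<bar>y i - x i\<bar> = 1 \<and> (\<forall>j<d. j \<noteq> i \<longrightarrow> y j = x j)"
    by (intro exI[of _ i]) (simp add: abs_minus_commute)
  with * show "y \<in> {..<d} \<rightarrow>\<^sub>E UNIV \<and> x \<in> {..<d} \<rightarrow>\<^sub>E UNIV \<and>
     (\<exists>i<d. \<bar>y i - x i\<bar> = 1 \<and> (\<forall>j<d. j \<noteq> i \<longrightarrow> y j = x j))" by simp
qed (simp add: lattice_def)

lemma adj_torus:
  "adj (torus d L) x y \<longleftrightarrow> x \<in> {..<d} \<rightarrow>\<^sub>E {0..<int L} \<and> y \<in> {..<d} \<rightarrow>\<^sub>E {0..<int L} \<and> x \<noteq> y \<and>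
     (\<exists>i<d. ([x i - y i = 1] (mod int L) \<or> [x i - y i = -1] (mod int L)) \<and>
        (\<forall>j<d. j \<noteq> i \<longrightarrow> x j = y j))"
proof (rule adj_iff_edge_relation)
  fix x y :: "nat \<Rightarrow> int"
  assume *: "x \<in> {..<d} \<rightarrow>\<^sub>E {0..<int L} \<and> y \<in> {..<d} \<rightarrow>\<^sub>E {0..<int L} \<and> x \<noteq> y \<and>
     (\<exists>i<d. ([x i - y i = 1] (mod int L) \<or> [x i - y i = -1] (mod int L)) \<and>
        (\<forall>j<d. j \<noteq> i \<longrightarrow> x j = y j))"
  then obtain i where i: "i < d" "[x i - y i = 1] (mod int L) \<or> [x i - y i = -1] (mod int L)"
    "\<forall>j<d. j \<noteq> i \<longrightarrow> x j = y j" by auto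
  have "[y i - x i = 1] (mod int L) \<or> [y i - x i = -1] (mod int L)"
    using i(2) cong_minus_minus_iff[of "x i - y i" 1 "int L"]
      cong_minus_minus_iff[of "x i - y i" "-1" "int L"] by auto
  then have "\<exists>i<d. ([y i - x i = 1] (mod int L) \<or> [y i - x i = -1] (mod int L)) \<and>
      (\<forall>j<d. j \<noteq> i \<longrightarrow> y j = x j)"
    using i(1,3) by (intro exI[of _ i]) simp
  moreover have "x \<in> {..<d} \<rightarrow>\<^sub>E {0..<int L}" "y \<in> {..<d} \<rightarrow>\<^sub>E {0..<int L}" "y \<noteq> x"
    using conjunct1[OF *] conjunct1[OF conjunct2[OF *]] conjunct1[OF conjunct2[OF conjunct2[OF *]]]
    by simp_all
  ultimately show "y \<in> {..<d} \<rightarrow>\<^sub>E {0..<int L} \<and> x \<in> {..<d} \<rightarrow>\<^sub>E {0..<int L} \<and> y \<noteq> x \<and>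
     (\<exists>i<d. ([y i - x i = 1] (mod int L) \<or> [y i - x i = -1] (mod int L)) \<and>
        (\<forall>j<d. j \<noteq> i \<longrightarrow> y j = x j))" by (intro conjI)
qed (simp add: torus_def)

lemma adj_latticeE:
  assumes "adj (lattice d) x y"
  obtains i where "i < d" "\<bar>x i - y i\<bar> = 1" "\<forall>j<d. j \<noteq> i \<longrightarrow> x j = y j"
    "x \<in> {..<d} \<rightarrow>\<^sub>E UNIV" "y \<in> {..<d} \<rightarrow>\<^sub>E UNIV"
  using iffD1[OF adj_lattice assms] by (elim conjE exE) (rule that; assumption)

lemma adj_torusE:
  assumes "adj (torus d L) x y"
  obtains i where "i < d" "[x i - y i = 1] (mod int L) \<or> [x i - y i = -1] (mod int L)"
    "\<forall>j<d. j \<noteq> i \<longrightarrow> x j = y j"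
    "x \<in> {..<d} \<rightarrow>\<^sub>E {0..<int L}" "y \<in> {..<d} \<rightarrow>\<^sub>E {0..<int L}"
  using iffD1[OF adj_torus assms] by (elim conjE exE) (rule that; assumption)

lemma simple_lattice: "simple_graph (lattice d)"
  unfolding simple_graph_def
proof
  fix e assume "e \<in> edges (lattice d)"
  moreover from this obtain x y where "e = {x, y}"
    unfolding lattice_def ugraph.simps mem_Collect_eq by blast
  ultimately have xy: "e = {x, y}" "adj (lattice d) x y" by (simp_all add: adj_def)
  obtain i where i: "\<bar>x i - y i\<bar> = 1" and v: "x \<in> {..<d} \<rightarrow>\<^sub>E UNIV" "y \<in> {..<d} \<rightarrow>\<^sub>E UNIV"
    using xy(2) by (rule adj_latticeE)
  have "x \<noteq> y" using i by auto
  moreover have "x \<in> verts (lattice d)" "y \<in> verts (lattice d)" using v by (simp_all add: lattice_def)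
  ultimately show "\<exists>u\<in>verts (lattice d). \<exists>v\<in>verts (lattice d). u \<noteq> v \<and> e = {u, v}" using xy(1) by blast
qed

lemma simple_torus: "simple_graph (torus d L)"
  unfolding simple_graph_def by (auto simp: torus_def)

lemma finite_torus: "finite (verts (torus d L))" "finite (edges (torus d L))"
proof -
  show fin: "finite (verts (torus d L))" by (auto simp: torus_def intro!: finite_PiE)
  have "edges (torus d L) \<subseteq> Pow (verts (torus d L))" by (auto simp: torus_def)
  then show "finite (edges (torus d L))" using fin finite_subset by blast
qed

text \<open>
  The function \<open>g\<close> is the identity for the lattice and reduction modulo \<open>L\<close> for the torus.
\<close>

lemma card_neighbours_le:
  fixes v :: "nat \<Rightarrow> int"
  assumes "\<And>w. adj G v w \<Longrightarrow> \<exists>i<d. \<exists>s\<in>{1, -1}. w = v(i := g (v i + s))"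
  shows "finite (neighbours G v) \<and> card (neighbours G v) \<le> 2 * d"
proof -
  let ?F = "(\<lambda>(i, s). v(i := g (v i + s))) ` ({..<d} \<times> {1, -1})"
  have sub: "neighbours G v \<subseteq> ?F"
  proof
    fix w assume "w \<in> neighbours G v"
    then have "adj G v w" by (simp add: neighbours_def)
    from assms[OF this] obtain i s where "i < d" "s \<in> {1, -1}" "w = v(i := g (v i + s))"
      by (elim exE conjE bexE) (rule that; assumption)
    then show "w \<in> ?F" by (intro image_eqI[of _ _ "(i, s)"]) auto
  qed
  have "card ?F \<le> card ({..<d} \<times> {1, -1 :: int})" by (rule card_image_le) auto
  also have "\<dots> = 2 * d" by (simp add: card_cartesian_product)
  finally have "card ?F \<le> 2 * d" .
  moreover have "finite ?F" by blast
  ultimately show ?thesis using finite_subset[OF sub] card_mono[OF _ sub] by linarith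
qed

lemma lattice_step:
  assumes "adj (lattice d) x y"
  obtains i s where "i < d" "s \<in> {1, -1}" "y = x(i := x i + s)"
proof -
  obtain i where i: "i < d" "\<bar>x i - y i\<bar> = 1" "\<forall>j<d. j \<noteq> i \<longrightarrow> x j = y j"
    and xy: "x \<in> {..<d} \<rightarrow>\<^sub>E UNIV" "y \<in> {..<d} \<rightarrow>\<^sub>E UNIV"
    using assms by (rule adj_latticeE)
  have "y = x(i := x i + (y i - x i))"
  proof
    fix j show "y j = (x(i := x i + (y i - x i))) j"
      using i xy by (cases "j < d") (auto simp: PiE_def extensional_def)
  qed
  moreover have "y i - x i \<in> {1, -1}" using i(2) by auto
  ultimately show thesis using that i(1) by blast
qed

lemma lattice_stepI:
  assumes "x \<in> {..<d} \<rightarrow>\<^sub>E UNIV" "i < d" "s \<in> {1, -1}"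
  shows "adj (lattice d) x (x(i := x i + s))"
proof -
  have "x(i := x i + s) \<in> {..<d} \<rightarrow>\<^sub>E UNIV" using assms by (auto simp: PiE_def extensional_def)
  moreover have "\<bar>x i - (x(i := x i + s)) i\<bar> = 1" using assms(3) by auto
  moreover have "\<forall>j<d. j \<noteq> i \<longrightarrow> x j = (x(i := x i + s)) j" by simp
  ultimately show ?thesis unfolding adj_lattice using assms(1,2) by blast
qed

lemma torus_step:
  assumes "adj (torus d L) x y"
  obtains i s where "i < d" "s \<in> {1, -1}" "y = x(i := (x i + s) mod int L)"
proof -
  obtain i where i: "i < d" "[x i - y i = 1] (mod int L) \<or> [x i - y i = -1] (mod int L)"
      "\<forall>j<d. j \<noteq> i \<longrightarrow> x j = y j"
    and xy: "x \<in> {..<d} \<rightarrow>\<^sub>E {0..<int L}" "y \<in> {..<d} \<rightarrow>\<^sub>E {0..<int L}"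
    using assms by (rule adj_torusE)
  have yi: "y i \<in> {0..<int L}" using xy i(1) by (auto simp: PiE_def)
  have "\<exists>s\<in>{1, -1}. [y i = x i + s] (mod int L)"
  proof (cases "[x i - y i = 1] (mod int L)")
    case True
    then have "int L dvd (x i - y i - 1)" by (simp add: cong_iff_dvd_diff)
    then have "int L dvd - (x i - y i - 1)" by (simp only: dvd_minus_iff)
    then have "[y i = x i + -1] (mod int L)" by (simp add: cong_iff_dvd_diff algebra_simps)
    then show ?thesis by blast
  next
    case False
    then have "int L dvd (x i - y i + 1)" using i(2) by (simp add: cong_iff_dvd_diff)
    then have "int L dvd - (x i - y i + 1)" by (simp only: dvd_minus_iff)
    then have "[y i = x i + 1] (mod int L)" by (simp add: cong_iff_dvd_diff algebra_simps)
    then show ?thesis by blast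
  qed
  then obtain s where s: "s \<in> {1, -1}" "[y i = x i + s] (mod int L)" by blast
  then have yi': "y i = (x i + s) mod int L" using yi by (simp add: cong_def)
  have "y = x(i := (x i + s) mod int L)"
  proof
    fix j show "y j = (x(i := (x i + s) mod int L)) j"
      using i xy yi' by (cases "j < d") (auto simp: PiE_def extensional_def)
  qed
  then show thesis using that s(1) i(1) by blast
qed

lemma lattice_degree:
  assumes "subgraph X (lattice d)"
  shows "finite (neighbours X v) \<and> card (neighbours X v) \<le> 2 * d"
  by (rule card_neighbours_le[where g = "\<lambda>a. a"]) (metis lattice_step subgraphD(4)[OF assms])

lemma torus_degree:
  assumes "subgraph X (torus d L)"
  shows "finite (neighbours X v) \<and> card (neighbours X v) \<le> 2 * d"
  by (rule card_neighbours_le[where g = "\<lambda>a. a mod int L"]) (metis torus_step subgraphD(4)[OF assms])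

lemma lattice_nball_close:
  assumes X: "subgraph X (lattice d)"
  shows "y \<in> nball X {x} r \<Longrightarrow> i < d \<Longrightarrow> \<bar>y i - x i\<bar> \<le> int r"
proof (induction r arbitrary: y)
  case (Suc r)
  consider "y \<in> nball X {x} r" | u where "u \<in> nball X {x} r" "adj X u y" using Suc.prems by auto
  then show ?case
  proof cases
    case 1 then show ?thesis using Suc.IH[of y] Suc.prems by simp
  next
    case 2
    obtain k s where "k < d" "s \<in> {1, -1 :: int}" "y = u(k := u k + s)"
      using lattice_step[OF subgraphD(4)[OF X 2(2)]] .
    then have "\<bar>y i - u i\<bar> \<le> 1" by (auto simp: fun_upd_def)
    then show ?thesis using Suc.IH[OF 2(1) Suc.prems(2)] by linarith
  qed
qed simp

definition lattice_box :: "nat \<Rightarrow> nat \<Rightarrow> (nat \<Rightarrow> int) set" where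
  "lattice_box d r = {..<d} \<rightarrow>\<^sub>E {- int r..int r}"

lemma finite_lattice_box: "finite (lattice_box d r)"
  by (auto simp: lattice_box_def intro!: finite_PiE)

lemma card_lattice_box: "card (lattice_box d r) = (2 * r + 1) ^ d"
proof -
  have "card {- int r..int r} = 2 * r + 1" by simp
  then show ?thesis by (simp only: lattice_box_def card_PiE finite_lessThan prod_constant card_lessThan)
qed

lemma lattice_box_verts: "lattice_box d r \<subseteq> verts (lattice d)"
  by (auto simp: lattice_box_def lattice_def PiE_def)

lemma origin_in_lattice_box: "lattice_origin d \<in> lattice_box d r"
  by (auto simp: lattice_box_def lattice_origin_def)

lemma nball_origin_lattice_box:
  assumes X: "subgraph X (lattice d)" and o: "lattice_origin d \<in> verts X"
  shows "nball X {lattice_origin d} r \<subseteq> lattice_box d r"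
proof
  fix y assume y: "y \<in> nball X {lattice_origin d} r"
  then have "y \<in> verts X" using nball_verts[OF subgraphD(1)[OF X], of "{lattice_origin d}" r] o by blast
  then have "y \<in> {..<d} \<rightarrow>\<^sub>E UNIV" using subgraphD(2)[OF X] by (auto simp: lattice_def)
  moreover have "\<bar>y i\<bar> \<le> int r" if "i < d" for i
    using lattice_nball_close[OF X y that] that by (simp add: lattice_origin_def)
  ultimately show "y \<in> lattice_box d r" by (force simp: lattice_box_def PiE_def)
qed

text \<open>
  A map from the lattice to \<open>G\<close> which lifts edges is onto every ball around the image
  of the origin. If it is injective on a box, the ball can be copied into the lattice by pulling back
  the edges of \<open>G\<close> between points of the box. This covers translations of lattice subgraphs
  and the projection of the lattice onto the torus.
\<close>

lemma lattice_type_covering: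
  assumes G: "simple_graph G" and T: "ball_type r T t" and ty: "has_ball_type G v r T t"
    and o: "\<pi> (lattice_origin d) = v"
    and inj: "inj_on \<pi> (lattice_box d r)"
    and refl: "\<And>x y. x \<in> lattice_box d r \<Longrightarrow> y \<in> lattice_box d r \<Longrightarrow> adj G (\<pi> x) (\<pi> y) \<Longrightarrow> adj (lattice d) x y"
    and lift: "\<And>x w. x \<in> verts (lattice d) \<Longrightarrow> adj G (\<pi> x) w \<Longrightarrow> \<exists>y. adj (lattice d) x y \<and> \<pi> y = w"
  shows "lattice_type d r T t"
proof -
  let ?W = "lattice_box d r" and ?o = "lattice_origin d"
  define X where "X = \<lparr>verts = verts (lattice d),
    edges = {{x, y} | x y. x \<in> ?W \<and> y \<in> ?W \<and> adj G (\<pi> x) (\<pi> y)}\<rparr>"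
  have adj: "adj X x y \<longleftrightarrow> adj G (\<pi> x) (\<pi> y)" if "x \<in> ?W" "y \<in> ?W" for x y
  proof -
    have "adj X x y \<longleftrightarrow> x \<in> ?W \<and> y \<in> ?W \<and> adj G (\<pi> x) (\<pi> y)"
      by (rule adj_iff_edge_relation) (auto simp: X_def adj_sym)
    then show ?thesis using that by blast
  qed
  have X: "subgraph X (lattice d)"
    unfolding subgraph_def
  proof (intro conjI)
    have eX: "edges X \<subseteq> edges (lattice d)" using refl by (auto simp: X_def adj_def[of "lattice d"])
    then show "edges X \<subseteq> edges (lattice d)" .
    show "verts X \<subseteq> verts (lattice d)" by (simp add: X_def)
    show "simple_graph X" unfolding simple_graph_def
    proof
      fix e assume "e \<in> edges X"
      then have "e \<in> edges (lattice d)" using eX by blast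
      then show "\<exists>u\<in>verts X. \<exists>v\<in>verts X. u \<noteq> v \<and> e = {u, v}"
        using simple_lattice[of d] by (simp add: simple_graph_def X_def)
    qed
  qed
  have oX: "?o \<in> verts X" using origin_in_lattice_box lattice_box_verts by (fastforce simp: X_def)
  have lift_ball: "w \<in> nball G {v} j \<Longrightarrow> \<exists>x\<in>nball (lattice d) {?o} j. \<pi> x = w" for w j
  proof (induction j arbitrary: w)
    case (Suc j)
    consider "w \<in> nball G {v} j" | u where "u \<in> nball G {v} j" "adj G u w" using Suc.prems by auto
    then show ?case
    proof cases
      case 1 then show ?thesis using Suc.IH by fastforce
    next
      case 2
      then obtain x where x: "x \<in> nball (lattice d) {?o} j" "\<pi> x = u" using Suc.IH by blast
      have "nball (lattice d) {?o} j \<subseteq> verts (lattice d)"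
        using oX by (intro nball_verts[OF simple_lattice]) (simp add: X_def)
      then obtain y where "adj (lattice d) x y" "\<pi> y = w" using lift[of x w] x 2(2) by blast
      then show ?thesis using nball_nbhd[OF x(1)] by blast
    qed
  qed (use o in simp)
  have "subgraph (lattice d) (lattice d)" using simple_lattice by (simp add: subgraph_def)
  then have "nball (lattice d) {?o} r \<subseteq> ?W" using oX by (intro nball_origin_lattice_box) (simp_all add: X_def)
  then have "nball G (\<pi> ` {?o}) r \<subseteq> \<pi> ` ?W" using lift_ball[of _ r] o by fastforce
  then have iso: "ball_iso X {?o} G \<pi> r"
    using inj adj nball_origin_lattice_box[OF X oX] by (intro ball_isoI[where W = ?W]) auto
  obtain g where g: "ball_iso G (\<pi> ` {?o}) X g r" "g ` \<pi> ` {?o} = {?o}" using ball_iso_inv[OF iso] by metis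
  have "has_ball_type X (g v) r T t"
    using g o oX by (intro has_ball_type_transfer[OF G subgraphD(1)[OF X] T ty]) auto
  then show ?thesis using X g(2) o by (auto simp: lattice_type_def)
qed

definition translate :: "nat \<Rightarrow> (nat \<Rightarrow> int) \<Rightarrow> (nat \<Rightarrow> int) \<Rightarrow> nat \<Rightarrow> int" where
  "translate d a x = (\<lambda>i\<in>{..<d}. x i + a i)"

lemma translate_apply: "i < d \<Longrightarrow> translate d a x i = x i + a i"
  by (simp add: translate_def)

lemma inj_translate: "inj_on (translate d a) (verts (lattice d))"
proof (rule inj_onI)
  fix x y assume xy: "x \<in> verts (lattice d)" "y \<in> verts (lattice d)" "translate d a x = translate d a y"
  have "x i = y i" if "i < d" for i using fun_cong[OF xy(3), of i] that by (simp add: translate_apply)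
  then show "x = y" using xy(1,2) by (auto simp: lattice_def intro: PiE_ext)
qed

lemma adj_lattice_translate:
  assumes "x \<in> verts (lattice d)" "y \<in> verts (lattice d)"
  shows "adj (lattice d) (translate d a x) (translate d a y) \<longleftrightarrow> adj (lattice d) x y"
  using assms unfolding adj_lattice by (auto simp: lattice_def translate_def cong: conj_cong)

lemma lattice_type_of_lattice_subgraph:
  assumes X: "subgraph X (lattice d)" and T: "ball_type r T t" and ty: "has_ball_type X v r T t"
  shows "lattice_type d r T t"
proof (rule lattice_type_covering[OF subgraphD(1)[OF X] T ty])
  have v: "v \<in> verts (lattice d)" using ty subgraphD(2)[OF X] by (auto simp: has_ball_type_def)
  show "translate d v (lattice_origin d) = v"
    using v by (auto simp: translate_def lattice_origin_def lattice_def PiE_def extensional_def)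
  show "inj_on (translate d v) (lattice_box d r)" by (rule inj_on_subset[OF inj_translate lattice_box_verts])
  show "adj (lattice d) x y" if "x \<in> lattice_box d r" "y \<in> lattice_box d r" "adj X (translate d v x) (translate d v y)" for x y
    using that lattice_box_verts subgraphD(4)[OF X] adj_lattice_translate by blast
  fix x w assume x: "x \<in> verts (lattice d)" "adj X (translate d v x) w"
  then obtain i s where s: "i < d" "s \<in> {1, -1}" "w = (translate d v x)(i := translate d v x i + s)"
    using lattice_step[OF subgraphD(4)[OF X x(2)]] by metis
  have "translate d v (x(i := x i + s)) = w" using s by (auto simp: translate_def)
  moreover have "adj (lattice d) x (x(i := x i + s))"
    using lattice_stepI x(1) s by (simp add: lattice_def)
  ultimately show "\<exists>y. adj (lattice d) x y \<and> translate d v y = w" by blast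
qed

text \<open>
  Points at distance at most \<open>r\<close> come from a box that does not wrap around the torus. The width
  \<open>2 * r + 1\<close> of the box makes the projection injective for \<open>L > 2 * r\<close>; one more unit is needed to exclude that two opposite
  sides of the box become adjacent.
\<close>

lemma lattice_type_of_torus_subgraph:
  assumes X: "subgraph X (torus d L)" and L: "2 * r + 2 \<le> L"
    and T: "ball_type r T t" and ty: "has_ball_type X v r T t"
  shows "lattice_type d r T t"
proof (rule lattice_type_covering[OF subgraphD(1)[OF X] T ty])
  let ?\<pi> = "\<lambda>x. \<lambda>i\<in>{..<d}. (v i + x i) mod int L"
  have v: "v \<in> {..<d} \<rightarrow>\<^sub>E {0..<int L}"
    using ty subgraphD(2)[OF X] by (auto simp: has_ball_type_def torus_def)
  have vi: "v i mod int L = v i" if "i < d" for i using PiE_mem[OF v, of i] that by simp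
  show "?\<pi> (lattice_origin d) = v"
  proof
    fix i show "?\<pi> (lattice_origin d) i = v i"
      using v vi[of i] by (cases "i < d") (auto simp: lattice_origin_def PiE_def extensional_def)
  qed
  have small: "a = b" if "int L dvd (a - b)" "\<bar>a\<bar> \<le> int r" "\<bar>b\<bar> \<le> int r + 1" for a b :: int
  proof (rule ccontr)
    assume "a \<noteq> b"
    then have "int L \<le> \<bar>a - b\<bar>" using that(1) zdvd_imp_le[of "int L" "\<bar>a - b\<bar>"] by simp
    then show False using that L by linarith
  qed
  have bx: "\<bar>x i\<bar> \<le> int r" if "x \<in> lattice_box d r" "i < d" for x i using that by (force simp: lattice_box_def PiE_def)
  have eq: "x i = y i" if "x \<in> lattice_box d r" "y \<in> lattice_box d r" "i < d" "?\<pi> x i = ?\<pi> y i" for x y i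
  proof -
    have "int L dvd (v i + x i - (v i + y i))" using that by (simp add: mod_eq_dvd_iff)
    then show ?thesis using bx[OF that(1,3)] bx[OF that(2,3)] by (intro small) auto
  qed
  show "inj_on ?\<pi> (lattice_box d r)"
  proof (rule inj_onI)
    fix x y assume xy: "x \<in> lattice_box d r" "y \<in> lattice_box d r" "?\<pi> x = ?\<pi> y"
    have "x i = y i" if "i < d" for i using eq[OF xy(1,2) that] fun_cong[OF xy(3), of i] by blast
    then show "x = y" using xy(1,2) unfolding lattice_box_def by (intro PiE_ext)  auto
  qed
  show "adj (lattice d) x y" if xy: "x \<in> lattice_box d r" "y \<in> lattice_box d r" "adj X (?\<pi> x) (?\<pi> y)" for x y
  proof -
    obtain i where i: "i < d" "[?\<pi> x i - ?\<pi> y i = 1] (mod int L) \<or> [?\<pi> x i - ?\<pi> y i = -1] (mod int L)"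
      "\<forall>j<d. j \<noteq> i \<longrightarrow> ?\<pi> x j = ?\<pi> y j"
      by (rule adj_torusE[OF subgraphD(4)[OF X xy(3)]])
    have other: "\<forall>j<d. j \<noteq> i \<longrightarrow> x j = y j" using eq[OF xy(1,2)] i(3) by blast
    have "(?\<pi> x i - ?\<pi> y i) mod int L = (x i - y i) mod int L"
      using i(1) by (simp add: mod_diff_eq)
    then have "[x i - y i = 1] (mod int L) \<or> [x i - y i = -1] (mod int L)"
      using i(2) unfolding cong_def by metis
    then have "int L dvd (x i - (y i + 1)) \<or> int L dvd (x i - (y i - 1))"
      by (simp add: cong_iff_dvd_diff algebra_simps)
    moreover have "\<bar>x i\<bar> \<le> int r" "\<bar>y i + 1\<bar> \<le> int r + 1" "\<bar>y i - 1\<bar> \<le> int r + 1"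
      using bx[OF xy(1) i(1)] bx[OF xy(2) i(1)] by auto
    ultimately have "x i = y i + 1 \<or> x i = y i - 1" using small by blast
    then have "\<bar>x i - y i\<bar> = 1" by auto
    then show ?thesis using xy(1,2) lattice_box_verts[of d r] i(1) other unfolding adj_lattice
      by (auto simp: lattice_def)
  qed
  fix x w assume x: "x \<in> verts (lattice d)" "adj X (?\<pi> x) w"
  obtain i s where s: "i < d" "s \<in> {1, -1}" "w = (?\<pi> x)(i := (?\<pi> x i + s) mod int L)"
    using torus_step[OF subgraphD(4)[OF X x(2)]] .
  have "?\<pi> (x(i := x i + s)) = w"
    using s(1,3) by (auto simp: mod_simps add.assoc)
  moreover have "adj (lattice d) x (x(i := x i + s))"
    using lattice_stepI x(1) s by (simp add: lattice_def)
  ultimately show "\<exists>y. adj (lattice d) x y \<and> ?\<pi> y = w" by blast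
qed

lemma nball_mono_edges:
  assumes "edges G \<subseteq> edges H"
  shows "nball G S r \<subseteq> nball H S r"
  using assms by (induction r) (auto simp: adj_def)

text \<open>
  A ball type of the lattice is realized in an infinite component as soon as one of its realizations
  has a component too large to fit into the box of radius \<open>r\<close>. Such a component leaves the box. The
  edges outside the box do not influence the ball, so all of them can be added to \<open>X\<close>, and then the
  component contains a ray that starts outside the box and moves away from it.
\<close>

lemma infinite_lattice_typeI:
  assumes X: "subgraph X (lattice d)" and T: "ball_type r T t"
    and ty: "has_ball_type X (lattice_origin d) r T t"
    and large: "(2 * r + 1) ^ d < card (nball X {lattice_origin d} s)"
  shows "infinite_lattice_type d r T t"
proof -
  let ?W = "lattice_box d r" and ?o = "lattice_origin d"
  define X' where "X' = \<lparr>verts = verts (lattice d),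
    edges = edges X \<union> {e\<in>edges (lattice d). \<not> e \<subseteq> ?W}\<rparr>"
  have X': "subgraph X' (lattice d)"
    using simple_lattice[of d] subgraphD(3)[OF X] by (auto simp: subgraph_def simple_graph_def X'_def)
  have oX: "?o \<in> verts X" using ty by (simp add: has_ball_type_def)
  have oX': "?o \<in> verts X'" using origin_in_lattice_box lattice_box_verts by (fastforce simp: X'_def)
  have iso: "ball_iso X {?o} X' id r"
  proof (rule ball_isoI[where W = ?W])
    show "nball X {?o} r \<subseteq> ?W" by (rule nball_origin_lattice_box[OF X oX])
    show "nball X' (id ` {?o}) r \<subseteq> id ` ?W" using nball_origin_lattice_box[OF X' oX', of r] by simp
  qed (auto simp: X'_def adj_def)
  have "has_ball_type X' (id ?o) r T t"
    using oX' by (intro has_ball_type_transfer[OF subgraphD(1)[OF X] subgraphD(1)[OF X'] T ty iso]) simp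
  then have ty': "has_ball_type X' ?o r T t" by simp
  have "\<not> nball X {?o} s \<subseteq> ?W"
    using card_mono[OF finite_lattice_box, of "nball X {?o} s" d r] large card_lattice_box[of d r] by linarith
  then obtain w where w: "w \<in> nball X {?o} s" "w \<notin> ?W" by blast
  have wv: "w \<in> {..<d} \<rightarrow>\<^sub>E UNIV"
    using w(1) nball_verts[OF subgraphD(1)[OF X], of "{?o}" s] oX subgraphD(2)[OF X]
    by (auto simp: lattice_def)
  then obtain i where i: "i < d" "\<bar>w i\<bar> > int r"
    using w(2) by (force simp: lattice_box_def PiE_def Pi_def abs_le_iff not_le)
  \<comment> \<open>The direction of the ray is the sign of a coordinate in which \<open>w\<close> is outside the box.\<close>
  define \<sigma> :: int where "\<sigma> = (if w i > 0 then 1 else -1)"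
  define ray where "ray k = w(i := w i + \<sigma> * int k)" for k :: nat
  have ray_out: "ray k \<notin> ?W" for k
  proof -
    have "\<bar>ray k i\<bar> > int r" using i(2) by (auto simp: ray_def \<sigma>_def abs_if split: if_splits)
    then show ?thesis using i(1) by (force simp: lattice_box_def PiE_def Pi_def)
  qed
  have ray_v: "ray k \<in> {..<d} \<rightarrow>\<^sub>E UNIV" for k using wv i(1) by (auto simp: ray_def PiE_def extensional_def)
  have "ray (Suc k) = (ray k)(i := ray k i + \<sigma>)" for k by (auto simp: ray_def algebra_simps)
  then have "adj (lattice d) (ray k) (ray (Suc k))" for k
    using lattice_stepI[OF ray_v i(1), of \<sigma> k] by (simp add: \<sigma>_def)
  then have adj: "adj X' (ray k) (ray (Suc k))" for k
    using ray_out by (auto simp: adj_def X'_def)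
  have reach: "ray k \<in> nball X' {?o} (s + k)" for k
  proof (induction k)
    case 0
    have "nball X {?o} s \<subseteq> nball X' {?o} s" by (rule nball_mono_edges) (simp add: X'_def)
    then show ?case using w(1) by (auto simp: ray_def)
  next
    case (Suc k)
    then show ?case using nball_nbhd[OF Suc adj] by simp
  qed
  then have "range ray \<subseteq> component X' ?o"
    unfolding component_eq_nball[OF subgraphD(1)[OF X'] oX'] by blast
  moreover have "inj ray"
  proof (rule injI)
    fix k l assume "ray k = ray l"
    then have "ray k i = ray l i" by simp
    then show "k = l" by (auto simp: ray_def \<sigma>_def split: if_splits)
  qed
  ultimately have "infinite (component X' ?o)"
    using finite_subset finite_imageD infinite_UNIV_nat by metis
  then show ?thesis using X' ty' unfolding infinite_lattice_type_def by blast
qed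

text \<open>
  In a graph whose balls are lattice balls and which has no small components, every ball of radius
  \<open>r\<close> extends to one of radius \<open>(2 * r + 1) ^ d + r\<close> with more vertices than the box has, and
  \<open>infinite_lattice_typeI\<close> applies to its copy in the lattice. So no ball types other than
  those of infinite components are left.
\<close>

lemma infinite_lattice_type_realized:
  fixes G :: "'a ugraph"
  assumes G: "simple_graph G"
    and deg: "\<And>v. v \<in> verts G \<Longrightarrow> finite (neighbours G v) \<and> card (neighbours G v) \<le> D"
    and comp: "\<And>m v. 1 \<le> m \<Longrightarrow> m \<le> (2 * r + 1) ^ d \<Longrightarrow> v \<in> verts G \<Longrightarrow> card (component G v) \<noteq> m"
    and lat: "\<And>T t v. ball_type ((2 * r + 1) ^ d + r) T t \<Longrightarrow>
      has_ball_type G v ((2 * r + 1) ^ d + r) T t \<Longrightarrow> lattice_type d ((2 * r + 1) ^ d + r) T t"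
    and T: "ball_type r T t" and ty: "has_ball_type G v r T t"
  shows "infinite_lattice_type d r T t"
proof -
  let ?M = "(2 * r + 1) ^ d" let ?s = "?M + r" and ?o = "lattice_origin d"
  have v: "v \<in> verts G" using ty by (simp add: has_ball_type_def)
  have fin: "finite (nball G {v} ?s)" using card_nball[of G D "{v}" ?s] deg G v by auto
  have M: "?M < card (nball G {v} ?s)"
  proof (cases "?s < card (nball G {v} ?s)")
    case False
    then have "\<forall>j. nball G {v} j \<subseteq> nball G {v} ?s" using nball_grows[OF fin] by blast
    then have C: "component G v = nball G {v} ?s" unfolding component_eq_nball[OF G v] by blast
    have "nball G {v} ?s \<noteq> {}" using nball_self[of "{v}" G ?s] by blast
    then have "1 \<le> card (component G v)" using fin C by (simp add: Suc_le_eq card_gt_0_iff)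
    then have "\<not> card (component G v) \<le> ?M" using comp[OF _ _ v] by blast
    then show ?thesis unfolding C not_le .
  qed simp
  obtain T' t' where T': "ball_type ?s T' t'" "has_ball_type G v ?s T' t'"
    using ball_type_exists[OF G v fin] by metis
  obtain X where X: "subgraph X (lattice d)" "has_ball_type X ?o ?s T' t'"
    using lat[OF T'] by (auto simp: lattice_type_def)
  obtain f where f: "ball_iso G {v} X f ?s" "f v = ?o"
    using has_ball_type_same_iso[OF G subgraphD(1)[OF X(1)] T' X(2)] .
  have "has_ball_type X (f v) r T t"
    using X(2) f(2) by (intro has_ball_type_transfer[OF G subgraphD(1)[OF X(1)] T ty] ball_iso_mono[OF f(1)])
      (auto simp: has_ball_type_def)
  moreover have "card (nball X {?o} ?s) = card (nball G {v} ?s)"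
    using f bij_betw_same_card[of f] by (simp add: ball_iso_def) metis
  ultimately show ?thesis using M f(2) by (intro infinite_lattice_typeI[OF X(1) T, of ?s]) auto
qed

section \<open>Clusters that survive pruning\<close>

text \<open>
  Adding the vertices one by one, instead of taking a large ball, keeps the size of the cluster
  linear in \<open>n\<close>. The probability of prescribing the state of all edges at the cluster is exponential
  in its size, so this is essential for the growth condition on \<open>f\<close>.
\<close>

lemma finite_cluster_exists:
  assumes X: "simple_graph X" and v: "v \<in> verts X" and inf: "infinite (component X v)"
    and fin: "finite (nball X {v} r)"
  shows "\<exists>K. finite K \<and> nball X {v} r \<subseteq> K \<and> K \<subseteq> nball X {v} (r + n) \<and>
    card K = card (nball X {v} r) + n \<and> (\<forall>w\<in>K. \<exists>j. w \<in> nball (induced_subgraph X K) {v} j)"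
proof (induction n)
  case 0
  let ?K = "nball X {v} r"
  have "nball X {v} j \<subseteq> nball (induced_subgraph X ?K) {v} j" if "j \<le> r" for j
    using that
  proof (induction j)
    case (Suc j)
    have sub: "nball X {v} (Suc j) \<subseteq> ?K" using Suc.prems by (rule nball_mono)
    show ?case
    proof
      fix w assume w: "w \<in> nball X {v} (Suc j)"
      then consider "w \<in> nball X {v} j" | u where "u \<in> nball X {v} j" "adj X u w" by auto
      then show "w \<in> nball (induced_subgraph X ?K) {v} (Suc j)"
      proof cases
        case 1 then show ?thesis using Suc by auto
      next
        case 2
        then have "adj (induced_subgraph X ?K) u w" using w sub by (auto simp: adj_induced)
        then show ?thesis using Suc 2(1) nball_nbhd[of u "induced_subgraph X ?K"] by auto
      qed
    qed
  qed simp
  from this[of r] show ?case using fin by (intro exI[of _ ?K]) auto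
next
  case (Suc n)
  then obtain K where K: "finite K" "nball X {v} r \<subseteq> K" "K \<subseteq> nball X {v} (r + n)"
    "card K = card (nball X {v} r) + n" "\<forall>w\<in>K. \<exists>j. w \<in> nball (induced_subgraph X K) {v} j" by blast
  have vK: "v \<in> K" using K(2) nball_self[of "{v}" X r] by blast
  have "\<exists>u\<in>K. \<exists>w. w \<notin> K \<and> adj X u w"
  proof (rule ccontr)
    assume "\<not> ?thesis"
    then have closed: "w \<in> K" if "u \<in> K" "adj X u w" for u w using that by blast
    have "nball X {v} j \<subseteq> K" for j
    proof (induction j)
      case (Suc j) then show ?case using closed by (simp add: subset_iff) blast
    qed (use vK in simp)
    then have "component X v \<subseteq> K" unfolding component_eq_nball[OF X v] by blast
    then show False using inf K(1) finite_subset by blast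
  qed
  then obtain u w where uw: "u \<in> K" "w \<notin> K" "adj X u w" by blast
  let ?K = "insert w K"
  have mono: "nball (induced_subgraph X K) {v} j \<subseteq> nball (induced_subgraph X ?K) {v} j" for j
    by (rule nball_mono_edges) (auto simp: induced_subgraph_def)
  obtain j where "u \<in> nball (induced_subgraph X K) {v} j" using K(5) uw(1) by blast
  then have "u \<in> nball (induced_subgraph X ?K) {v} j" using mono by blast
  moreover have "adj (induced_subgraph X ?K) u w" using uw by (simp add: adj_induced)
  ultimately have "w \<in> nball (induced_subgraph X ?K) {v} (Suc j)" by (rule nball_nbhd)
  then have "\<forall>z\<in>?K. \<exists>j. z \<in> nball (induced_subgraph X ?K) {v} j" using K(5) mono by blast
  moreover have "w \<in> nball X {v} (r + Suc n)" using nball_nbhd[of u X "{v}" "r + n" w] K(3) uw by auto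
  then have "?K \<subseteq> nball X {v} (r + Suc n)"
    using K(3) nball_mono[of "r + n" "r + Suc n" X "{v}"] by auto
  ultimately show ?case using K uw(2) by (intro exI[of _ ?K]) auto
qed

text \<open>
  If a copy of the cluster \<open>K\<close> is a component of \<open>H\<close>, it survives pruning at \<open>m\<close>, and the ball of
  \<open>X\<close> around \<open>v\<close> survives with it.
\<close>

lemma pruned_cluster_type:
  assumes X: "simple_graph X" and T: "ball_type r T t" and ty: "has_ball_type X v r T t"
    and H: "simple_graph H"
    and K: "finite K" "nball X {v} r \<subseteq> K" "\<forall>w\<in>K. \<exists>j. w \<in> nball (induced_subgraph X K) {v} j"
    and inj: "inj_on \<pi> K" and im: "\<pi> ` K \<subseteq> verts H"
    and adj: "\<And>x y. x \<in> K \<Longrightarrow> y \<in> K \<Longrightarrow> adj X x y \<longleftrightarrow> adj H (\<pi> x) (\<pi> y)"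
    and closed: "\<And>x w. x \<in> K \<Longrightarrow> adj H (\<pi> x) w \<Longrightarrow> w \<in> \<pi> ` K"
    and m: "m \<le> card K"
  shows "has_ball_type (prune m H) (\<pi> v) r T t"
proof -
  let ?P = "prune m H"
  have vK: "v \<in> K" using K(2) nball_self[of "{v}" X r] by blast
  have reach: "(\<pi> v, \<pi> w) \<in> (adj_rel H)\<^sup>*" if "w \<in> K" for w
  proof -
    have "w \<in> K \<and> (\<pi> v, \<pi> w) \<in> (adj_rel H)\<^sup>*" if "w \<in> nball (induced_subgraph X K) {v} j" for j w
      using that
    proof (induction j arbitrary: w)
      case (Suc j)
      consider "w \<in> nball (induced_subgraph X K) {v} j" |
        u where "u \<in> nball (induced_subgraph X K) {v} j" "adj (induced_subgraph X K) u w"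
        using Suc.prems by auto
      then show ?case
      proof cases
        case 2
        then have "u \<in> K" "w \<in> K" "adj X u w" "(\<pi> v, \<pi> u) \<in> (adj_rel H)\<^sup>*"
          using Suc.IH by (auto simp: adj_induced)
        then show ?thesis using adj[of u w] by (auto simp: adj_rel_def intro: rtrancl_into_rtrancl)
      qed (use Suc in auto)
    qed (use vK in auto)
    then show ?thesis using K(3) that by blast
  qed
  have sym: "sym ((adj_rel H)\<^sup>*)"
    by (rule sym_rtrancl) (auto simp: sym_def adj_rel_def adj_sym)
  have comp: "component H (\<pi> x) = \<pi> ` K" if x: "x \<in> K" for x
  proof
    show "component H (\<pi> x) \<subseteq> \<pi> ` K"
    proof
      fix w assume "w \<in> component H (\<pi> x)"
      then have "(\<pi> x, w) \<in> (adj_rel H)\<^sup>*" by (simp add: component_def)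
      then show "w \<in> \<pi> ` K"
        by (induction rule: rtrancl_induct) (use x closed in \<open>auto simp: adj_rel_def\<close>)
    qed
    show "\<pi> ` K \<subseteq> component H (\<pi> x)"
      using reach x sym im by (auto simp: component_def intro: rtrancl_trans dest: symD)
  qed
  have big: "\<pi> x \<in> {u\<in>verts H. card (component H u) \<ge> m}" if "x \<in> K" for x
    using comp[OF that] card_image[OF inj] m im that by auto
  have adjP: "adj X x y \<longleftrightarrow> adj ?P (\<pi> x) (\<pi> y)" if "x \<in> K" "y \<in> K" for x y
    using adj[OF that] big that by (auto simp: prune_def adj_induced)
  have P: "simple_graph ?P"
    using H unfolding simple_graph_def prune_def induced_subgraph_def by fastforce
  have vP: "\<pi> v \<in> verts ?P" using big[OF vK] im vK by (auto simp: prune_def induced_subgraph_def)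
  have cl: "nball ?P {\<pi> v} j \<subseteq> \<pi> ` K" for j
  proof (induction j)
    case (Suc j)
    have "w \<in> \<pi> ` K" if "u \<in> \<pi> ` K" "adj ?P u w" for u w
      using that closed by (auto simp: prune_def adj_induced)
    then show ?case using Suc by (simp add: subset_iff) blast
  qed (use vK in simp)
  have "ball_iso X {v} ?P \<pi> r"
    using cl[of r] inj K(2) adjP by (intro ball_isoI[where W = K]) auto
  then show ?thesis using vP by (intro has_ball_type_transfer[OF X P T ty])
qed

section \<open>Independent edge patterns\<close>

text \<open>
  The supports are countable, so intersecting \<open>A\<close> and \<open>B\<close> with them reduces the claim to countable
  sets.
\<close>

lemma prob_pair_Times:
  "measure_pmf.prob (pair_pmf M N) (A \<times> B) = measure_pmf.prob M A * measure_pmf.prob N B"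
proof -
  have "measure_pmf.prob (pair_pmf M N) (A \<times> B) =
      measure_pmf.prob (pair_pmf M N) (A \<times> B \<inter> set_pmf (pair_pmf M N))"
    by (rule measure_Int_set_pmf[symmetric])
  also have "A \<times> B \<inter> set_pmf (pair_pmf M N) = (A \<inter> set_pmf M) \<times> (B \<inter> set_pmf N)" by auto
  also have "measure_pmf.prob (pair_pmf M N) \<dots> =
      measure_pmf.prob M (A \<inter> set_pmf M) * measure_pmf.prob N (B \<inter> set_pmf N)"
    by (intro measure_pmf_prob_product) (auto intro: countable_subset[OF _ countable_set_pmf])
  finally show ?thesis by (simp add: measure_Int_set_pmf)
qed

text \<open>
  That an event depends only on the coordinates in \<open>B\<close> is expressed by invariance under changes of
  the other coordinates.
\<close>

lemma prob_Pi_pmf_disjoint_blocks: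
  assumes fin: "finite A" and B: "B \<subseteq> A"
    and P: "\<And>\<omega> \<omega>'. (\<And>e. e \<in> B \<Longrightarrow> \<omega> e = \<omega>' e) \<Longrightarrow> P \<omega> \<longleftrightarrow> P \<omega>'"
    and Q: "\<And>\<omega> \<omega>'. (\<And>e. e \<notin> B \<Longrightarrow> \<omega> e = \<omega>' e) \<Longrightarrow> Q \<omega> \<longleftrightarrow> Q \<omega>'"
  shows "measure_pmf.prob (Pi_pmf A dflt p) {\<omega>. P \<omega> \<and> Q \<omega>} =
    measure_pmf.prob (Pi_pmf A dflt p) {\<omega>. P \<omega>} * measure_pmf.prob (Pi_pmf A dflt p) {\<omega>. Q \<omega>}"
proof -
  let ?M = "Pi_pmf B dflt p" and ?N = "Pi_pmf (A - B) dflt p"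
  let ?h = "\<lambda>(f, g) x. if x \<in> B then f x else g x"
  have "A = B \<union> (A - B)" using B by blast
  then have eq: "Pi_pmf A dflt p = map_pmf ?h (pair_pmf ?M ?N)"
    using Pi_pmf_union[of B "A - B" dflt p] fin finite_subset[OF B fin] by simp
  have hP: "P (?h (f, g)) \<longleftrightarrow> P f" for f g by (rule P) simp
  have hQ: "Q (?h (f, g)) \<longleftrightarrow> Q g" for f g by (rule Q) simp
  have *: "measure_pmf.prob (Pi_pmf A dflt p) {\<omega>. R \<omega> \<and> S \<omega>} =
      measure_pmf.prob ?M {f. R f} * measure_pmf.prob ?N {g. S g}"
    if "\<And>f g. R (?h (f, g)) \<longleftrightarrow> R f" "\<And>f g. S (?h (f, g)) \<longleftrightarrow> S g" for R S
  proof -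
    have "?h -` {\<omega>. R \<omega> \<and> S \<omega>} = {f. R f} \<times> {g. S g}"
      unfolding vimage_def Times_eq_image_sum using that by auto
    then show ?thesis unfolding eq measure_map_pmf by (simp only: prob_pair_Times)
  qed
  show ?thesis using *[of P Q] *[of P "\<lambda>_. True"] *[of "\<lambda>_. True" Q] hP hQ by simp
qed

lemma prob_no_pattern:
  assumes fin: "finite A" and I: "finite I" and F: "\<And>k. k \<in> I \<Longrightarrow> F k \<subseteq> A"
    and disj: "\<And>k l. k \<in> I \<Longrightarrow> l \<in> I \<Longrightarrow> k \<noteq> l \<Longrightarrow> F k \<inter> F l = {}"
  shows "measure_pmf.prob (Pi_pmf A dflt p) {\<omega>. \<forall>k\<in>I. \<not> (\<forall>e\<in>F k. \<omega> e = c k e)} =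
    (\<Prod>k\<in>I. 1 - measure_pmf.prob (Pi_pmf A dflt p) {\<omega>. \<forall>e\<in>F k. \<omega> e = c k e})"
  using I F disj
proof (induction I rule: finite_induct)
  case (insert k I)
  let ?M = "Pi_pmf A dflt p"
  let ?E = "\<lambda>k \<omega>. \<forall>e\<in>F k. \<omega> e = c k e"
  have "{\<omega>. \<forall>l\<in>insert k I. \<not> ?E l \<omega>} = {\<omega>. \<not> ?E k \<omega> \<and> (\<forall>l\<in>I. \<not> ?E l \<omega>)}" by auto
  also have "measure_pmf.prob ?M \<dots> =
      measure_pmf.prob ?M {\<omega>. \<not> ?E k \<omega>} * measure_pmf.prob ?M {\<omega>. \<forall>l\<in>I. \<not> ?E l \<omega>}"
  proof (rule prob_Pi_pmf_disjoint_blocks[OF fin, of "F k"])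
    show "F k \<subseteq> A" using insert.prems by simp
    show "(\<forall>l\<in>I. \<not> ?E l \<omega>) \<longleftrightarrow> (\<forall>l\<in>I. \<not> ?E l \<omega>')" if "\<And>e. e \<notin> F k \<Longrightarrow> \<omega> e = \<omega>' e" for \<omega> \<omega>'
    proof (intro ball_cong refl arg_cong[of _ _ Not])
      fix l e assume "l \<in> I" "e \<in> F l"
      then have "e \<notin> F k" using insert.prems(2)[of l k] insert.hyps by auto
      then show "\<omega> e = c l e \<longleftrightarrow> \<omega>' e = c l e" using that by simp
    qed
  qed auto
  also have "measure_pmf.prob ?M {\<omega>. \<not> ?E k \<omega>} = 1 - measure_pmf.prob ?M {\<omega>. ?E k \<omega>}"
  proof -
    have "{\<omega>. \<not> ?E k \<omega>} = UNIV - {\<omega>. ?E k \<omega>}" by blast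
    then show ?thesis using measure_pmf.prob_compl[of "{\<omega>. ?E k \<omega>}" ?M] by (simp only:) simp
  qed
  also have "measure_pmf.prob ?M {\<omega>. \<forall>l\<in>I. \<not> ?E l \<omega>} = (\<Prod>k\<in>I. 1 - measure_pmf.prob ?M {\<omega>. ?E k \<omega>})"
    using insert.prems by (intro insert.IH) auto
  finally show ?case using insert.hyps by simp
qed simp

lemma prob_pattern_ge:
  assumes fin: "finite A" and F: "F \<subseteq> A" "card F \<le> m" and q: "0 \<le> q" "q \<le> 1"
  shows "min (1 - q) q ^ m \<le>
    measure_pmf.prob (Pi_pmf A dflt (\<lambda>_. bernoulli_pmf q)) {\<omega>. \<forall>e\<in>F. \<omega> e = c e}"
proof -
  let ?\<eta> = "min (1 - q) q" and ?B = "\<lambda>e. if e \<in> F then {c e} else UNIV"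
  have \<eta>: "0 \<le> ?\<eta>" "?\<eta> \<le> 1" using q by auto
  have "{\<omega>. \<forall>e\<in>F. \<omega> e = c e} = Pi A ?B" using F by (auto simp: Pi_def)
  then have "measure_pmf.prob (Pi_pmf A dflt (\<lambda>_. bernoulli_pmf q)) {\<omega>. \<forall>e\<in>F. \<omega> e = c e} =
      (\<Prod>e\<in>A. measure_pmf.prob (bernoulli_pmf q) (?B e))"
    by (simp only: measure_Pi_pmf_Pi[OF fin])
  also have "\<dots> = (\<Prod>e\<in>F. pmf (bernoulli_pmf q) (c e))"
    using F fin by (intro prod.mono_neutral_cong_right) (auto simp: measure_pmf_single)
  also have "\<dots> \<ge> (\<Prod>e\<in>F. ?\<eta>)"
  proof (intro prod_mono conjI)
    fix e
    show "?\<eta> \<le> pmf (bernoulli_pmf q) (c e)" using q by (cases "c e") auto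
  qed (use \<eta> in simp)
  also have "(\<Prod>e\<in>F. ?\<eta>) = ?\<eta> ^ card F" by simp
  ultimately show ?thesis using power_decreasing[OF F(2) \<eta>] by simp
qed

text \<open>
  The \<open>h * M\<close> patterns are divided into \<open>h\<close> groups of \<open>M\<close>. By independence a group contains no
  realized pattern with probability at most \<open>(1 - min (1 - q) q ^ m) ^ M\<close>, and a union bound over the groups
  yields \<open>h\<close> realized patterns, one in each group.
\<close>

lemma prob_pattern_in_each_group:
  assumes fin: "finite A" and q: "0 \<le> q" "q \<le> 1"
    and F: "\<And>k. k < h * M \<Longrightarrow> F k \<subseteq> A" "\<And>k. k < h * M \<Longrightarrow> card (F k) \<le> m"
    and disj: "\<And>k l. k < h * M \<Longrightarrow> l < h * M \<Longrightarrow> k \<noteq> l \<Longrightarrow> F k \<inter> F l = {}"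
  shows "1 - real h * (1 - min (1 - q) q ^ m) ^ M \<le>
    measure_pmf.prob (Pi_pmf A dflt (\<lambda>_. bernoulli_pmf q))
      {\<omega>. \<forall>j<h. \<exists>k\<in>{j * M..<Suc j * M}. \<forall>e\<in>F k. \<omega> e = c k e}"
proof -
  let ?P = "Pi_pmf A dflt (\<lambda>_. bernoulli_pmf q)" and ?\<eta> = "min (1 - q) q"
  let ?E = "\<lambda>k \<omega>. \<forall>e\<in>F k. \<omega> e = c k e"
  let ?I = "\<lambda>j. {j * M..<Suc j * M}"
  let ?bad = "\<lambda>j. {\<omega>. \<forall>k\<in>?I j. \<not> ?E k \<omega>}"
  have lt: "k < h * M" if "k \<in> ?I j" "j < h" for k j
  proof -
    have "Suc j * M \<le> h * M" using that by (intro mult_le_mono1) simp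
    then show ?thesis using that by simp
  qed
  have bad: "measure_pmf.prob ?P (?bad j) \<le> (1 - ?\<eta> ^ m) ^ M" if j: "j < h" for j
  proof -
    have "measure_pmf.prob ?P (?bad j) = (\<Prod>k\<in>?I j. 1 - measure_pmf.prob ?P {\<omega>. ?E k \<omega>})"
      using F disj lt[OF _ j] by (intro prob_no_pattern[OF fin]) auto
    also have "\<dots> \<le> (\<Prod>k\<in>?I j. 1 - ?\<eta> ^ m)"
      using prob_pattern_ge[OF fin F(1,2) q] lt[OF _ j] by (intro prod_mono) auto
    also have "\<dots> = (1 - ?\<eta> ^ m) ^ M" by simp
    finally show ?thesis .
  qed
  let ?good = "{\<omega>. \<forall>j<h. \<exists>k\<in>?I j. ?E k \<omega>}"
  have "- ?good = (\<Union>j\<in>{..<h}. ?bad j)" by blast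
  then have "measure_pmf.prob ?P (- ?good) \<le> (\<Sum>j<h. measure_pmf.prob ?P (?bad j))"
    by (simp only:) (intro measure_pmf.finite_measure_subadditive_finite, auto)
  also have "\<dots> \<le> (\<Sum>j<h. (1 - ?\<eta> ^ m) ^ M)" using bad by (intro sum_mono) auto
  also have "\<dots> = real h * (1 - ?\<eta> ^ m) ^ M" by simp
  finally have "measure_pmf.prob ?P (- ?good) \<le> real h * (1 - ?\<eta> ^ m) ^ M" .
  moreover have "measure_pmf.prob ?P (- ?good) = 1 - measure_pmf.prob ?P ?good"
    using measure_pmf.prob_compl[of ?good ?P] by (simp add: Compl_eq_Diff_UNIV)
  ultimately show ?thesis by linarith
qed

section \<open>Many disjoint copies of a cluster\<close>

text \<open>
  The \<open>k\<close>-th copy of a cluster which lies in the box of radius \<open>b\<close> around \<open>v\<close>. The copies are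
  placed along the first coordinate only, with period \<open>2 * b + 3\<close>, and all coordinates stay
  between \<open>1\<close> and \<open>L - 2\<close>, so that no edge at a copy wraps around the torus. About \<open>L / (2 * b + 3)\<close> copies
  fit, which is less than a \<open>d\<close>-dimensional arrangement would give but is still a positive power of
  \<open>L\<close>.
\<close>

definition place :: "nat \<Rightarrow> nat \<Rightarrow> (nat \<Rightarrow> int) \<Rightarrow> nat \<Rightarrow> (nat \<Rightarrow> int) \<Rightarrow> nat \<Rightarrow> int" where
  "place d b v k = translate d (\<lambda>i. int b + 1 - v i + (if i = 0 then int k * (2 * int b + 3) else 0))"

lemma place_bounds:
  assumes x: "\<And>i. i < d \<Longrightarrow> \<bar>x i - v i\<bar> \<le> int b" and i: "i < d" and k: "k < L div (2 * b + 3)"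
  shows "1 \<le> place d b v k x i" "place d b v k x i \<le> int L - 2"
    "i = 0 \<Longrightarrow> int k * (2 * int b + 3) + 1 \<le> place d b v k x i"
    "i = 0 \<Longrightarrow> place d b v k x i \<le> int k * (2 * int b + 3) + 2 * int b + 1"
proof -
  have "Suc k * (2 * b + 3) \<le> L"
    using k by (metis Suc_leI div_times_less_eq_dividend le_trans mult_le_mono1)
  then have "int (Suc k * (2 * b + 3)) \<le> int L" by linarith
  then have L: "int k * (2 * int b + 3) + 2 * int b + 3 \<le> int L" by (simp add: algebra_simps)
  define s where "s = int k * (2 * int b + 3)"
  have s: "0 \<le> s" by (simp add: s_def)
  show "1 \<le> place d b v k x i" "place d b v k x i \<le> int L - 2"
    "i = 0 \<Longrightarrow> int k * (2 * int b + 3) + 1 \<le> place d b v k x i"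
    "i = 0 \<Longrightarrow> place d b v k x i \<le> int k * (2 * int b + 3) + 2 * int b + 1"
    unfolding place_def translate_apply[OF i] s_def[symmetric]
    using L[folded s_def] s x[OF i] by (auto simp: abs_le_iff)
qed

lemma adj_torus_of_lattice:
  assumes "adj (lattice d) x y" "x \<in> verts (torus d L)" "y \<in> verts (torus d L)"
  shows "adj (torus d L) x y"
proof -
  obtain i where i: "i < d" "\<bar>x i - y i\<bar> = 1" "\<forall>j<d. j \<noteq> i \<longrightarrow> x j = y j"
    using assms(1) by (rule adj_latticeE)
  then have "x i - y i = 1 \<or> x i - y i = -1" by linarith
  then have "[x i - y i = 1] (mod int L) \<or> [x i - y i = -1] (mod int L)" by auto
  moreover have "x \<noteq> y" using i(2) by auto
  moreover have "x \<in> {..<d} \<rightarrow>\<^sub>E {0..<int L}" "y \<in> {..<d} \<rightarrow>\<^sub>E {0..<int L}"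
    using assms by (simp_all add: torus_def)
  ultimately show ?thesis unfolding adj_torus using i(1,3) by blast
qed

definition touching :: "nat \<Rightarrow> nat \<Rightarrow> (nat \<Rightarrow> int) set \<Rightarrow> (nat \<Rightarrow> int) set set" where
  "touching d L U = {e\<in>edges (torus d L). e \<inter> U \<noteq> {}}"

lemma card_touching:
  assumes "finite U"
  shows "card (touching d L U) \<le> 2 * d * card U"
proof -
  let ?T = "torus d L"
  have deg: "finite (neighbours ?T u) \<and> card (neighbours ?T u) \<le> 2 * d" for u
    by (rule torus_degree[of _ _ L]) (simp add: subgraph_def simple_torus)
  have sub: "touching d L U \<subseteq> (\<Union>u\<in>U. (\<lambda>w. {u, w}) ` neighbours ?T u)"
  proof
    fix e assume "e \<in> touching d L U"
    then obtain u where u: "e \<in> edges ?T" "u \<in> e" "u \<in> U" by (auto simp: touching_def)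
    then obtain w where w: "e = {u, w}" "w \<in> verts ?T"
      using simple_torus[of d L] unfolding simple_graph_def by (metis doubleton_eq_iff insertE singletonD)
    then have "w \<in> neighbours ?T u" using u(1) by (simp add: neighbours_def adj_def)
    then show "e \<in> (\<Union>u\<in>U. (\<lambda>w. {u, w}) ` neighbours ?T u)" using w(1) u(3) by blast
  qed
  have "card (touching d L U) \<le> card (\<Union>u\<in>U. (\<lambda>w. {u, w}) ` neighbours ?T u)"
    using assms deg by (intro card_mono[OF _ sub]) auto
  also have "\<dots> \<le> (\<Sum>u\<in>U. card ((\<lambda>w. {u, w}) ` neighbours ?T u))"
    using assms by (rule card_UN_le)
  also have "\<dots> \<le> (\<Sum>u\<in>U. 2 * d)"
    by (intro sum_mono) (use order_trans[OF card_image_le] deg in blast)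
  finally show ?thesis by (simp add: mult.commute)
qed

text \<open>
  Consecutive copies are at distance at least \<open>3\<close> in the first coordinate, and the
  coordinates between \<open>1\<close> and \<open>L - 2\<close> leave no shorter way around the torus, hence no edge meets two
  copies.
\<close>

lemma disjoint_touching:
  assumes K: "\<And>x i. x \<in> K \<Longrightarrow> i < d \<Longrightarrow> \<bar>x i - v i\<bar> \<le> int b"
    and k: "k < L div (2 * b + 3)" and l: "l < L div (2 * b + 3)" and kl: "k < l" and d: "d \<ge> 1"
  shows "touching d L (place d b v k ` K) \<inter> touching d L (place d b v l ` K) = {}"
proof (rule ccontr)
  let ?T = "torus d L"
  assume "\<not> ?thesis"
  then obtain e x y where e: "e \<in> edges ?T" "x \<in> K" "y \<in> K" "place d b v k x \<in> e" "place d b v l y \<in> e"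
    by (auto simp: touching_def)
  let ?u = "place d b v k x" and ?w = "place d b v l y"
  have "Suc k * (2 * b + 3) \<le> l * (2 * b + 3)" using kl by (intro mult_le_mono1) simp
  then have "int (Suc k * (2 * b + 3)) \<le> int (l * (2 * b + 3))" by linarith
  then have kl': "int k * (2 * int b + 3) + 2 * int b + 3 \<le> int l * (2 * int b + 3)" by (simp add: algebra_simps)
  note bu = place_bounds[of d x v b 0, OF K[OF e(2)] _ k] and bw = place_bounds[of d y v b 0, OF K[OF e(3)] _ l]
  have gap: "?u 0 + 3 \<le> ?w 0" using bu(4) bw(3) kl' d by auto
  obtain a c where ac: "e = {a, c}" using simple_torus[of d L] e(1) by (auto simp: simple_graph_def)
  have "?u \<noteq> ?w" using gap by auto
  then have "e = {?u, ?w}" using e(4,5) ac by auto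
  then have "adj ?T ?u ?w" using e(1) by (simp add: adj_def)
  then obtain i s where i: "i < d" "s \<in> {1, -1}" "?w = ?u(i := (?u i + s) mod int L)" by (rule torus_step)
  show False
  proof (cases "i = 0")
    case True
    have "0 \<le> ?u 0 + s" "?u 0 + s < int L" using bu(1,2) d i(2) by auto
    then have "?w 0 = ?u 0 + s" using i(3) True by (metis fun_upd_same mod_pos_pos_trivial)
    then show False using gap i(2) by auto
  next
    case False
    then have "?w 0 = ?u 0" using i(3) by (metis fun_upd_other)
    then show False using gap by simp
  qed
qed

text \<open>
  The pattern at the \<open>k\<close>-th place prescribes the state of all edges touching the copy of a cluster
  \<open>K\<close> of size at least \<open>m\<close>: the edges of \<open>X\<close> inside \<open>K\<close> are present, all others absent. A realized
  pattern gives a vertex of the desired type in the pruned graph, by \<open>pruned_cluster_type\<close>.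
\<close>

lemma prob_many_type_ge:
  assumes X: "subgraph X (lattice d)" and inf: "infinite (component X v)"
    and T: "ball_type r T t" and ty: "has_ball_type X v r T t"
    and d: "d \<ge> 1" and q: "0 \<le> q" "q \<le> 1"
  shows "1 - real h * (1 - min (1 - q) q ^ (2 * d * (card (nball X {v} r) + m))) ^ (L div (2 * (r + m) + 3) div h) \<le>
    measure_pmf.prob (map_pmf (prune m) (percolation d L q))
      {G. \<exists>S\<subseteq>{w. has_ball_type G w r T t}. finite S \<and> card S = h}"
proof -
  let ?T = "torus d L" and ?b = "r + m"
  define M where "M = L div (2 * ?b + 3) div h"
  have sX: "simple_graph X" by (rule subgraphD(1)[OF X])
  have v: "v \<in> verts X" using ty by (simp add: has_ball_type_def)
  have fin: "finite (nball X {v} r)"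
    using card_nball[of X "2 * d" "{v}" r] lattice_degree[OF X] sX v by auto
  obtain K where K: "finite K" "nball X {v} r \<subseteq> K" "K \<subseteq> nball X {v} ?b"
    "card K = card (nball X {v} r) + m" "\<forall>w\<in>K. \<exists>j. w \<in> nball (induced_subgraph X K) {v} j"
    using finite_cluster_exists[OF sX v inf fin, of m] by blast
  have close: "\<bar>x i - v i\<bar> \<le> int ?b" if "x \<in> K" "i < d" for x i
    using lattice_nball_close[OF X subsetD[OF K(3) that(1)] that(2)] .
  have vK: "v \<in> K" using K(2) nball_self[of "{v}" X r] by blast
  have KX: "K \<subseteq> verts X" using K(3) nball_verts[OF sX, of "{v}" ?b] v by blast
  have KL: "K \<subseteq> verts (lattice d)" using KX subgraphD(2)[OF X] by blast
  let ?\<pi> = "place d ?b v"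
  have inj: "inj_on (?\<pi> k) K" for k unfolding place_def by (rule inj_on_subset[OF inj_translate KL])
  have lt: "k < L div (2 * ?b + 3)" if "k < h * M" for k
    using that unfolding M_def by (metis div_times_less_eq_dividend mult.commute order_less_le_trans)
  have im: "?\<pi> k ` K \<subseteq> verts ?T" if k: "k < h * M" for k
  proof
    fix u assume "u \<in> ?\<pi> k ` K"
    then obtain x where x: "x \<in> K" "u = ?\<pi> k x" by blast
    have "?\<pi> k x i \<in> {0..<int L}" if "i < d" for i
      using place_bounds(1,2)[of d x v ?b i k L, OF close[OF x(1)] that lt[OF k]] by auto
    then show "u \<in> verts ?T" using x(2) by (auto simp: torus_def place_def translate_def)
  qed
  define F where "F k = touching d L (?\<pi> k ` K)" for k
  define c where "c k e \<longleftrightarrow> (\<exists>x\<in>K. \<exists>y\<in>K. e = {?\<pi> k x, ?\<pi> k y} \<and> adj X x y)" for k e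
  define H where "H \<omega> = \<lparr>verts = verts ?T, edges = {e\<in>edges ?T. \<omega> e}\<rparr>" for \<omega>
  \<comment> \<open>\<open>F k\<close> is the set of edges at the \<open>k\<close>-th copy of \<open>K\<close>, \<open>c k\<close> their prescribed states.\<close>
  let ?E = "\<lambda>k \<omega>. \<forall>e\<in>F k. \<omega> e = c k e"
  have cF: "card (F k) \<le> 2 * d * (card (nball X {v} r) + m)" for k
    using card_touching[of "?\<pi> k ` K" d L] K(1) card_image[OF inj, of k] K(4) by (simp add: F_def)
  have disj: "F k \<inter> F l = {}" if "k < h * M" "l < h * M" "k \<noteq> l" for k l
    using disjoint_touching[of K d v ?b k L l] disjoint_touching[of K d v ?b l L k] close lt that d
    unfolding F_def by (metis Int_commute nat_neq_iff)
  have FA: "F k \<subseteq> edges ?T" for k by (auto simp: F_def touching_def)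
  have event: "has_ball_type (prune m (H \<omega>)) (?\<pi> k v) r T t" if k: "k < h * M" and E: "?E k \<omega>" for k \<omega>
  proof (rule pruned_cluster_type[OF sX T ty _ K(1,2,5) inj])
    show "simple_graph (H \<omega>)" using simple_torus[of d L] by (auto simp: simple_graph_def H_def)
    show "?\<pi> k ` K \<subseteq> verts (H \<omega>)" using im[OF k] by (simp add: H_def)
    show "m \<le> card K" using K(4) by simp
    have inF: "{?\<pi> k x, w} \<in> F k" if "x \<in> K" "adj ?T (?\<pi> k x) w" for x w
      using that by (auto simp: F_def touching_def adj_def)
    have open_c: "c k {?\<pi> k x, w}" if "x \<in> K" "adj (H \<omega>) (?\<pi> k x) w" for x w
    proof -
      have "adj ?T (?\<pi> k x) w" "\<omega> {?\<pi> k x, w}" using that(2) by (auto simp: adj_def H_def)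
      then show ?thesis using inF[OF that(1)] E by blast
    qed
    show "w \<in> ?\<pi> k ` K" if "x \<in> K" "adj (H \<omega>) (?\<pi> k x) w" for x w
      using open_c[OF that] by (auto simp: c_def doubleton_eq_iff)
    show "adj X x y \<longleftrightarrow> adj (H \<omega>) (?\<pi> k x) (?\<pi> k y)" if xy: "x \<in> K" "y \<in> K" for x y
    proof
      assume a: "adj X x y"
      have "adj (lattice d) (?\<pi> k x) (?\<pi> k y)"
        unfolding place_def using adj_lattice_translate subgraphD(4)[OF X a] KL xy by blast
      then have T: "adj ?T (?\<pi> k x) (?\<pi> k y)" using im[OF k] xy by (intro adj_torus_of_lattice) auto
      have "c k {?\<pi> k x, ?\<pi> k y}" using xy a by (auto simp: c_def)
      then have "\<omega> {?\<pi> k x, ?\<pi> k y}" using inF[OF xy(1) T] E by blast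
      then show "adj (H \<omega>) (?\<pi> k x) (?\<pi> k y)" using T by (simp add: adj_def H_def)
    next
      assume "adj (H \<omega>) (?\<pi> k x) (?\<pi> k y)"
      then have "c k {?\<pi> k x, ?\<pi> k y}" by (rule open_c[OF xy(1)])
      then obtain x' y' where *: "x' \<in> K" "y' \<in> K" "{?\<pi> k x, ?\<pi> k y} = {?\<pi> k x', ?\<pi> k y'}" "adj X x' y'"
        unfolding c_def by blast
      then have "{x, y} = {x', y'}" using inj_on_image_eq_iff[OF inj, of "{x, y}" "{x', y'}" k] xy by simp
      then show "adj X x y" using *(4) by (simp add: adj_def)
    qed
  qed
  have distinct: "?\<pi> k v \<noteq> ?\<pi> l v" if "k \<noteq> l" for k l
  proof
    assume "?\<pi> k v = ?\<pi> l v"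
    then have "?\<pi> k v 0 = ?\<pi> l v 0" by simp
    then have "int k * (2 * int ?b + 3) = int l * (2 * int ?b + 3)"
      using d by (simp add: place_def translate_def)
    then show False using that by simp
  qed
  have good: "\<exists>S\<subseteq>{w. has_ball_type (prune m (H \<omega>)) w r T t}. finite S \<and> card S = h"
    if E: "\<forall>j<h. \<exists>k\<in>{j * M..<Suc j * M}. ?E k \<omega>" for \<omega>
  proof -
    obtain \<kappa> where \<kappa>: "\<And>j. j < h \<Longrightarrow> \<kappa> j \<in> {j * M..<Suc j * M} \<and> ?E (\<kappa> j) \<omega>" using E by metis
    have \<kappa>lt: "\<kappa> j < h * M" if "j < h" for j
      using \<kappa>[OF that] mult_le_mono1[of "Suc j" h M] that by auto
    have \<kappa>less: "\<kappa> i < \<kappa> j" if "i < j" "j < h" for i j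
      using \<kappa>[of i] \<kappa>[of j] mult_le_mono1[of "Suc i" j M] that by auto
    have "inj_on (\<lambda>j. ?\<pi> (\<kappa> j) v) {..<h}"
    proof (rule inj_onI)
      fix i j assume *: "i \<in> {..<h}" "j \<in> {..<h}" "?\<pi> (\<kappa> i) v = ?\<pi> (\<kappa> j) v"
      then have "\<kappa> i = \<kappa> j" using distinct by blast
      then show "i = j" using \<kappa>less[of i j] \<kappa>less[of j i] * by (cases i j rule: linorder_cases) auto
    qed
    then have "card ((\<lambda>j. ?\<pi> (\<kappa> j) v) ` {..<h}) = h" by (simp add: card_image)
    moreover have "(\<lambda>j. ?\<pi> (\<kappa> j) v) ` {..<h} \<subseteq> {w. has_ball_type (prune m (H \<omega>)) w r T t}"
      using event \<kappa> \<kappa>lt by blast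
    ultimately show ?thesis by (meson finite_imageI finite_lessThan)
  qed
  have "1 - real h * (1 - min (1 - q) q ^ (2 * d * (card (nball X {v} r) + m))) ^ M \<le>
    measure_pmf.prob (Pi_pmf (edges ?T) False (\<lambda>_. bernoulli_pmf q))
      {\<omega>. \<forall>j<h. \<exists>k\<in>{j * M..<Suc j * M}. ?E k \<omega>}"
    using FA cF disj by (intro prob_pattern_in_each_group finite_torus q) auto
  also have "\<dots> \<le> measure_pmf.prob (Pi_pmf (edges ?T) False (\<lambda>_. bernoulli_pmf q))
      {\<omega>. \<exists>S\<subseteq>{w. has_ball_type (prune m (H \<omega>)) w r T t}. finite S \<and> card S = h}"
    using good by (intro measure_pmf.finite_measure_mono) auto
  also have "\<dots> = measure_pmf.prob (map_pmf (prune m) (percolation d L q))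
      {G. \<exists>S\<subseteq>{w. has_ball_type G w r T t}. finite S \<and> card S = h}"
    by (simp add: percolation_def map_pmf_comp H_def vimage_def)
  finally show ?thesis unfolding M_def .
qed

section \<open>Asymptotics of the failure probability\<close>

lemma quotient_le_div_plus_1:
  fixes k m n :: nat
  assumes "0 < m" "0 < n"
  shows "real k / (real m * real n) \<le> real (k div m div n) + 1"
proof -
  have "k < m * n + k div (m * n) * (m * n)" using assms by (intro dividend_less_div_times) simp
  then have "real k < real (m * n + k div (m * n) * (m * n))" by (simp only: of_nat_less_iff)
  also have "\<dots> = (real (k div m div n) + 1) * (real m * real n)"
    by (simp add: div_mult2_eq algebra_simps)
  finally show ?thesis using assms by (simp add: pos_divide_le_eq)
qed

text \<open>
  The growth condition makes both the cluster size and the inverse pattern probability smaller than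
  any fixed power of \<open>L\<close>; the exponent \<open>1 / 4\<close> for each of them leaves \<open>L powr (1 / 2)\<close> for the
  expected number of realized patterns in a group. Since \<open>\<eta> \<le> 1 / 2\<close>, the bound on \<open>F * ln (1 / \<eta>)\<close>
  also bounds \<open>F\<close>, up to the factor \<open>ln 2\<close>.
\<close>

lemma miss_probability_tendsto_0:
  fixes \<eta> :: "nat \<Rightarrow> real" and F :: "nat \<Rightarrow> nat"
  assumes d: "d \<ge> 1" and h: "h \<ge> 1"
    and \<eta>: "eventually (\<lambda>L. 0 < \<eta> L) sequentially" "\<And>L. \<eta> L \<le> 1 / 2"
    and F: "eventually (\<lambda>L. 1 \<le> F L) sequentially"
    and growth: "(\<lambda>L. real (F L) * ln (1 / \<eta> L)) \<in> o[sequentially](\<lambda>L. ln (real (L ^ d)))"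
  shows "(\<lambda>L. real h * (1 - \<eta> L ^ (2 * d * (c + F L))) ^ (L div (2 * (r + F L) + 3) div h)) \<longlonglongrightarrow> 0"
proof -
  define a where "a L = real (F L) * ln (1 / \<eta> L)" for L
  \<comment> \<open>Chosen such that the exponent of the pattern probability is at most \<open>ln L / 4\<close>.\<close>
  define \<epsilon> where "\<epsilon> = 1 / (8 * real d * real d * (real c + 1))"
  define C where "C = (2 * real r + 5) * (\<epsilon> * real d) / ln 2"
  have \<epsilon>: "\<epsilon> > 0" using d by (simp add: \<epsilon>_def)
  have "eventually (\<lambda>L. norm (a L) \<le> \<epsilon> * norm (ln (real (L ^ d)))) sequentially"
    using landau_o.smallD[OF growth \<epsilon>] by (simp add: a_def)
  moreover have "eventually (\<lambda>L::nat. C * ln (real L) \<le> real L powr (1 / 4)) sequentially"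
    by real_asymp
  moreover have "eventually (\<lambda>L::nat. 1 \<le> L) sequentially" by (rule eventually_ge_at_top)
  ultimately have bound: "eventually (\<lambda>L. real h * (1 - \<eta> L ^ (2 * d * (c + F L))) ^ (L div (2 * (r + F L) + 3) div h)
      \<le> real h * exp (- (real L powr (1 / 2) / real h - real L powr (- (1 / 4))))) sequentially"
    using \<eta>(1) F
  proof eventually_elim
    case (elim L)
    let ?n = "2 * d * (c + F L)" and ?s = "2 * (r + F L) + 3"
    let ?M = "L div ?s div h" and ?p = "\<eta> L ^ (2 * d * (c + F L))"
    have F1: "1 \<le> real (F L)" and L1: "1 \<le> real L" using elim by auto
    have lnL: "0 \<le> ln (real L)" using L1 by simp
    have "2 \<le> 1 / \<eta> L" using \<eta>(2)[of L] elim(4) by (simp add: field_simps)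
    then have ln2: "ln 2 \<le> ln (1 / \<eta> L)" by (intro ln_mono) auto
    have ln2_pos: "0 < ln (2::real)" by simp
    have ln_nonneg: "0 \<le> ln (1 / \<eta> L)" using ln2 ln2_pos by linarith
    have "a L \<le> \<epsilon> * \<bar>ln (real (L ^ d))\<bar>" using elim(1) by simp
    also have "ln (real (L ^ d)) = real d * ln (real L)" using L1 by (simp add: ln_realpow)
    finally have aL: "a L \<le> \<epsilon> * real d * ln (real L)" using lnL by (simp add: abs_mult)
    have "real ?n * ln (1 / \<eta> L) \<le> (2 * real d * (real c + 1)) * a L"
    proof -
      have "real c + real (F L) \<le> (real c + 1) * real (F L)" using F1 by (simp add: algebra_simps mult_le_cancel_left1)
      then have "real ?n \<le> 2 * real d * ((real c + 1) * real (F L))" by (simp add: mult_left_mono)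
      then have "real ?n * ln (1 / \<eta> L) \<le> 2 * real d * ((real c + 1) * real (F L)) * ln (1 / \<eta> L)"
        using ln_nonneg by (rule mult_right_mono)
      then show ?thesis by (simp add: a_def mult.assoc)
    qed
    also have "\<dots> \<le> (2 * real d * (real c + 1)) * (\<epsilon> * real d * ln (real L))"
      using aL by (intro mult_left_mono) auto
    also have "\<dots> = ln (real L) / 4"
    proof -
      have "2 * D * k * (1 / (8 * D * D * k) * D * x) = x / 4" if "D > 0" "k > 0" for D k x :: real
        using that by (simp add: field_simps)
      from this[of "real d" "real c + 1"] show ?thesis using d unfolding \<epsilon>_def by simp
    qed
    finally have exponent: "real ?n * ln (1 / \<eta> L) \<le> ln (real L) / 4" .
    have "?p = exp (- (real ?n * ln (1 / \<eta> L)))"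
      using elim(4) by (simp add: ln_div exp_of_nat_mult[symmetric] exp_minus flip: powr_realpow) (simp add: powr_def)
    also have "\<dots> \<ge> exp (- (ln (real L) / 4))" using exponent by simp
    also have "exp (- (ln (real L) / 4)) = real L powr (- (1 / 4))" using L1 by (simp add: powr_def)
    finally have p: "real L powr (- (1 / 4)) \<le> ?p" .
    have "ln 2 * real (F L) \<le> a L" unfolding a_def using ln2 F1 by (simp add: mult.commute mult_left_mono)
    also note aL
    finally have F_le: "real (F L) \<le> \<epsilon> * real d * ln (real L) / ln 2"
      using ln2_pos by (simp add: field_simps)
    have "real r \<le> real r * real (F L)" using F1 by (simp add: mult_le_cancel_left1)
    then have "real ?s \<le> (2 * real r + 5) * real (F L)" using F1 by (simp add: algebra_simps)
    also have "\<dots> \<le> (2 * real r + 5) * (\<epsilon> * real d * ln (real L) / ln 2)"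
      using F_le by (intro mult_left_mono) auto
    also have "\<dots> = C * ln (real L)" by (simp add: C_def)
    also note elim(2)
    finally have s: "real ?s \<le> real L powr (1 / 4)" .
    have "real L powr (3 / 4) / real h = real L / (real L powr (1 / 4) * real h)"
    proof -
      have "real L powr (3 / 4) = real L powr 1 / real L powr (1 / 4)" using powr_diff[of "real L" 1 "1/4"] by simp
      then show ?thesis using L1 by simp
    qed
    also have "\<dots> \<le> real L / (real ?s * real h)"
      using s h L1 by (intro divide_left_mono mult_right_mono mult_pos_pos) auto
    finally have "real L powr (3 / 4) / real h \<le> real L / (real ?s * real h)" .
    moreover have "real L / (real ?s * real h) \<le> real ?M + 1"
      using h by (intro quotient_le_div_plus_1) auto
    ultimately have M: "real L powr (3 / 4) / real h - 1 \<le> real ?M" by linarith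
    have "real L powr (1 / 2) / real h - real L powr (- (1 / 4)) =
        real L powr (- (1 / 4)) * (real L powr (3 / 4) / real h - 1)"
      by (simp add: right_diff_distrib powr_add[symmetric])
    also have "\<dots> \<le> real L powr (- (1 / 4)) * real ?M" using M by (intro mult_left_mono) auto
    also have "\<dots> \<le> ?p * real ?M" using p by (intro mult_right_mono) auto
    finally have pM: "real L powr (1 / 2) / real h - real L powr (- (1 / 4)) \<le> ?p * real ?M" .
    have "?p \<le> 1" using elim(4) \<eta>(2)[of L] by (intro power_le_one) auto
    then have "(1 - ?p) ^ ?M \<le> exp (- ?p) ^ ?M"
      using exp_ge_add_one_self[of "- ?p"] by (intro power_mono) auto
    also have "\<dots> = exp (- (?p * real ?M))" by (simp add: exp_of_nat_mult[symmetric] mult.commute)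
    also have "\<dots> \<le> exp (- (real L powr (1 / 2) / real h - real L powr (- (1 / 4))))" using pM by simp
    finally show ?case by (intro mult_left_mono) auto
  qed
  have "real h > 0" using h by simp
  then have lim: "(\<lambda>L::nat. real h * exp (- (real L powr (1 / 2) / real h - real L powr (- (1 / 4))))) \<longlonglongrightarrow> 0"
    by real_asymp
  have nonneg: "eventually (\<lambda>L. 0 \<le> real h * (1 - \<eta> L ^ (2 * d * (c + F L))) ^ (L div (2 * (r + F L) + 3) div h)) sequentially"
    using \<eta>(1)
  proof eventually_elim
    case (elim L)
    then have "\<eta> L ^ (2 * d * (c + F L)) \<le> 1" using \<eta>(2)[of L] by (intro power_le_one) auto
    then show ?case by simp
  qed
  show ?thesis by (rule tendsto_sandwich[OF nonneg bound tendsto_const lim])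
qed

section \<open>Events with probability tending to one\<close>

definition whp :: "(nat \<Rightarrow> 'a pmf) \<Rightarrow> 'a set \<Rightarrow> bool" where
  "whp Y A \<longleftrightarrow> (\<lambda>L. measure_pmf.prob (Y L) A) \<longlonglongrightarrow> 1"

lemma whp_lower_bound:
  assumes "eventually (\<lambda>L. g L \<le> measure_pmf.prob (Y L) A) sequentially" "g \<longlonglongrightarrow> 1"
  shows "whp Y A"
  unfolding whp_def
  by (rule tendsto_sandwich[OF assms(1) _ assms(2) tendsto_const]) simp

lemma whp_mono:
  assumes A: "whp Y A" and sub: "eventually (\<lambda>L. \<forall>G\<in>set_pmf (Y L). G \<in> A \<longrightarrow> G \<in> B) sequentially"
  shows "whp Y B"
proof (rule whp_lower_bound)
  show "eventually (\<lambda>L. measure_pmf.prob (Y L) A \<le> measure_pmf.prob (Y L) B) sequentially"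
    using sub
  proof eventually_elim
    case (elim L)
    have "measure_pmf.prob (Y L) (A \<inter> set_pmf (Y L)) \<le> measure_pmf.prob (Y L) B"
      using elim by (intro measure_pmf.finite_measure_mono) auto
    then show ?case by (simp add: measure_Int_set_pmf)
  qed
qed (use A in \<open>simp add: whp_def\<close>)

lemma whp_UNIV: "whp Y UNIV"
  by (simp add: whp_def)

lemma whp_Int:
  assumes "whp Y A" "whp Y B"
  shows "whp Y (A \<inter> B)"
proof (rule whp_lower_bound)
  have "measure_pmf.prob (Y L) A + measure_pmf.prob (Y L) B - 1 \<le> measure_pmf.prob (Y L) (A \<inter> B)" for L
    using measure_pmf.finite_measure_Union'[of A "Y L" B] measure_pmf.finite_measure_Diff'[of B "Y L" A]
      measure_pmf.prob_le_1[of "Y L" "A \<union> B"] by (simp add: Int_commute)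
  then show "eventually (\<lambda>L. measure_pmf.prob (Y L) A + measure_pmf.prob (Y L) B - 1
      \<le> measure_pmf.prob (Y L) (A \<inter> B)) sequentially" by simp
  show "(\<lambda>L. measure_pmf.prob (Y L) A + measure_pmf.prob (Y L) B - 1) \<longlonglongrightarrow> 1"
    using tendsto_diff[OF tendsto_add[OF assms[unfolded whp_def]] tendsto_const[of 1]] by simp
qed

lemma whp_INT:
  assumes "finite I" "\<And>i. i \<in> I \<Longrightarrow> whp Y (A i)"
  shows "whp Y (\<Inter>i\<in>I. A i)"
  using assms by (induction I rule: finite_induct) (auto simp: whp_UNIV intro: whp_Int)

lemma whp_Compl: "whp Y (- A) \<Longrightarrow> (\<lambda>L. measure_pmf.prob (Y L) A) \<longlonglongrightarrow> 0"
proof -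
  assume "whp Y (- A)"
  moreover have "measure_pmf.prob (Y L) (- A) = 1 - measure_pmf.prob (Y L) A" for L
    using measure_pmf.prob_compl[of A "Y L"] by (simp add: Compl_eq_Diff_UNIV)
  ultimately have "(\<lambda>L. 1 - (1 - measure_pmf.prob (Y L) A)) \<longlonglongrightarrow> 1 - 1"
    unfolding whp_def by (intro tendsto_diff tendsto_const) simp
  then show ?thesis by simp
qed

lemma whp_nonempty:
  assumes "whp Y A"
  shows "A \<noteq> {}"
proof
  assume "A = {}"
  then have "(\<lambda>L. 0 :: real) \<longlonglongrightarrow> 1" using assms by (simp add: whp_def)
  then show False using LIMSEQ_unique[OF tendsto_const[of 0]] by force
qed

section \<open>The pruned percolation graph\<close>

lemma component_eq:
  assumes "w \<in> component G v"
  shows "component G w = component G v"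
proof -
  have "sym ((adj_rel G)\<^sup>*)" by (rule sym_rtrancl) (auto simp: sym_def adj_rel_def adj_sym)
  moreover have "(v, w) \<in> (adj_rel G)\<^sup>*" using assms by (simp add: component_def)
  ultimately have "(v, x) \<in> (adj_rel G)\<^sup>* \<longleftrightarrow> (w, x) \<in> (adj_rel G)\<^sup>*" for x
    by (metis rtrancl_trans symD)
  then show ?thesis by (simp add: component_def)
qed

lemma subgraph_prune: "subgraph G H \<Longrightarrow> subgraph (prune m G) H"
  by (fastforce simp: subgraph_def simple_graph_def prune_def induced_subgraph_def)

text \<open>
  Pruning removes whole components, so a surviving component is unchanged; in particular it is still
  large.
\<close>

lemma component_prune:
  assumes G: "simple_graph G" and v: "v \<in> verts (prune m G)"
  shows "component G v \<subseteq> component (prune m G) v"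
proof -
  let ?P = "prune m G"
  have vG: "v \<in> verts G" "m \<le> card (component G v)" using v by (auto simp: prune_def induced_subgraph_def)
  have P: "simple_graph ?P" using subgraph_prune[of G G m] G by (simp add: subgraph_def)
  have "nball G {v} r \<subseteq> nball ?P {v} r" for r
  proof (induction r)
    case (Suc r)
    have keep: "x \<in> verts G \<and> m \<le> card (component G x)" if "x \<in> nball G {v} j" for x j
    proof -
      have x: "x \<in> component G v" using that unfolding component_eq_nball[OF G vG(1)] by blast
      then show ?thesis using component_eq[OF x] vG(2) by (simp add: component_def)
    qed
    show ?case
    proof
      fix w assume w: "w \<in> nball G {v} (Suc r)"
      then consider "w \<in> nball G {v} r" | u where "u \<in> nball G {v} r" "adj G u w" by auto
      then show "w \<in> nball ?P {v} (Suc r)"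
      proof cases
        case 2
        then have "adj ?P u w" using keep[OF 2(1)] keep[OF w] by (simp add: prune_def adj_induced)
        moreover have "u \<in> nball ?P {v} r" using Suc 2(1) by blast
        ultimately show ?thesis by (intro nball_nbhd)
      qed (use Suc in auto)
    qed
  qed simp
  then show ?thesis unfolding component_eq_nball[OF G vG(1)] component_eq_nball[OF P v] by blast
qed

lemma pruned_percolation_support:
  assumes "G \<in> set_pmf (map_pmf (prune m) (percolation d L q))"
  shows "subgraph G (torus d L)" "\<And>v. v \<in> verts G \<Longrightarrow> m \<le> card (component G v)"
proof -
  obtain \<omega> where \<omega>: "G = prune m \<lparr>verts = verts (torus d L), edges = {e\<in>edges (torus d L). \<omega> e}\<rparr>"
    using assms by (auto simp: percolation_def)
  define H where "H = \<lparr>verts = verts (torus d L), edges = {e\<in>edges (torus d L). \<omega> e}\<rparr>"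
  have H: "subgraph H (torus d L)" "G = prune m H"
    using simple_torus[of d L] \<omega> by (simp_all add: H_def subgraph_def simple_graph_def subset_iff)
  show G: "subgraph G (torus d L)" using H subgraph_prune by blast
  fix v assume v: "v \<in> verts G"
  have "m \<le> card (component H v)" using v H(2) by (simp add: prune_def induced_subgraph_def)
  also have "\<dots> \<le> card (component G v)"
  proof (rule card_mono)
    have "component G v \<subseteq> verts (torus d L)" using subgraphD(2)[OF G] by (auto simp: component_def)
    then show "finite (component G v)" using finite_torus(1) finite_subset by blast
    show "component H v \<subseteq> component G v"
      using component_prune[OF subgraphD(1)[OF H(1)]] v H(2) by simp
  qed
  finally show "m \<le> card (component G v)" .
qed

text \<open>
  Finitely many axioms, with explicit bounds on the radii and on the sizes of components, suffice for
  richness. Therefore the lemma applies to models of the axioms and also to the random graph, which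
  for each fixed \<open>L\<close> satisfies only some of them.
\<close>

lemma richI:
  fixes G :: "'a ugraph"
  assumes d: "d \<ge> 1" and G: "simple_graph G"
    and deg: "\<forall>v\<in>verts G. finite (neighbours G v) \<and> card (neighbours G v) \<le> 2 * d"
    and comp: "\<And>m. 1 \<le> m \<Longrightarrow> m \<le> (2 * R + 1) ^ d \<Longrightarrow> \<not> (\<exists>v\<in>verts G. card (component G v) = m)"
    and lat: "\<And>r T t. r \<le> (2 * R + 1) ^ d + R \<Longrightarrow> ball_type r T t \<Longrightarrow> \<not> lattice_type d r T t \<Longrightarrow>
      \<not> (\<exists>v. has_ball_type G v r T t)"
    and many: "\<And>r T t. (r, T, t) \<in> ball_types (2 * d) R \<Longrightarrow> infinite_lattice_type d r T t \<Longrightarrow>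
      \<exists>S\<subseteq>{v. has_ball_type G v r T t}. finite S \<and> card S = h"
  shows "rich (infinite_lattice_type d) (2 * d) R h G"
proof -
  have "\<not> (\<exists>v. has_ball_type G v r T t)"
    if rT: "(r, T, t) \<in> ball_types (2 * d) R" and "\<not> infinite_lattice_type d r T t" for r T t
  proof
    assume "\<exists>v. has_ball_type G v r T t"
    then obtain v where v: "has_ball_type G v r T t" ..
    have r: "r \<le> R" "ball_type r T t" using rT by (auto simp: ball_types_def)
    have le: "(2 * r + 1) ^ d \<le> (2 * R + 1) ^ d" using r(1) by (intro power_mono) auto
    have "infinite_lattice_type d r T t"
    proof (rule infinite_lattice_type_realized[OF G _ _ _ r(2) v])
      show "finite (neighbours G v) \<and> card (neighbours G v) \<le> 2 * d" if "v \<in> verts G" for v using deg that by blast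
      show "card (component G v) \<noteq> m" if "1 \<le> m" "m \<le> (2 * r + 1) ^ d" "v \<in> verts G" for m v
        using comp[OF that(1)] that(2,3) le by auto
      show "lattice_type d ((2 * r + 1) ^ d + r) T t"
        if "ball_type ((2 * r + 1) ^ d + r) T t" "has_ball_type G v ((2 * r + 1) ^ d + r) T t" for T t v
        using lat[OF _ that(1)] that(2) le r(1) by auto
    qed
    then show False using that(2) by blast
  qed
  then show ?thesis using G deg many by (auto simp: rich_def)
qed

section \<open>A model of the axioms\<close>

lemma models_limit_axioms_iff:
  fixes G :: "'a ugraph"
  assumes G: "simple_graph G"
  shows "(\<forall>\<psi>\<in>limit_axioms d. models G \<psi>) \<longleftrightarrow>
    (\<forall>v\<in>verts G. finite (neighbours G v) \<and> card (neighbours G v) \<le> 2 * d) \<and>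
    (\<forall>r T t. ball_type r T t \<and> \<not> lattice_type d r T t \<longrightarrow> \<not> (\<exists>v. has_ball_type G v r T t)) \<and>
    (\<forall>m\<ge>1. \<not> (\<exists>v\<in>verts G. card (component G v) = m)) \<and>
    (\<forall>r T t h. ball_type r T t \<and> infinite_lattice_type d r T t \<and> h \<ge> 1 \<longrightarrow>
       (\<exists>S\<subseteq>{v. has_ball_type G v r T t}. finite S \<and> card S = h))"
proof -
  have 1: "models G (degree_axiom (2 * d)) \<longleftrightarrow>
      (\<forall>v\<in>verts G. finite (neighbours G v) \<and> card (neighbours G v) \<le> 2 * d)"
    using expresses_degree[of "2 * d"] G unfolding expresses_def by blast
  have 2: "models G (omit_type_axiom r T t) \<longleftrightarrow> \<not> (\<exists>v. has_ball_type G v r T t)"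
    if "ball_type r T t" for r T t
    using expresses_omit_type[OF that] G unfolding expresses_def by blast
  have 3: "models G (no_component_axiom m) \<longleftrightarrow> \<not> (\<exists>v\<in>verts G. card (component G v) = m)"
    if "m \<ge> 1" for m
    using expresses_no_component[OF that] G unfolding expresses_def by blast
  have 4: "models G (many_type_axiom h r T t) \<longleftrightarrow>
      (\<exists>S\<subseteq>{v. has_ball_type G v r T t}. finite S \<and> card S = h)" if "ball_type r T t" for h r T t
    using expresses_many_type[OF that, of h] G unfolding expresses_def by blast
  have "(\<forall>\<psi>\<in>limit_axioms d. models G \<psi>) \<longleftrightarrow> models G (degree_axiom (2 * d)) \<and>
    (\<forall>r T t. ball_type r T t \<and> \<not> lattice_type d r T t \<longrightarrow> models G (omit_type_axiom r T t)) \<and>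
    (\<forall>m\<ge>1. models G (no_component_axiom m)) \<and>
    (\<forall>r T t h. ball_type r T t \<and> infinite_lattice_type d r T t \<and> h \<ge> 1 \<longrightarrow> models G (many_type_axiom h r T t))"
    unfolding limit_axioms_def by blast
  then show ?thesis using 1 2 3 4 by auto
qed

lemma limit_axioms_sentence:
  assumes "\<psi> \<in> limit_axioms d"
  shows "sentence \<psi>"
proof -
  have "sentence (degree_axiom k)" for k
    using expresses_degree[of k] unfolding expresses_def by (rule conjunct1)
  moreover have "sentence (omit_type_axiom r T t)" if "ball_type r T t" for r T t
    using expresses_omit_type[OF that] unfolding expresses_def by (rule conjunct1)
  moreover have "sentence (no_component_axiom m)" if "m \<ge> 1" for m
    using expresses_no_component[OF that] unfolding expresses_def by (rule conjunct1)
  moreover have "sentence (many_type_axiom h r T t)" if "ball_type r T t" for h r T t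
    using expresses_many_type[OF that, of h] unfolding expresses_def by (rule conjunct1)
  ultimately show ?thesis using assms unfolding limit_axioms_def by blast
qed

lemma countable_finite_graphs:
  "countable {T :: nat ugraph. simple_graph T \<and> finite (verts T)}"
proof -
  let ?mk = "\<lambda>(V, E). \<lparr>verts = V, edges = E\<rparr> :: nat ugraph"
  let ?A = "Collect (finite :: nat set \<Rightarrow> bool)"
  have "{T :: nat ugraph. simple_graph T \<and> finite (verts T)} \<subseteq> ?mk ` (?A \<times> {E. finite E \<and> E \<subseteq> ?A})"
  proof
    fix T :: "nat ugraph" assume "T \<in> {T. simple_graph T \<and> finite (verts T)}"
    then have T: "simple_graph T" "finite (verts T)" by auto
    have "edges T \<subseteq> Pow (verts T)" using T(1) by (auto simp: simple_graph_def)
    then have "finite (edges T)" "\<forall>e\<in>edges T. finite e"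
      using T(2) finite_subset[of "edges T" "Pow (verts T)"] finite_subset[of _ "verts T"] by auto
    then have "finite (edges T)" "edges T \<subseteq> ?A" by auto
    moreover have "T = ?mk (verts T, edges T)" by simp
    ultimately show "T \<in> ?mk ` (?A \<times> {E. finite E \<and> E \<subseteq> ?A})" using T(2) by blast
  qed
  moreover have "countable (?mk ` (?A \<times> {E. finite E \<and> E \<subseteq> ?A}))"
    by (intro countable_image countable_SIGMA countable_Collect_finite countable_Collect_finite_subset)
  ultimately show ?thesis using countable_subset by blast
qed

text \<open>
  Disjoint union of infinitely many copies of an infinite lattice component for every infinite lattice
  type. As there are countably many types and the lattice is countable, the union embeds into any
  infinite type \<open>'v\<close>.
\<close>

theorem limit_axioms_satisfiable:
  "\<exists>G :: 'v::infinite ugraph. simple_graph G \<and> (\<forall>\<psi>\<in>limit_axioms d. models G \<psi>)"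
proof -
  define I where "I = {(r, T, t). ball_type r T t \<and> infinite_lattice_type d r T t}"
  have "\<forall>i\<in>I. \<exists>Xv. subgraph (fst Xv) (lattice d) \<and> infinite (component (fst Xv) (snd Xv)) \<and>
      has_ball_type (fst Xv) (snd Xv) (fst i) (fst (snd i)) (snd (snd i))"
    by (auto simp: I_def infinite_lattice_type_def)
  then obtain Xv where Xv: "\<forall>i\<in>I. subgraph (fst (Xv i)) (lattice d) \<and>
      infinite (component (fst (Xv i)) (snd (Xv i))) \<and>
      has_ball_type (fst (Xv i)) (snd (Xv i)) (fst i) (fst (snd i)) (snd (snd i))"
    by (rule bchoice[THEN exE])
  define X where "X j = fst (Xv (fst j))" for j :: "(nat \<times> nat ugraph \<times> nat) \<times> nat"
  define c where "c j = snd (Xv (fst j))" for j :: "(nat \<times> nat ugraph \<times> nat) \<times> nat"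
  let ?J = "I \<times> (UNIV :: nat set)"
  have X: "subgraph (X j) (lattice d)" "infinite (component (X j) (c j))"
      "has_ball_type (X j) (c j) (fst (fst j)) (fst (snd (fst j))) (snd (snd (fst j)))" if "j \<in> ?J" for j
    using Xv that by (auto simp: X_def c_def)
  have sX: "simple_graph (X j)" if "j \<in> ?J" for j using subgraphD(1)[OF X(1)[OF that]] .
  let ?W = "\<lambda>j. component (X j) (c j)"
  define P where "P = (SIGMA j:?J. ?W j)"
  have "countable I"
  proof (rule countable_subset)
    show "I \<subseteq> UNIV \<times> {T. simple_graph T \<and> finite (verts T)} \<times> UNIV" by (auto simp: I_def ball_type_def)
    show "countable (UNIV \<times> {T :: nat ugraph. simple_graph T \<and> finite (verts T)} \<times> (UNIV :: nat set) :: (nat \<times> _) set)"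
      by (intro countable_SIGMA countable_finite_graphs) auto
  qed
  moreover have "countable (?W j)" if "j \<in> ?J" for j
  proof (rule countable_subset)
    show "?W j \<subseteq> {..<d} \<rightarrow>\<^sub>E (UNIV :: int set)"
      using subgraphD(2)[OF X(1)[OF that]] by (auto simp: component_def lattice_def)
  qed (auto intro: countable_PiE)
  ultimately have "countable P" unfolding P_def by (intro countable_SIGMA) auto
  then obtain e0 :: "_ \<Rightarrow> nat" where e0: "inj_on e0 P" by (auto simp: countable_def)
  obtain e1 :: "nat \<Rightarrow> 'v" where e1: "inj e1"
    using infinite_countable_subset[OF infinite_UNIV] by blast
  define e where "e = e1 \<circ> e0"
  have e: "inj_on e P" unfolding e_def using e0 e1 by (intro comp_inj_on) (auto intro: inj_on_subset)
  define N where "N = \<lparr>verts = e ` P,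
    edges = {{u, w} | u w. \<exists>j x y. (j, x) \<in> P \<and> (j, y) \<in> P \<and> u = e (j, x) \<and> w = e (j, y) \<and> adj (X j) x y}\<rparr>"
  have adjN: "adj N u w \<longleftrightarrow> (\<exists>j x y. (j, x) \<in> P \<and> (j, y) \<in> P \<and> u = e (j, x) \<and> w = e (j, y) \<and> adj (X j) x y)"
    for u w
  proof (rule adj_iff_edge_relation)
    fix u w assume "\<exists>j x y. (j, x) \<in> P \<and> (j, y) \<in> P \<and> u = e (j, x) \<and> w = e (j, y) \<and> adj (X j) x y"
    then show "\<exists>j x y. (j, x) \<in> P \<and> (j, y) \<in> P \<and> w = e (j, x) \<and> u = e (j, y) \<and> adj (X j) x y"
      using adj_sym by metis
  qed (simp add: N_def)
  have adjN': "adj N (e (j, x)) w \<longleftrightarrow> (\<exists>y. (j, y) \<in> P \<and> w = e (j, y) \<and> adj (X j) x y)"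
    if "(j, x) \<in> P" for j x w
  proof
    assume "adj N (e (j, x)) w"
    then obtain j' x' y where *: "(j', x') \<in> P" "(j', y) \<in> P" "e (j, x) = e (j', x')" "w = e (j', y)" "adj (X j') x' y"
      unfolding adjN by blast
    then have "(j, x) = (j', x')" using inj_onD[OF e *(3) that *(1)] by simp
    then show "\<exists>y. (j, y) \<in> P \<and> w = e (j, y) \<and> adj (X j) x y" using * by blast
  qed (use that adjN in blast)
  have simpleN: "simple_graph N"
    unfolding simple_graph_def
  proof
    fix E assume "E \<in> edges N"
    then obtain j x y where *: "E = {e (j, x), e (j, y)}" "(j, x) \<in> P" "(j, y) \<in> P" "adj (X j) x y"
      unfolding N_def by auto
    have "j \<in> ?J" using *(2) by (simp add: P_def)
    then have "x \<noteq> y" using simple_adj(3)[OF sX *(4)] by blast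
    then have "e (j, x) \<noteq> e (j, y)" using inj_onD[OF e _ *(2,3)] by auto
    moreover have "e (j, x) \<in> verts N" "e (j, y) \<in> verts N" using *(2,3) by (auto simp: N_def)
    ultimately show "\<exists>u\<in>verts N. \<exists>v\<in>verts N. u \<noteq> v \<and> E = {u, v}" using *(1) by blast
  qed
  have iso: "ball_iso (X j) {x} N (\<lambda>y. e (j, y)) r" if p: "(j, x) \<in> P" for j x r
  proof (rule ball_isoI[where W = "?W j"])
    have j: "j \<in> ?J" and x: "x \<in> ?W j" using p by (auto simp: P_def)
    have xV: "x \<in> verts (X j)" using x by (simp add: component_def)
    have PW: "(j, y) \<in> P \<longleftrightarrow> y \<in> ?W j" for y using j by (auto simp: P_def)
    show "inj_on (\<lambda>y. e (j, y)) (?W j)" using inj_onD[OF e] PW by (intro inj_onI) blast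
    show "adj (X j) y z \<longleftrightarrow> adj N (e (j, y)) (e (j, z))" if "y \<in> ?W j" "z \<in> ?W j" for y z
    proof -
      have "z = z'" if "(j, z') \<in> P" "e (j, z) = e (j, z')" for z'
        using inj_onD[OF e that(2) _ that(1)] PW \<open>z \<in> ?W j\<close> by simp
      then show ?thesis using that adjN'[of j y "e (j, z)"] PW by blast
    qed
    show "nball (X j) {x} r \<subseteq> ?W j"
      using component_eq[OF x] component_eq_nball[OF sX[OF j] xV] by blast
    show "nball N ((\<lambda>y. e (j, y)) ` {x}) r \<subseteq> (\<lambda>y. e (j, y)) ` ?W j"
    proof (induction r)
      case (Suc r)
      have "w \<in> (\<lambda>y. e (j, y)) ` ?W j" if "u \<in> (\<lambda>y. e (j, y)) ` ?W j" "adj N u w" for u w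
        using that adjN' PW by blast
      then show ?case using Suc by (simp add: subset_iff) blast
    qed (use x in simp)
  qed
  have type_lift: "has_ball_type N (e (j, x)) r T t" if p: "(j, x) \<in> P" and "ball_type r T t" "has_ball_type (X j) x r T t" for j x r T t
  proof -
    have "j \<in> ?J" using p by (simp add: P_def)
    then show ?thesis
      using has_ball_type_transfer[OF sX simpleN that(2,3) iso[OF p]] p by (simp add: N_def)
  qed
  have type_proj: "has_ball_type (X j) x r T t" if p: "(j, x) \<in> P" and "ball_type r T t" "has_ball_type N (e (j, x)) r T t" for j x r T t
  proof -
    have j: "j \<in> ?J" and x: "x \<in> verts (X j)" using p by (auto simp: P_def component_def)
    obtain g where g: "ball_iso N ((\<lambda>y. e (j, y)) ` {x}) (X j) g r" "g ` (\<lambda>y. e (j, y)) ` {x} = {x}"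
      using ball_iso_inv[OF iso[OF p, of r]] by metis
    have "has_ball_type (X j) (g (e (j, x))) r T t"
      using g x by (intro has_ball_type_transfer[OF simpleN sX[OF j] that(2,3)]) auto
    then show ?thesis using g(2) by simp
  qed
  have deg: "finite (neighbours N u) \<and> card (neighbours N u) \<le> 2 * d" if u: "u \<in> verts N" for u
  proof -
    obtain j x where p: "(j, x) \<in> P" "u = e (j, x)" using u by (auto simp: N_def)
    have j: "j \<in> ?J" using p(1) by (simp add: P_def)
    have "neighbours N u \<subseteq> (\<lambda>y. e (j, y)) ` neighbours (X j) x"
    proof
      fix w assume "w \<in> neighbours N u"
      then obtain y where "w = e (j, y)" "adj (X j) x y"
        using adjN'[OF p(1)] p(2) by (auto simp: neighbours_def)
      then show "w \<in> (\<lambda>y. e (j, y)) ` neighbours (X j) x"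
        using simple_adj(2)[OF sX[OF j]] by (simp add: neighbours_def)
    qed
    moreover have "finite (neighbours (X j) x)" "card (neighbours (X j) x) \<le> 2 * d"
      using lattice_degree[OF X(1)[OF j]] by auto
    ultimately show ?thesis by (metis card_image_le card_mono finite_imageI finite_subset le_trans)
  qed
  have comp: "infinite (component N u)" if u: "u \<in> verts N" for u
  proof -
    obtain j x where p: "(j, x) \<in> P" "u = e (j, x)" using u by (auto simp: N_def)
    have j: "j \<in> ?J" and x: "x \<in> ?W j" and xV: "x \<in> verts (X j)"
      using p(1) by (auto simp: P_def component_def)
    have "nball N {u} r = (\<lambda>y. e (j, y)) ` nball (X j) {x} r" for r
      using ball_iso_image[OF iso[OF p(1)], of r] p(2) by simp
    then have "component N u = (\<lambda>y. e (j, y)) ` component (X j) x"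
      unfolding component_eq_nball[OF simpleN u] component_eq_nball[OF sX[OF j] xV] by blast
    moreover have "inj_on (\<lambda>y. e (j, y)) (?W j)"
      using j by (intro inj_onI) (auto simp: P_def dest: inj_onD[OF e])
    ultimately show ?thesis using X(2)[OF j] component_eq[OF x] finite_imageD by metis
  qed
  have omit: "\<not> (\<exists>v. has_ball_type N v r T t)" if "ball_type r T t" "\<not> lattice_type d r T t" for r T t
  proof
    assume "\<exists>v. has_ball_type N v r T t"
    then obtain v where v: "has_ball_type N v r T t" ..
    then have "v \<in> verts N" by (simp add: has_ball_type_def)
    then obtain j x where p: "(j, x) \<in> P" "v = e (j, x)" by (auto simp: N_def)
    have "j \<in> ?J" using p(1) by (simp add: P_def)
    then show False
      using lattice_type_of_lattice_subgraph[OF X(1) that(1) type_proj[OF p(1) that(1)]] v p(2) that(2) by blast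
  qed
  have many: "\<exists>S\<subseteq>{v. has_ball_type N v r T t}. finite S \<and> card S = h"
    if T: "ball_type r T t" "infinite_lattice_type d r T t" for r T t h
  proof -
    \<comment> \<open>The second component of an index numbers the copies.\<close>
    let ?j = "\<lambda>k. ((r, T, t), k :: nat)" and ?p = "\<lambda>k. (((r, T, t), k :: nat), c ((r, T, t), k))"
    have j: "?j k \<in> ?J" for k using T by (simp add: I_def)
    have ty: "has_ball_type (X (?j k)) (c (?j k)) r T t" for k using X(3)[OF j[of k]] by simp
    then have "c (?j k) \<in> ?W (?j k)" for k by (simp add: has_ball_type_def component_def)
    then have p: "?p k \<in> P" for k using j by (simp add: P_def)
    have "inj_on (\<lambda>k. e (?p k)) {..<h}" using inj_onD[OF e _ p p] by (intro inj_onI) blast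
    then have "card ((\<lambda>k. e (?p k)) ` {..<h}) = h" by (simp add: card_image)
    moreover have "(\<lambda>k. e (?p k)) ` {..<h} \<subseteq> {v. has_ball_type N v r T t}"
      using type_lift[OF p T(1) ty] by blast
    ultimately show ?thesis by (intro exI[of _ "(\<lambda>k. e (?p k)) ` {..<h}"]) simp
  qed
  have "\<forall>\<psi>\<in>limit_axioms d. models N \<psi>"
    unfolding models_limit_axioms_iff[OF simpleN]
    using deg omit many comp by (auto simp: card_eq_0_iff)
  then show ?thesis using simpleN by blast
qed

section \<open>The zero--one law and the almost sure theory\<close>

lemma rich_of_limit_axioms:
  assumes "d \<ge> 1" "simple_graph G" "\<forall>\<psi>\<in>limit_axioms d. models G \<psi>" "h \<ge> 1"
  shows "rich (infinite_lattice_type d) (2 * d) R h G"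
  using assms(3,4) unfolding models_limit_axioms_iff[OF assms(2)]
  by (intro richI[OF assms(1,2)]) (auto simp: ball_types_def)

theorem theorem1p3:
  fixes d :: nat and q :: "nat \<Rightarrow> real" and f :: "nat \<Rightarrow> nat"
    and Y :: "nat \<Rightarrow> (nat \<Rightarrow> int) ugraph pmf"
  assumes d: "d \<ge> 1"
    and q: "\<And>L. L \<ge> 1 \<Longrightarrow> q (L ^ d) \<in> {0..1}"
    and f: "\<And>n. n \<ge> 1 \<Longrightarrow> f n \<ge> 1"
    and eta_pos: "eventually (\<lambda>L. min (1 - q (L ^ d)) (q (L ^ d)) > 0) sequentially"
    and f_lim: "filterlim (\<lambda>L. f (L ^ d)) at_top sequentially"
    and f_growth:
      "(\<lambda>L. real (f (L ^ d)) * ln (1 / min (1 - q (L ^ d)) (q (L ^ d))))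
         \<in> o[sequentially](\<lambda>L. ln (real (L ^ d)))"
    and Y: "\<And>L. Y L = map_pmf (prune (f (L ^ d))) (percolation d L (q (L ^ d)))"
  shows "zero_one_law Y \<and>
    limit_axioms d \<subseteq> almost_sure_theory Y \<and>
    almost_sure_theory Y = consequences TYPE('v::infinite) (limit_axioms d) \<and>
    (\<forall>k. expresses (degree_axiom k)
       (\<lambda>G :: 'w ugraph. \<forall>v\<in>verts G. finite (neighbours G v) \<and> card (neighbours G v) \<le> k)) \<and>
    (\<forall>r T t. ball_type r T t \<longrightarrow>
       expresses (omit_type_axiom r T t) (\<lambda>G :: 'w ugraph. \<not> (\<exists>v. has_ball_type G v r T t))) \<and>
    (\<forall>m\<ge>1. expresses (no_component_axiom m)
       (\<lambda>G :: 'w ugraph. \<not> (\<exists>v\<in>verts G. card (component G v) = m))) \<and>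
    (\<forall>r T t. ball_type r T t \<longrightarrow> (\<forall>h\<ge>1. expresses (many_type_axiom h r T t)
       (\<lambda>G :: 'w ugraph. \<exists>S\<subseteq>{v. has_ball_type G v r T t}. finite S \<and> card S = h)))"
proof -
  have sub: "subgraph G (torus d L)" if "G \<in> set_pmf (Y L)" for G L
    using that pruned_percolation_support(1) unfolding Y by blast
  have comp: "f (L ^ d) \<le> card (component G v)" if "G \<in> set_pmf (Y L)" "v \<in> verts G" for G L v
    using that pruned_percolation_support(2) unfolding Y by blast
  have simple: "simple_graph G" if "G \<in> set_pmf (Y L)" for G L
    using subgraphD(1)[OF sub[OF that]] .
  have deg: "\<forall>v\<in>verts G. finite (neighbours G v) \<and> card (neighbours G v) \<le> 2 * d"
    if "G \<in> set_pmf (Y L)" for G L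
    using torus_degree[OF sub[OF that]] by blast
  have omit: "eventually (\<lambda>L. \<forall>G\<in>set_pmf (Y L). \<forall>r T t. r \<le> R \<and> ball_type r T t \<and> \<not> lattice_type d r T t \<longrightarrow>
      \<not> (\<exists>v. has_ball_type G v r T t)) sequentially" for R
    using eventually_ge_at_top[of "2 * R + 2"]
  proof eventually_elim
    case (elim L)
    then show ?case using lattice_type_of_torus_subgraph[OF sub] by (meson add_le_mono1 le_trans mult_le_mono2)
  qed
  have no_comp: "eventually (\<lambda>L. \<forall>G\<in>set_pmf (Y L). \<forall>m\<le>M. \<not> (\<exists>v\<in>verts G. card (component G v) = m)) sequentially" for M
    using f_lim[unfolded filterlim_at_top, rule_format, of "Suc M"]
  proof eventually_elim
    case (elim L)
    then show ?case using comp by fastforce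
  qed
  have many: "whp Y {G. \<exists>S\<subseteq>{w. has_ball_type G w r T t}. finite S \<and> card S = h}"
    if T: "ball_type r T t" "infinite_lattice_type d r T t" and h: "h \<ge> 1" for r T t h
  proof -
    obtain X v where X: "subgraph X (lattice d)" "infinite (component X v)" "has_ball_type X v r T t"
      using T(2) by (auto simp: infinite_lattice_type_def)
    let ?\<eta> = "\<lambda>L. min (1 - q (L ^ d)) (q (L ^ d))" and ?c = "card (nball X {v} r)"
    let ?g = "\<lambda>L. real h * (1 - ?\<eta> L ^ (2 * d * (?c + f (L ^ d)))) ^ (L div (2 * (r + f (L ^ d)) + 3) div h)"
    have "eventually (\<lambda>L. 1 \<le> f (L ^ d)) sequentially"
      using f_lim unfolding filterlim_at_top by blast
    moreover have "?\<eta> L \<le> 1 / 2" for L by (simp add: min_def)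
    ultimately have "?g \<longlonglongrightarrow> 0"
      by (intro miss_probability_tendsto_0[OF d h eta_pos _ _ f_growth])
    then have lim: "(\<lambda>L. 1 - ?g L) \<longlonglongrightarrow> 1" using tendsto_diff[OF tendsto_const[of 1]] by fastforce
    show ?thesis
    proof (rule whp_lower_bound[OF _ lim])
      show "eventually (\<lambda>L. 1 - ?g L \<le> measure_pmf.prob (Y L)
          {G. \<exists>S\<subseteq>{w. has_ball_type G w r T t}. finite S \<and> card S = h}) sequentially"
        using eventually_ge_at_top[of 1]
      proof eventually_elim
        case (elim L)
        then show ?case
          unfolding Y using prob_many_type_ge[OF X(1,2) T(1) X(3) d, of "q (L ^ d)" h "f (L ^ d)" L] q[of L] by simp
      qed
    qed
  qed
  have rich: "whp Y {G. rich (infinite_lattice_type d) (2 * d) R h G}" if h: "h \<ge> 1" for R h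
  proof -
    let ?I = "{(r, T, t)\<in>ball_types (2 * d) R. infinite_lattice_type d r T t}"
    let ?A = "\<lambda>(r, T, t). {G :: (nat \<Rightarrow> int) ugraph. \<exists>S\<subseteq>{w. has_ball_type G w r T t}. finite S \<and> card S = h}"
    have "finite ?I" by (rule finite_subset[OF _ finite_ball_types]) auto
    then have "whp Y (\<Inter>i\<in>?I. ?A i)"
    proof (rule whp_INT)
      fix i assume i: "i \<in> ?I"
      obtain r T t where "i = (r, T, t)" by (cases i)
      then show "whp Y (?A i)" using many[of r T t h] i h by (simp add: ball_types_def)
    qed
    then show ?thesis
    proof (rule whp_mono)
      show "eventually (\<lambda>L. \<forall>G\<in>set_pmf (Y L). G \<in> (\<Inter>i\<in>?I. ?A i) \<longrightarrow>
          G \<in> {G. rich (infinite_lattice_type d) (2 * d) R h G}) sequentially"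
        using omit[of "(2 * R + 1) ^ d + R"] no_comp[of "(2 * R + 1) ^ d"]
      proof eventually_elim
        case (elim L)
        show ?case
        proof (intro ballI impI CollectI)
          fix G assume G: "G \<in> set_pmf (Y L)" "G \<in> (\<Inter>i\<in>?I. ?A i)"
          show "rich (infinite_lattice_type d) (2 * d) R h G"
          proof (rule richI[OF d simple[OF G(1)] deg[OF G(1)]])
            show "\<exists>S\<subseteq>{v. has_ball_type G v r T t}. finite S \<and> card S = h"
              if "(r, T, t) \<in> ball_types (2 * d) R" "infinite_lattice_type d r T t" for r T t
              using INT_D[OF G(2), of "(r, T, t)"] that by simp
            show "\<not> (\<exists>v. has_ball_type G v r T t)"
              if "r \<le> (2 * R + 1) ^ d + R" "ball_type r T t" "\<not> lattice_type d r T t" for r T t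
              using bspec[OF elim(1) G(1)] that by simp
            show "\<not> (\<exists>v\<in>verts G. card (component G v) = m)" if "m \<le> (2 * R + 1) ^ d" for m
              using bspec[OF elim(2) G(1)] that by simp
          qed
        qed
      qed
    qed
  qed
  have axioms: "whp Y {G. models G \<psi>}" if \<psi>: "\<psi> \<in> limit_axioms d" for \<psi>
  proof -
    from \<psi> consider "\<psi> = degree_axiom (2 * d)"
      | r T t where "\<psi> = omit_type_axiom r T t" "ball_type r T t" "\<not> lattice_type d r T t"
      | m where "\<psi> = no_component_axiom m" "m \<ge> 1"
      | h r T t where "\<psi> = many_type_axiom h r T t" "ball_type r T t" "infinite_lattice_type d r T t" "h \<ge> 1"
      unfolding limit_axioms_def by blast
    then show ?thesis
    proof cases
      case 1
      then have "models G \<psi>" if "G \<in> set_pmf (Y L)" for G L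
        using expresses_degree deg[OF that] simple[OF that] unfolding expresses_def by blast
      then show ?thesis by (intro whp_mono[OF whp_UNIV]) simp
    next
      case 2
      show ?thesis
      proof (rule whp_mono[OF whp_UNIV])
        show "eventually (\<lambda>L. \<forall>G\<in>set_pmf (Y L). G \<in> UNIV \<longrightarrow> G \<in> {G. models G \<psi>}) sequentially"
          using omit[of r]
        proof eventually_elim
          case (elim L)
          then show ?case
            using expresses_omit_type[OF 2(2)] simple 2 unfolding expresses_def by blast
        qed
      qed
    next
      case 3
      show ?thesis
      proof (rule whp_mono[OF whp_UNIV])
        show "eventually (\<lambda>L. \<forall>G\<in>set_pmf (Y L). G \<in> UNIV \<longrightarrow> G \<in> {G. models G \<psi>}) sequentially"
          using no_comp[of m]
        proof eventually_elim
          case (elim L)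
          then show ?case
            using expresses_no_component[OF 3(2)] simple 3(1) unfolding expresses_def by blast
        qed
      qed
    next
      case 4
      show ?thesis
      proof (rule whp_mono[OF many[OF 4(2-4)]])
        show "eventually (\<lambda>L. \<forall>G\<in>set_pmf (Y L).
            G \<in> {G. \<exists>S\<subseteq>{w. has_ball_type G w r T t}. finite S \<and> card S = h} \<longrightarrow> G \<in> {G. models G \<psi>}) sequentially"
        proof (intro always_eventually allI ballI impI)
          fix L and G :: "(nat \<Rightarrow> int) ugraph"
          assume G: "G \<in> set_pmf (Y L)"
            "G \<in> {G. \<exists>S\<subseteq>{w. has_ball_type G w r T t}. finite S \<and> card S = h}"
          have "expresses \<psi> (\<lambda>G :: (nat \<Rightarrow> int) ugraph.
              \<exists>S\<subseteq>{w. has_ball_type G w r T t}. finite S \<and> card S = h)"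
            unfolding 4(1) by (rule expresses_many_type[OF 4(2)])
          then show "G \<in> {G. models G \<psi>}"
            using G(2) simple[OF G(1)] unfolding expresses_def by simp
        qed
      qed
    qed
  qed
  have transfer: "whp Y {G. models G \<phi> \<longleftrightarrow> models N \<phi>}"
    if \<phi>: "sentence \<phi>" and N: "simple_graph N" "\<forall>\<psi>\<in>limit_axioms d. models N \<psi>" for \<phi> and N :: "'v ugraph"
  proof -
    let ?R = "radius (quant_rank \<phi>)"
    \<comment> \<open>Large enough for a game with \<open>quant_rank \<phi>\<close> rounds.\<close>
    let ?h = "Suc (quant_rank \<phi> * (2 * d + 1) ^ ?R)"
    have richN: "rich (infinite_lattice_type d) (2 * d) ?R ?h N"
      by (rule rich_of_limit_axioms[OF d N]) simp
    have "models G \<phi> \<longleftrightarrow> models N \<phi>" if "rich (infinite_lattice_type d) (2 * d) ?R ?h G" for G :: "(nat \<Rightarrow> int) ugraph"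
      using rich_models_iff[OF \<phi> that richN] by simp
    then show ?thesis by (intro whp_mono[OF rich[of ?h ?R]]) auto
  qed
  obtain N :: "'v ugraph" where N: "simple_graph N" "\<forall>\<psi>\<in>limit_axioms d. models N \<psi>"
    using limit_axioms_satisfiable by blast
  have "zero_one_law Y"
    unfolding zero_one_law_def
  proof (intro allI impI)
    fix \<phi> assume \<phi>: "sentence \<phi>"
    show "(\<lambda>L. measure_pmf.prob (Y L) {G. models G \<phi>}) \<longlonglongrightarrow> 0 \<or>
      (\<lambda>L. measure_pmf.prob (Y L) {G. models G \<phi>}) \<longlonglongrightarrow> 1"
    proof (cases "models N \<phi>")
      case True
      then show ?thesis using transfer[OF \<phi> N] by (simp add: whp_def)
    next
      case False
      then have "whp Y (- {G. models G \<phi>})" using transfer[OF \<phi> N] by (simp add: Collect_neg_eq)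
      then show ?thesis using whp_Compl by blast
    qed
  qed
  moreover have "limit_axioms d \<subseteq> almost_sure_theory Y"
    using axioms limit_axioms_sentence by (auto simp: almost_sure_theory_def whp_def)
  moreover have "almost_sure_theory Y = consequences TYPE('v) (limit_axioms d)"
  proof (intro set_eqI iffI)
    fix \<phi> assume "\<phi> \<in> almost_sure_theory Y"
    then have \<phi>: "sentence \<phi>" "whp Y {G. models G \<phi>}" by (auto simp: almost_sure_theory_def whp_def)
    have "models K \<phi>" if "simple_graph K" "\<forall>\<psi>\<in>limit_axioms d. models K \<psi>" for K :: "'v ugraph"
      using whp_nonempty[OF whp_Int[OF \<phi>(2) transfer[OF \<phi>(1) that]]] by blast
    then show "\<phi> \<in> consequences TYPE('v) (limit_axioms d)" using \<phi>(1) by (simp add: consequences_def)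
  next
    fix \<phi> assume "\<phi> \<in> consequences TYPE('v) (limit_axioms d)"
    then have \<phi>: "sentence \<phi>" "models N \<phi>" using N by (auto simp: consequences_def)
    then show "\<phi> \<in> almost_sure_theory Y"
      using transfer[OF \<phi>(1) N] by (simp add: almost_sure_theory_def whp_def)
  qed
  ultimately show ?thesis
    using expresses_degree expresses_omit_type expresses_no_component expresses_many_type by blast
qed

end
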